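(* Let $R$ be a commutative noetherian local ring and let $M$ and $N$ be finitely generated $R$-modules. Then $$\bigcup_{i\ge 0}\operatorname{Supp}(\operatorname{Ext}^i_R(M\otimes_R N,R))=\bigcup_{i\ge 0}\operatorname{Supp}(\operatorname{Ext}^i_R(M,N))=\Big(\bigcup_{i\ge 0}\operatorname{Supp}(\operatorname{Ext}^i_R(M,R))\Big)\cap\Big(\bigcup_{i\ge 0}\operatorname{Supp}(\operatorname{Ext}^i_R(N,R))\Big).$$ In particular, $\bigcup_{i\ge 0}\operatorname{Supp}(\operatorname{Ext}^i_R(M,M))=\bigcup_{i\ge 0}\operatorname{Supp}(\operatorname{Ext}^i_R(M,R))$. *)

theory Defs
  imports "HOL-Algebra.Ring_Divisibility" "HOL-Algebra.Module"
begin

text \<open>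
  Modules are the \<^const>\<open>module\<close>s of HOL-Algebra. Their record type inherits the two
  multiplicative ring fields, which have no meaning for a module and are left \<^const>\<open>undefined\<close>
  in the constructions below.
\<close>

section \<open>Rings and finitely generated modules\<close>

text \<open>The zero ring has no maximal ideal, so a local ring is nonzero.\<close>

definition local_ring :: "('r, 'k) ring_scheme \<Rightarrow> bool" where
  "local_ring R \<longleftrightarrow> cring R \<and> (\<exists>!I. maximalideal I R)"

definition regular_module :: "('r, 'k) ring_scheme \<Rightarrow> ('r, 'r) module" where
  "regular_module R =
     \<lparr>carrier = carrier R, mult = mult R, one = one R, zero = zero R, add = add R,
      smult = mult R\<rparr>"

definition module_span ::
    "('r, 'k) ring_scheme \<Rightarrow> ('r, 'm, 'l) module_scheme \<Rightarrow> 'm set \<Rightarrow> 'm set" where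
  "module_span R M S = \<Inter>{K. submodule K R M \<and> S \<subseteq> K}"

definition finitely_generated ::
    "('r, 'k) ring_scheme \<Rightarrow> ('r, 'm, 'l) module_scheme \<Rightarrow> bool" where
  "finitely_generated R M \<longleftrightarrow>
     (\<exists>S. finite S \<and> S \<subseteq> carrier M \<and> module_span R M S = carrier M)"


section \<open>Quotients, homomorphisms, free modules, tensor products\<close>

definition quotient_module ::
    "('r, 'm, 'l) module_scheme \<Rightarrow> 'm set \<Rightarrow> ('r, 'm set) module" where
  "quotient_module M K =
     \<lparr>carrier = a_rcosets\<^bsub>M\<^esub> K, mult = undefined, one = undefined,
      zero = K, add = set_add M,
      smult = (\<lambda>r A. \<Union>x\<in>A. K +>\<^bsub>M\<^esub> (r \<odot>\<^bsub>M\<^esub> x))\<rparr>"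

text \<open>Linear maps are made extensional outside the carrier, so that equality of functions is
  equality of maps.\<close>

definition module_hom ::
    "('r, 'k) ring_scheme \<Rightarrow> ('r, 'm, 'l) module_scheme \<Rightarrow> ('r, 'n, 'l2) module_scheme
      \<Rightarrow> ('m \<Rightarrow> 'n) set" where
  "module_hom R M N =
     {h \<in> carrier M \<rightarrow>\<^sub>E carrier N.
        (\<forall>x\<in>carrier M. \<forall>y\<in>carrier M. h (x \<oplus>\<^bsub>M\<^esub> y) = h x \<oplus>\<^bsub>N\<^esub> h y) \<and>
        (\<forall>r\<in>carrier R. \<forall>x\<in>carrier M. h (r \<odot>\<^bsub>M\<^esub> x) = r \<odot>\<^bsub>N\<^esub> h x)}"

definition Hom_module ::
    "('r, 'k) ring_scheme \<Rightarrow> ('r, 'm, 'l) module_scheme \<Rightarrow> ('r, 'n, 'l2) module_scheme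
      \<Rightarrow> ('r, 'm \<Rightarrow> 'n) module" where
  "Hom_module R M N =
     \<lparr>carrier = module_hom R M N, mult = undefined, one = undefined,
      zero = (\<lambda>x\<in>carrier M. \<zero>\<^bsub>N\<^esub>),
      add = (\<lambda>f g. \<lambda>x\<in>carrier M. f x \<oplus>\<^bsub>N\<^esub> g x),
      smult = (\<lambda>r f. \<lambda>x\<in>carrier M. r \<odot>\<^bsub>N\<^esub> f x)\<rparr>"

text \<open>The free module on a set \<open>X\<close>: finitely supported functions from \<open>X\<close> to \<open>R\<close>,
  extended by zero to the whole type.\<close>

definition free_module :: "('r, 'k) ring_scheme \<Rightarrow> 'x set \<Rightarrow> ('r, 'x \<Rightarrow> 'r) module" where
  "free_module R X =
     \<lparr>carrier = {f. (\<forall>x. f x \<in> carrier R) \<and> (\<forall>x. x \<notin> X \<longrightarrow> f x = \<zero>\<^bsub>R\<^esub>) \<and>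
                    finite {x. f x \<noteq> \<zero>\<^bsub>R\<^esub>}},
      mult = undefined, one = undefined,
      zero = (\<lambda>x. \<zero>\<^bsub>R\<^esub>),
      add = (\<lambda>f g x. f x \<oplus>\<^bsub>R\<^esub> g x),
      smult = (\<lambda>r f x. r \<otimes>\<^bsub>R\<^esub> f x)\<rparr>"

definition free_basis :: "('r, 'k) ring_scheme \<Rightarrow> 'x \<Rightarrow> 'x \<Rightarrow> 'r" where
  "free_basis R x = (\<lambda>y. if y = x then \<one>\<^bsub>R\<^esub> else \<zero>\<^bsub>R\<^esub>)"

text \<open>The linear map on the free module that sends the basis vector of \<open>x\<close> to \<open>\<phi> x\<close>.\<close>

definition free_lift ::
    "('r, 'k) ring_scheme \<Rightarrow> 'x set \<Rightarrow> ('r, 'n, 'l) module_scheme \<Rightarrow> ('x \<Rightarrow> 'n)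
      \<Rightarrow> ('x \<Rightarrow> 'r) \<Rightarrow> 'n" where
  "free_lift R X N \<phi> =
     (\<lambda>f\<in>carrier (free_module R X).
        \<Oplus>\<^bsub>N\<^esub>x\<in>{x. f x \<noteq> \<zero>\<^bsub>R\<^esub>}. f x \<odot>\<^bsub>N\<^esub> \<phi> x)"

definition tensor_relations ::
    "('r, 'k) ring_scheme \<Rightarrow> ('r, 'm, 'l) module_scheme \<Rightarrow> ('r, 'n, 'l2) module_scheme
      \<Rightarrow> ('m \<times> 'n \<Rightarrow> 'r) set" where
  "tensor_relations R M N =
     (let F = free_module R (carrier M \<times> carrier N); e = free_basis R in
        {e (x \<oplus>\<^bsub>M\<^esub> x', y) \<ominus>\<^bsub>F\<^esub> (e (x, y) \<oplus>\<^bsub>F\<^esub> e (x', y)) | x x' y.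
           x \<in> carrier M \<and> x' \<in> carrier M \<and> y \<in> carrier N} \<union>
        {e (x, y \<oplus>\<^bsub>N\<^esub> y') \<ominus>\<^bsub>F\<^esub> (e (x, y) \<oplus>\<^bsub>F\<^esub> e (x, y')) | x y y'.
           x \<in> carrier M \<and> y \<in> carrier N \<and> y' \<in> carrier N} \<union>
        {e (r \<odot>\<^bsub>M\<^esub> x, y) \<ominus>\<^bsub>F\<^esub> (r \<odot>\<^bsub>F\<^esub> e (x, y)) | r x y.
           r \<in> carrier R \<and> x \<in> carrier M \<and> y \<in> carrier N} \<union>
        {e (x, r \<odot>\<^bsub>N\<^esub> y) \<ominus>\<^bsub>F\<^esub> (r \<odot>\<^bsub>F\<^esub> e (x, y)) | r x y.
           r \<in> carrier R \<and> x \<in> carrier M \<and> y \<in> carrier N})"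

definition tensor_module ::
    "('r, 'k) ring_scheme \<Rightarrow> ('r, 'm, 'l) module_scheme \<Rightarrow> ('r, 'n, 'l2) module_scheme
      \<Rightarrow> ('r, ('m \<times> 'n \<Rightarrow> 'r) set) module" where
  "tensor_module R M N =
     (let F = free_module R (carrier M \<times> carrier N) in
        quotient_module F (module_span R F (tensor_relations R M N)))"


section \<open>Localization and support\<close>

definition fraction_rel ::
    "('r, 'k) ring_scheme \<Rightarrow> ('r, 'm, 'l) module_scheme \<Rightarrow> 'r set
      \<Rightarrow> (('m \<times> 'r) \<times> ('m \<times> 'r)) set" where
  "fraction_rel R M p =
     {((x, s), (y, t)). x \<in> carrier M \<and> y \<in> carrier M \<and>
        s \<in> carrier R - p \<and> t \<in> carrier R - p \<and>
        (\<exists>u\<in>carrier R - p. u \<odot>\<^bsub>M\<^esub> (t \<odot>\<^bsub>M\<^esub> x) = u \<odot>\<^bsub>M\<^esub> (s \<odot>\<^bsub>M\<^esub> y))}"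

text \<open>The localization of \<open>M\<close> at a prime ideal \<open>p\<close>, with scalars restricted to \<open>R\<close>; the pair
  \<open>(x, s)\<close> represents the fraction \<open>x / s\<close>.\<close>

definition localized_module ::
    "('r, 'k) ring_scheme \<Rightarrow> ('r, 'm, 'l) module_scheme \<Rightarrow> 'r set
      \<Rightarrow> ('r, ('m \<times> 'r) set) module" where
  "localized_module R M p =
     \<lparr>carrier = (carrier M \<times> (carrier R - p)) // fraction_rel R M p,
      mult = undefined, one = undefined,
      zero = fraction_rel R M p `` {(\<zero>\<^bsub>M\<^esub>, \<one>\<^bsub>R\<^esub>)},
      add = (\<lambda>A B. \<Union>(x, s)\<in>A. \<Union>(y, t)\<in>B.
               fraction_rel R M p `` {(t \<odot>\<^bsub>M\<^esub> x \<oplus>\<^bsub>M\<^esub> s \<odot>\<^bsub>M\<^esub> y, s \<otimes>\<^bsub>R\<^esub> t)}),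
      smult = (\<lambda>r A. \<Union>(x, s)\<in>A. fraction_rel R M p `` {(r \<odot>\<^bsub>M\<^esub> x, s)})\<rparr>"

definition Supp ::
    "('r, 'k) ring_scheme \<Rightarrow> ('r, 'm, 'l) module_scheme \<Rightarrow> 'r set set" where
  "Supp R M =
     {p. primeideal p R \<and>
         carrier (localized_module R M p) \<noteq> {\<zero>\<^bsub>localized_module R M p\<^esub>}}"


section \<open>Ext\<close>

text \<open>
  Cohomology of the complex \<open>Hom(F\<^sub>\<bullet>, N)\<close>, where \<open>F\<close> is a chain complex with differentials
  \<open>d n\<close> from \<open>F (n + 1)\<close> to \<open>F n\<close>.
\<close>

definition Hom_diff ::
    "(nat \<Rightarrow> ('r, 'f, 'l) module_scheme) \<Rightarrow> (nat \<Rightarrow> 'f \<Rightarrow> 'f) \<Rightarrow> nat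
      \<Rightarrow> ('f \<Rightarrow> 'n) \<Rightarrow> ('f \<Rightarrow> 'n)" where
  "Hom_diff F d n h = (\<lambda>x\<in>carrier (F (Suc n)). h (d n x))"

definition Hom_cocycles ::
    "('r, 'k) ring_scheme \<Rightarrow> (nat \<Rightarrow> ('r, 'f, 'l) module_scheme) \<Rightarrow> (nat \<Rightarrow> 'f \<Rightarrow> 'f)
      \<Rightarrow> ('r, 'n, 'l2) module_scheme \<Rightarrow> nat \<Rightarrow> ('f \<Rightarrow> 'n) set" where
  "Hom_cocycles R F d N n =
     {h \<in> module_hom R (F n) N. Hom_diff F d n h = \<zero>\<^bsub>Hom_module R (F (Suc n)) N\<^esub>}"

definition Hom_coboundaries ::
    "('r, 'k) ring_scheme \<Rightarrow> (nat \<Rightarrow> ('r, 'f, 'l) module_scheme) \<Rightarrow> (nat \<Rightarrow> 'f \<Rightarrow> 'f)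
      \<Rightarrow> ('r, 'n, 'l2) module_scheme \<Rightarrow> nat \<Rightarrow> ('f \<Rightarrow> 'n) set" where
  "Hom_coboundaries R F d N n =
     (case n of 0 \<Rightarrow> {\<zero>\<^bsub>Hom_module R (F 0) N\<^esub>}
      | Suc k \<Rightarrow> Hom_diff F d k ` module_hom R (F k) N)"

definition Hom_cohomology ::
    "('r, 'k) ring_scheme \<Rightarrow> (nat \<Rightarrow> ('r, 'f, 'l) module_scheme) \<Rightarrow> (nat \<Rightarrow> 'f \<Rightarrow> 'f)
      \<Rightarrow> ('r, 'n, 'l2) module_scheme \<Rightarrow> nat \<Rightarrow> ('r, ('f \<Rightarrow> 'n) set) module" where
  "Hom_cohomology R F d N n =
     quotient_module ((Hom_module R (F n) N)\<lparr>carrier := Hom_cocycles R F d N n\<rparr>)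
       (Hom_coboundaries R F d N n)"

text \<open>
  Ext is computed from the following free resolution of \<open>M\<close>, which exists for every module.
  The basis in degree 0 consists of all elements of \<open>M\<close>. The basis in degree \<open>n + 1\<close> consists of
  all formal linear combinations, written as lists of coefficients and basis elements of degree
  \<open>n\<close>, that evaluate to zero in \<open>M\<close> (if \<open>n = 0\<close>) or in the free module of degree \<open>n - 1\<close>
  (if \<open>n > 0\<close>). The differential sends such a basis element to the combination it names.
  The inductive type puts the bases of all degrees into one type.
\<close>

datatype ('r, 'm) syz = Gen (gen_elem: 'm) | Rel (rel_terms: "('r \<times> ('r, 'm) syz) list")

definition lin_comb ::
    "('r, 'n, 'l) module_scheme \<Rightarrow> ('x \<Rightarrow> 'n) \<Rightarrow> ('r \<times> 'x) list \<Rightarrow> 'n" where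
  "lin_comb N \<phi> ws = foldr (\<lambda>(r, x) y. r \<odot>\<^bsub>N\<^esub> \<phi> x \<oplus>\<^bsub>N\<^esub> y) ws \<zero>\<^bsub>N\<^esub>"

definition syz_boundary :: "('r, 'k) ring_scheme \<Rightarrow> ('r, 'm) syz \<Rightarrow> ('r, 'm) syz \<Rightarrow> 'r" where
  "syz_boundary R x = lin_comb (free_module R UNIV) (free_basis R) (rel_terms x)"

fun syz_basis ::
    "('r, 'k) ring_scheme \<Rightarrow> ('r, 'm, 'l) module_scheme \<Rightarrow> nat \<Rightarrow> ('r, 'm) syz set" where
  "syz_basis R M 0 = Gen ` carrier M"
| "syz_basis R M (Suc 0) =
     {Rel ws | ws. set ws \<subseteq> carrier R \<times> syz_basis R M 0 \<and>
        lin_comb M gen_elem ws = \<zero>\<^bsub>M\<^esub>}"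
| "syz_basis R M (Suc (Suc n)) =
     {Rel ws | ws. set ws \<subseteq> carrier R \<times> syz_basis R M (Suc n) \<and>
        lin_comb (free_module R (syz_basis R M n)) (syz_boundary R) ws =
          \<zero>\<^bsub>free_module R (syz_basis R M n)\<^esub>}"

definition free_res ::
    "('r, 'k) ring_scheme \<Rightarrow> ('r, 'm, 'l) module_scheme \<Rightarrow> nat
      \<Rightarrow> ('r, ('r, 'm) syz \<Rightarrow> 'r) module" where
  "free_res R M n = free_module R (syz_basis R M n)"

definition free_res_diff ::
    "('r, 'k) ring_scheme \<Rightarrow> ('r, 'm, 'l) module_scheme \<Rightarrow> nat
      \<Rightarrow> (('r, 'm) syz \<Rightarrow> 'r) \<Rightarrow> (('r, 'm) syz \<Rightarrow> 'r)" where
  "free_res_diff R M n =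
     free_lift R (syz_basis R M (Suc n)) (free_res R M n) (syz_boundary R)"

definition free_res_aug ::
    "('r, 'k) ring_scheme \<Rightarrow> ('r, 'm, 'l) module_scheme \<Rightarrow> (('r, 'm) syz \<Rightarrow> 'r) \<Rightarrow> 'm" where
  "free_res_aug R M = free_lift R (syz_basis R M 0) M gen_elem"

definition Ext ::
    "('r, 'k) ring_scheme \<Rightarrow> nat \<Rightarrow> ('r, 'm, 'l) module_scheme \<Rightarrow> ('r, 'n, 'l2) module_scheme
      \<Rightarrow> ('r, ((('r, 'm) syz \<Rightarrow> 'r) \<Rightarrow> 'n) set) module" where
  "Ext R i M N = Hom_cohomology R (free_res R M) (free_res_diff R M) N i"


section \<open>Exactness of the free resolution\<close>


lemma free_module_simps:
  "zero (free_module R X) = (\<lambda>x. \<zero>\<^bsub>R\<^esub>)"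
  "add (free_module R X) = (\<lambda>f g x. f x \<oplus>\<^bsub>R\<^esub> g x)"
  "smult (free_module R X) = (\<lambda>r f x. r \<otimes>\<^bsub>R\<^esub> f x)"
  by (simp_all add: free_module_def)

lemma module_free_module:
  assumes "cring R" shows "module R (free_module R X)"
proof -
  interpret cring R by fact
  have supp_add: "finite {x. f x \<oplus>\<^bsub>R\<^esub> g x \<noteq> \<zero>\<^bsub>R\<^esub>}"
    if "finite {x. f x \<noteq> \<zero>\<^bsub>R\<^esub>}" "finite {x. g x \<noteq> \<zero>\<^bsub>R\<^esub>}" for f g :: "_ \<Rightarrow> _"
    by (rule finite_subset[OF _ finite_UnI[OF that]]) auto
  have supp_smult: "finite {x. r \<otimes>\<^bsub>R\<^esub> f x \<noteq> \<zero>\<^bsub>R\<^esub>}"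
    if "finite {x. f x \<noteq> \<zero>\<^bsub>R\<^esub>}" "r \<in> carrier R" for r and f :: "_ \<Rightarrow> _"
    by (rule finite_subset[OF _ that(1)]) (use that in auto)
  have inv: "\<exists>y\<in>carrier (free_module R X). y \<oplus>\<^bsub>free_module R X\<^esub> f = \<zero>\<^bsub>free_module R X\<^esub>"
    if "f \<in> carrier (free_module R X)" for f
  proof (rule bexI[where x = "\<lambda>x. \<ominus>\<^bsub>R\<^esub> f x"])
    have "finite {x. \<ominus>\<^bsub>R\<^esub> f x \<noteq> \<zero>\<^bsub>R\<^esub>}"
      by (rule finite_subset[of _ "{x. f x \<noteq> \<zero>\<^bsub>R\<^esub>}"]) (use that in \<open>auto simp: free_module_def\<close>)
    then show "(\<lambda>x. \<ominus>\<^bsub>R\<^esub> f x) \<in> carrier (free_module R X)"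
      using that by (auto simp: free_module_def)
  qed (use that in \<open>auto simp: free_module_def l_neg\<close>)
  show ?thesis
  proof (rule moduleI)
    show "abelian_group (free_module R X)"
      by (rule abelian_groupI)
         (use inv in \<open>auto simp: free_module_def fun_eq_iff supp_add a_ac\<close>)
  qed (use assms in \<open>auto simp: free_module_def fun_eq_iff supp_smult l_distr r_distr m_assoc\<close>)
qed

lemma free_basis_closed:
  assumes "cring R" "x \<in> X" shows "free_basis R x \<in> carrier (free_module R X)"
proof -
  interpret cring R by fact
  have "finite {y. free_basis R x y \<noteq> \<zero>\<^bsub>R\<^esub>}"
    by (rule finite_subset[of _ "{x}"]) (auto simp: free_basis_def)
  then show ?thesis using assms by (auto simp: free_module_def free_basis_def)
qed

lemma free_lift_superset:
  assumes "module R N" "\<phi> \<in> X \<rightarrow> carrier N" "f \<in> carrier (free_module R X)"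
    "finite A" "{x. f x \<noteq> \<zero>\<^bsub>R\<^esub>} \<subseteq> A" "A \<subseteq> X"
  shows "free_lift R X N \<phi> f = (\<Oplus>\<^bsub>N\<^esub>x\<in>A. f x \<odot>\<^bsub>N\<^esub> \<phi> x)"
proof -
  interpret module R N by fact
  have "(\<Oplus>\<^bsub>N\<^esub>x\<in>{x. f x \<noteq> \<zero>\<^bsub>R\<^esub>}. f x \<odot>\<^bsub>N\<^esub> \<phi> x) = (\<Oplus>\<^bsub>N\<^esub>x\<in>A. f x \<odot>\<^bsub>N\<^esub> \<phi> x)"
    by (rule M.add.finprod_mono_neutral_cong_left) (use assms in \<open>auto simp: free_module_def subset_iff Pi_iff\<close>)
  with assms(3) show ?thesis by (simp add: free_lift_def)
qed

lemma free_lift_hom: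
  assumes "module R N" "\<phi> \<in> X \<rightarrow> carrier N"
  shows "free_lift R X N \<phi> \<in> module_hom R (free_module R X) N"
proof -
  interpret module R N by fact
  let ?F = "free_module R X"
  interpret F: module R ?F by (rule module_free_module) (rule R.is_cring)
  have sub: "finite {x. f x \<noteq> \<zero>\<^bsub>R\<^esub>}" "{x. f x \<noteq> \<zero>\<^bsub>R\<^esub>} \<subseteq> X" "\<And>x. f x \<in> carrier R" if "f \<in> carrier ?F" for f
    using that by (auto simp: free_module_def)
  have cl: "(\<lambda>x. f x \<odot>\<^bsub>N\<^esub> \<phi> x) \<in> A \<rightarrow> carrier N" if "f \<in> carrier ?F" "A \<subseteq> X" for f A
    using that assms by (auto simp: Pi_iff free_module_def)
  have 1: "free_lift R X N \<phi> (f \<oplus>\<^bsub>?F\<^esub> g) = free_lift R X N \<phi> f \<oplus>\<^bsub>N\<^esub> free_lift R X N \<phi> g"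
    if f: "f \<in> carrier ?F" and g: "g \<in> carrier ?F" for f g
  proof -
    let ?A = "{x. f x \<noteq> \<zero>\<^bsub>R\<^esub>} \<union> {x. g x \<noteq> \<zero>\<^bsub>R\<^esub>}"
    have A: "finite ?A" "?A \<subseteq> X" using sub[OF f] sub[OF g] by auto
    have "free_lift R X N \<phi> (f \<oplus>\<^bsub>?F\<^esub> g) = (\<Oplus>\<^bsub>N\<^esub>x\<in>?A. (f \<oplus>\<^bsub>?F\<^esub> g) x \<odot>\<^bsub>N\<^esub> \<phi> x)"
      by (rule free_lift_superset) (use assms A F.M.a_closed[OF f g] in \<open>auto simp: free_module_simps\<close>)
    also have "\<dots> = (\<Oplus>\<^bsub>N\<^esub>x\<in>?A. f x \<odot>\<^bsub>N\<^esub> \<phi> x \<oplus>\<^bsub>N\<^esub> g x \<odot>\<^bsub>N\<^esub> \<phi> x)"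
      by (rule M.add.finprod_cong') (use A assms sub(3)[OF f] sub(3)[OF g] in \<open>auto simp: free_module_simps smult_l_distr Pi_iff subset_iff\<close>)
    also have "\<dots> = (\<Oplus>\<^bsub>N\<^esub>x\<in>?A. f x \<odot>\<^bsub>N\<^esub> \<phi> x) \<oplus>\<^bsub>N\<^esub> (\<Oplus>\<^bsub>N\<^esub>x\<in>?A. g x \<odot>\<^bsub>N\<^esub> \<phi> x)"
      by (rule M.finsum_addf) (use cl[OF f A(2)] cl[OF g A(2)] in auto)
    also have "(\<Oplus>\<^bsub>N\<^esub>x\<in>?A. f x \<odot>\<^bsub>N\<^esub> \<phi> x) = free_lift R X N \<phi> f"
      by (rule free_lift_superset[symmetric]) (use assms A f in auto)
    also have "(\<Oplus>\<^bsub>N\<^esub>x\<in>?A. g x \<odot>\<^bsub>N\<^esub> \<phi> x) = free_lift R X N \<phi> g"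
      by (rule free_lift_superset[symmetric]) (use assms A g in auto)
    finally show ?thesis .
  qed
  have 2: "free_lift R X N \<phi> (r \<odot>\<^bsub>?F\<^esub> f) = r \<odot>\<^bsub>N\<^esub> free_lift R X N \<phi> f"
    if f: "f \<in> carrier ?F" and r: "r \<in> carrier R" for f r
  proof -
    let ?A = "{x. f x \<noteq> \<zero>\<^bsub>R\<^esub>}"
    have A: "finite ?A" "?A \<subseteq> X" using sub[OF f] by auto
    have "free_lift R X N \<phi> (r \<odot>\<^bsub>?F\<^esub> f) = (\<Oplus>\<^bsub>N\<^esub>x\<in>?A. (r \<odot>\<^bsub>?F\<^esub> f) x \<odot>\<^bsub>N\<^esub> \<phi> x)"
      by (rule free_lift_superset) (use assms A F.smult_closed[OF r f] r in \<open>auto simp: free_module_simps\<close>)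
    also have "\<dots> = (\<Oplus>\<^bsub>N\<^esub>x\<in>?A. r \<odot>\<^bsub>N\<^esub> (f x \<odot>\<^bsub>N\<^esub> \<phi> x))"
      by (rule M.add.finprod_cong') (use A assms r sub(3)[OF f] in \<open>auto simp: free_module_simps smult_assoc1 Pi_iff subset_iff\<close>)
    also have "\<dots> = r \<odot>\<^bsub>N\<^esub> (\<Oplus>\<^bsub>N\<^esub>x\<in>?A. f x \<odot>\<^bsub>N\<^esub> \<phi> x)"
      by (rule finsum_smult_ldistr[symmetric]) (use A r cl[OF f A(2)] in auto)
    also have "(\<Oplus>\<^bsub>N\<^esub>x\<in>?A. f x \<odot>\<^bsub>N\<^esub> \<phi> x) = free_lift R X N \<phi> f"
      using f by (simp add: free_lift_def)
    finally show ?thesis .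
  qed
  have "free_lift R X N \<phi> f \<in> carrier N" if f: "f \<in> carrier ?F" for f
    using cl[OF f sub(2)[OF f]] f by (auto simp: free_lift_def intro!: M.finsum_closed)
  moreover have "free_lift R X N \<phi> \<in> extensional (carrier ?F)"
    by (simp add: free_lift_def)
  ultimately show ?thesis
    unfolding module_hom_def using 1 2 by (auto simp: PiE_def)
qed

lemma free_lift_basis:
  assumes "module R N" "\<phi> \<in> X \<rightarrow> carrier N" "x \<in> X"
  shows "free_lift R X N \<phi> (free_basis R x) = \<phi> x"
proof -
  interpret module R N by fact
  have "free_lift R X N \<phi> (free_basis R x) = (\<Oplus>\<^bsub>N\<^esub>y\<in>{x}. free_basis R x y \<odot>\<^bsub>N\<^esub> \<phi> y)"
    by (rule free_lift_superset)
       (use assms free_basis_closed[OF R.is_cring assms(3)] in \<open>auto simp: free_basis_def\<close>)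
  also have "\<dots> = \<phi> x" using assms by (simp add: free_basis_def Pi_iff)
  finally show ?thesis .
qed

lemma lin_comb_simps [simp]:
  "lin_comb N \<phi> [] = \<zero>\<^bsub>N\<^esub>"
  "lin_comb N \<phi> ((r, x) # ws) = r \<odot>\<^bsub>N\<^esub> \<phi> x \<oplus>\<^bsub>N\<^esub> lin_comb N \<phi> ws"
  by (simp_all add: lin_comb_def)

lemma lin_comb_closed:
  assumes "module R N" "\<phi> \<in> X \<rightarrow> carrier N" "set ws \<subseteq> carrier R \<times> X"
  shows "lin_comb N \<phi> ws \<in> carrier N"
proof -
  interpret module R N by fact
  show ?thesis using assms(3) by (induction ws) (use assms(2) in \<open>auto simp: Pi_iff\<close>)
qed

lemma module_hom_zero:
  assumes "module R A" "module R B" "h \<in> module_hom R A B" shows "h \<zero>\<^bsub>A\<^esub> = \<zero>\<^bsub>B\<^esub>"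
proof -
  interpret A: module R A by fact
  interpret B: module R B by fact
  have h: "h \<zero>\<^bsub>A\<^esub> \<in> carrier B"
    using assms(3) by (auto simp: module_hom_def)
  have "h (\<zero>\<^bsub>R\<^esub> \<odot>\<^bsub>A\<^esub> \<zero>\<^bsub>A\<^esub>) = \<zero>\<^bsub>R\<^esub> \<odot>\<^bsub>B\<^esub> h \<zero>\<^bsub>A\<^esub>"
    using assms(3) A.R.zero_closed A.M.zero_closed unfolding module_hom_def by blast
  then show ?thesis
    by (simp only: A.smult_l_null[OF A.M.zero_closed] B.smult_l_null[OF h])
qed

lemma module_hom_compose:
  assumes "module R A" "f \<in> module_hom R A B" "g \<in> module_hom R B C"
  shows "(\<lambda>x\<in>carrier A. g (f x)) \<in> module_hom R A C"
proof -
  interpret A: module R A by fact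
  have f: "\<And>x. x \<in> carrier A \<Longrightarrow> f x \<in> carrier B"
    and g: "\<And>x. x \<in> carrier B \<Longrightarrow> g x \<in> carrier C"
    using assms(2,3) by (auto simp: module_hom_def)
  show ?thesis
    using assms(2,3) f g by (simp add: module_hom_def)
qed

lemma lin_comb_hom:
  assumes "module R A" "module R B" "h \<in> module_hom R A B" "\<phi> \<in> X \<rightarrow> carrier A"
    "set ws \<subseteq> carrier R \<times> X" "\<And>x. x \<in> X \<Longrightarrow> h (\<phi> x) = \<psi> x"
  shows "h (lin_comb A \<phi> ws) = lin_comb B \<psi> ws"
  using assms(5)
proof (induction ws)
  case Nil
  then show ?case using module_hom_zero[OF assms(1-3)] by simp
next
  case (Cons w ws)
  interpret A: module R A by fact
  obtain r x where w: "w = (r, x)" "r \<in> carrier R" "x \<in> X" using Cons.prems by (cases w) auto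
  have "lin_comb A \<phi> ws \<in> carrier A" by (rule lin_comb_closed) (use assms Cons.prems in auto)
  moreover have "\<phi> x \<in> carrier A" using assms(4) w by auto
  ultimately show ?case using Cons w assms(3,6) by (auto simp: module_hom_def)
qed

lemma lin_comb_free_UNIV:
  "lin_comb (free_module R X) \<phi> = lin_comb (free_module R UNIV) \<phi>"
  by (simp add: lin_comb_def free_module_simps fun_eq_iff)

lemma free_module_eq_lin_comb:
  assumes "cring R" "f \<in> carrier (free_module R X)"
  obtains ws where "set ws \<subseteq> carrier R \<times> X" "lin_comb (free_module R X) (free_basis R) ws = f"
proof -
  interpret cring R by fact
  have f: "finite {x. f x \<noteq> \<zero>\<^bsub>R\<^esub>}" "{x. f x \<noteq> \<zero>\<^bsub>R\<^esub>} \<subseteq> X" "\<And>x. f x \<in> carrier R"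
    using assms(2) by (auto simp: free_module_def)
  obtain xs where xs: "set xs = {x. f x \<noteq> \<zero>\<^bsub>R\<^esub>}" "distinct xs"
    using finite_distinct_list[OF f(1)] by auto
  have "lin_comb (free_module R X) (free_basis R) (map (\<lambda>x. (f x, x)) ys) =
      (\<lambda>x. if x \<in> set ys then f x else \<zero>\<^bsub>R\<^esub>)" if "distinct ys" for ys
    using that by (induction ys) (auto simp: free_module_simps free_basis_def fun_eq_iff f(3))
  from this[OF xs(2)] have "lin_comb (free_module R X) (free_basis R) (map (\<lambda>x. (f x, x)) xs) = f"
    by (auto simp: xs fun_eq_iff)
  then show ?thesis by (intro that[of "map (\<lambda>x. (f x, x)) xs"]) (use f xs in auto)
qed

lemma free_hom_kernel:
  assumes "module R N" "\<phi> \<in> X \<rightarrow> carrier N" 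
   and Y: "Y = {Rel ws | ws. set ws \<subseteq> carrier R \<times> X \<and> lin_comb N \<phi> ws = \<zero>\<^bsub>N\<^esub>}"
  shows "syz_boundary R \<in> Y \<rightarrow> carrier (free_module R X)"
    and "free_lift R Y (free_module R X) (syz_boundary R) ` carrier (free_module R Y) =
      {f \<in> carrier (free_module R X). free_lift R X N \<phi> f = \<zero>\<^bsub>N\<^esub>}"
proof -
  interpret module R N by fact
  let ?F = "free_module R X" and ?G = "free_module R Y"
  let ?d = "free_lift R Y ?F (syz_boundary R)" and ?e = "free_lift R X N \<phi>"
  note cr = R.is_cring
  have F: "module R ?F" and G: "module R ?G" using cr by (auto intro: module_free_module)
  interpret F: module R ?F by fact
  have bX: "free_basis R \<in> X \<rightarrow> carrier ?F" and bY: "free_basis R \<in> Y \<rightarrow> carrier ?G"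
    using free_basis_closed[OF cr] by auto
  have bd: "syz_boundary R (Rel ws) = lin_comb ?F (free_basis R) ws" for ws
    unfolding syz_boundary_def lin_comb_free_UNIV[of R X] by simp
  show phi: "syz_boundary R \<in> Y \<rightarrow> carrier ?F"
    unfolding Y using lin_comb_closed[OF F bX] by (auto simp: bd)
  have e: "?e \<in> module_hom R ?F N" by (rule free_lift_hom) fact+
  have d: "?d \<in> module_hom R ?G ?F" by (rule free_lift_hom[OF F phi])
  have elc: "?e (lin_comb ?F (free_basis R) ws) = lin_comb N \<phi> ws" if "set ws \<subseteq> carrier R \<times> X" for ws
    by (rule lin_comb_hom[OF F assms(1) e bX that]) (rule free_lift_basis[OF assms(1,2)])
  have dcl: "?d g \<in> carrier ?F" if "g \<in> carrier ?G" for g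
    using d that by (auto simp: module_hom_def)
  have comp: "(\<lambda>g\<in>carrier ?G. ?e (?d g)) \<in> module_hom R ?G N"
    using module_hom_compose[OF G d e] .
  have "?e (?d g) = \<zero>\<^bsub>N\<^esub>" if g: "g \<in> carrier ?G" for g
  proof -
    obtain ws where ws: "set ws \<subseteq> carrier R \<times> Y" "lin_comb ?G (free_basis R) ws = g"
      using free_module_eq_lin_comb[OF cr g] .
    have "(\<lambda>g\<in>carrier ?G. ?e (?d g)) (free_basis R y) = \<zero>\<^bsub>N\<^esub>" if y: "y \<in> Y" for y
    proof -
      obtain vs where vs: "y = Rel vs" "set vs \<subseteq> carrier R \<times> X" "lin_comb N \<phi> vs = \<zero>\<^bsub>N\<^esub>"
        using y unfolding Y by auto
      have "?d (free_basis R y) = syz_boundary R y" by (rule free_lift_basis[OF F phi y])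
      moreover have "free_basis R y \<in> carrier ?G" by (rule free_basis_closed[OF cr y])
      ultimately show ?thesis using vs bd elc by simp
    qed
    from lin_comb_hom[OF G assms(1) comp bY ws(1), of "\<lambda>_. \<zero>\<^bsub>N\<^esub>", OF this]
    have "?e (?d g) = lin_comb N (\<lambda>_. \<zero>\<^bsub>N\<^esub>) ws"
      unfolding ws(2) using g by simp
    also have "\<dots> = \<zero>\<^bsub>N\<^esub>" using ws(1) by (induction ws) auto
    finally show ?thesis .
  qed
  moreover have "f \<in> ?d ` carrier ?G" if f: "f \<in> carrier ?F" "?e f = \<zero>\<^bsub>N\<^esub>" for f
  proof -
    obtain ws where ws: "set ws \<subseteq> carrier R \<times> X" "lin_comb ?F (free_basis R) ws = f"
      using free_module_eq_lin_comb[OF cr f(1)] .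
    have "Rel ws \<in> Y" using ws f elc by (auto simp: Y)
    then have "?d (free_basis R (Rel ws)) = f"
      using free_lift_basis[OF F phi, of "Rel ws"] ws by (simp add: bd)
    with \<open>Rel ws \<in> Y\<close> bY show ?thesis by force
  qed
  ultimately show "?d ` carrier ?G = {f \<in> carrier ?F. ?e f = \<zero>\<^bsub>N\<^esub>}"
    using dcl by auto
qed

lemma gen_elem_closed: "gen_elem \<in> syz_basis R M 0 \<rightarrow> carrier M"
  by auto

lemma syz_boundary_closed:
  assumes "module R M"
  shows "syz_boundary R \<in> syz_basis R M (Suc n) \<rightarrow> carrier (free_res R M n)"
proof (induction n)
  case 0
  show ?case unfolding free_res_def
    by (rule free_hom_kernel(1)[OF assms gen_elem_closed]) simp
next
  case (Suc n)
  have cr: "cring R" using assms by (simp add: module_def)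
  show ?case unfolding free_res_def
    by (rule free_hom_kernel(1)[OF module_free_module[OF cr] Suc.IH[unfolded free_res_def]]) simp
qed

text \<open>The free modules \<^const>\<open>free_res\<close> do form a resolution of \<open>M\<close>.\<close>

theorem free_res_exact:
  assumes "module R M"
  shows "module R (free_res R M n)"
    and "free_res_diff R M n \<in> module_hom R (free_res R M (Suc n)) (free_res R M n)"
    and "free_res_aug R M \<in> module_hom R (free_res R M 0) M"
    and "free_res_aug R M ` carrier (free_res R M 0) = carrier M"
    and "free_res_diff R M 0 ` carrier (free_res R M (Suc 0)) =
      {f \<in> carrier (free_res R M 0). free_res_aug R M f = \<zero>\<^bsub>M\<^esub>}"
    and "free_res_diff R M (Suc n) ` carrier (free_res R M (Suc (Suc n))) =
      {f \<in> carrier (free_res R M (Suc n)). free_res_diff R M n f = \<zero>\<^bsub>free_res R M n\<^esub>}"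
proof -
  have cr: "cring R" using assms by (simp add: module_def)
  show F: "module R (free_res R M n)" for n
    unfolding free_res_def by (rule module_free_module[OF cr])
  show "free_res_diff R M n \<in> module_hom R (free_res R M (Suc n)) (free_res R M n)"
    using free_lift_hom[OF F syz_boundary_closed[OF assms]]
    by (simp add: free_res_diff_def free_res_def)
  show h: "free_res_aug R M \<in> module_hom R (free_res R M 0) M"
    using free_lift_hom[OF assms gen_elem_closed] by (simp add: free_res_aug_def free_res_def)
  have "x \<in> free_res_aug R M ` carrier (free_res R M 0)" if "x \<in> carrier M" for x
  proof (rule image_eqI)
    show "x = free_res_aug R M (free_basis R (Gen x))"
      using free_lift_basis[OF assms gen_elem_closed, of "Gen x" R] that by (simp add: free_res_aug_def)
    show "free_basis R (Gen x) \<in> carrier (free_res R M 0)"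
      unfolding free_res_def by (rule free_basis_closed[OF cr]) (use that in simp)
  qed
  with h show "free_res_aug R M ` carrier (free_res R M 0) = carrier M"
    by (auto simp: module_hom_def)
  show "free_res_diff R M 0 ` carrier (free_res R M (Suc 0)) =
      {f \<in> carrier (free_res R M 0). free_res_aug R M f = \<zero>\<^bsub>M\<^esub>}"
    unfolding free_res_def free_res_diff_def free_res_aug_def
    by (rule free_hom_kernel(2)[OF assms gen_elem_closed]) simp
  show "free_res_diff R M (Suc n) ` carrier (free_res R M (Suc (Suc n))) =
      {f \<in> carrier (free_res R M (Suc n)). free_res_diff R M n f = \<zero>\<^bsub>free_res R M n\<^esub>}"
    unfolding free_res_def free_res_diff_def
    by (rule free_hom_kernel(2)[OF module_free_module[OF cr] syz_boundary_closed[OF assms, unfolded free_res_def]]) simp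
qed

end

theory Submission
  imports Defs
begin

text \<open>
  All three unions are expressed by supports of modules: if \<open>M\<close> and \<open>N\<close> are finitely generated over
  a noetherian ring, then \<open>\<Union>\<^sub>i Supp Ext\<^sup>i(M, N) = Supp M \<inter> Supp N\<close>, while
  \<open>Supp (M \<otimes> N) = Supp M \<inter> Supp N\<close> and \<open>Supp R\<close> consists of all primes. For the first equation,
  an element that annihilates \<open>M\<close> or \<open>N\<close> annihilates \<open>Ext\<^sup>i(M, N)\<close>. Conversely, at a prime \<open>p\<close> in both
  supports, dividing \<open>N\<close> by \<open>p\<close>-torsion and by regular elements of \<open>p\<close> preserves the vanishing
  of \<open>Ext(M, N)\<^sub>p\<close>, and once \<open>p\<close> consists of zero divisors on \<open>N\<close> there is a map
  \<open>M \<rightarrow> R / p \<rightarrow> N\<close> that is nonzero at \<open>p\<close>. The maps \<open>M \<rightarrow> R / p\<close> and \<open>N \<rightarrow> R / p\<close>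
  also detect the support of the tensor product.
\<close>

section \<open>Submodules, homomorphisms and quotients\<close>

text \<open>\<open>Supp_iff\<close> removes localized modules: every assertion at a prime p becomes
  one about scalars s outside p. Vanishing at p then gives each element its own s; a common s for
  the whole module comes from the maximal condition (\<open>uniform_denominator\<close>).

  In the argument for Ext, the quotients N / L are replaced by congruences modulo L. All L then live
  in one lattice, the submodules of N, and its maximal condition takes the place of an induction on
  dimension or along a regular sequence.

  Dividing by a regular x rests on the exact sequence 0 -> N/L -> N/L -> N/(L + xN) -> 0 whose first
  map is multiplication by x: Ext^n(M, N/(L + xN)) sits between Ext^n(M, N/L) and Ext^(n+1)(M, N/L).
  The shift in degree is the reason why vanishing is carried in all degrees at once. The division
  must also keep the quotient nonzero at p. This is Nakayama's lemma, obtained here from the same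
  maps to R / p that serve elsewhere.\<close>

lemma (in abelian_group) add_swap_cancel:
  "x \<in> carrier G \<Longrightarrow> y \<in> carrier G \<Longrightarrow> x \<oplus> (y \<oplus> \<ominus> x) = y"
  using a_lcomm[of x y "\<ominus> x"] by (simp add: r_neg)

lemma (in abelian_group) minus_minus_cancel_right:
  assumes "x \<in> carrier G" "y \<in> carrier G" "z \<in> carrier G"
  shows "(x \<ominus> z) \<ominus> (y \<ominus> z) = x \<ominus> y"
  using assms add_swap_cancel[of z "\<ominus> y"] by (simp add: minus_eq minus_add a_ac)

lemma (in abelian_group) add_minus_add:
  assumes "x \<in> carrier G" "y \<in> carrier G" "x' \<in> carrier G" "y' \<in> carrier G"
  shows "(x \<oplus> y) \<ominus> (x' \<oplus> y') = (x \<ominus> x') \<oplus> (y \<ominus> y')"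
  using assms by (simp add: minus_eq minus_add a_ac)

lemma (in abelian_group) eq_if_minus_eq_zero:
  assumes "x \<in> carrier G" "y \<in> carrier G" "x \<ominus> y = \<zero>" shows "x = y"
proof -
  have "x = (x \<ominus> y) \<oplus> y" using assms(1,2) by (simp add: minus_eq a_assoc l_neg)
  then show ?thesis using assms by simp
qed

text \<open>Maps into R / p are represented below by functions \<rho> with values in R, whose
  linearity holds only up to p. Membership in p is transferred across such congruences.\<close>

lemma (in ideal) cong_mem_iff:
  assumes "r \<in> carrier R" "t \<in> carrier R" "r \<ominus> t \<in> I"
  shows "r \<in> I \<longleftrightarrow> t \<in> I"
proof
  assume "t \<in> I"
  then have "(r \<ominus> t) \<oplus> t \<in> I" using assms(3) by simp
  then show "r \<in> I" using assms by (simp add: minus_eq a_assoc l_neg)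
next
  assume "r \<in> I"
  then have "r \<oplus> \<ominus> (r \<ominus> t) \<in> I"
    using assms(3) additive_subgroup.a_inv_closed[OF is_additive_subgroup] by simp
  then show "t \<in> I" using assms by (simp add: minus_eq minus_add r_neg2)
qed

lemma (in primeideal) complement_submonoid:
  shows "\<one> \<in> carrier R - I"
    and "s \<in> carrier R - I \<Longrightarrow> t \<in> carrier R - I \<Longrightarrow> s \<otimes> t \<in> carrier R - I"
  using I_prime one_imp_carrier I_notcarr by auto

lemma submodule_carrier: "submodule K R M \<Longrightarrow> x \<in> K \<Longrightarrow> x \<in> carrier M"
  unfolding submodule_def using subgroup.subset by fastforce

lemma (in module) submodule_minus_closed:
  "submodule K R M \<Longrightarrow> x \<in> K \<Longrightarrow> y \<in> K \<Longrightarrow> x \<ominus>\<^bsub>M\<^esub> y \<in> K"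
  using submoduleE(3,5)[of K] by (simp add: minus_eq)

lemma (in module) submodule_zero: "submodule K R M \<Longrightarrow> \<zero>\<^bsub>M\<^esub> \<in> K"
  unfolding submodule_def using subgroup.one_closed by fastforce

lemma (in module) smult_minus_distr:
  "r \<in> carrier R \<Longrightarrow> x \<in> carrier M \<Longrightarrow> y \<in> carrier M \<Longrightarrow>
    r \<odot>\<^bsub>M\<^esub> (x \<ominus>\<^bsub>M\<^esub> y) = r \<odot>\<^bsub>M\<^esub> x \<ominus>\<^bsub>M\<^esub> r \<odot>\<^bsub>M\<^esub> y"
  by (simp add: minus_eq smult_r_distr smult_r_minus)

lemma (in module) smult_diff_distr:
  "r \<in> carrier R \<Longrightarrow> t \<in> carrier R \<Longrightarrow> x \<in> carrier M \<Longrightarrow>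
    (r \<ominus> t) \<odot>\<^bsub>M\<^esub> x = r \<odot>\<^bsub>M\<^esub> x \<ominus>\<^bsub>M\<^esub> t \<odot>\<^bsub>M\<^esub> x"
  by (simp add: minus_eq R.minus_eq smult_l_distr smult_l_minus)

lemma (in module) submodule_cong:
  assumes "submodule K R M" "x \<in> carrier M" "y \<in> carrier M" "x \<ominus>\<^bsub>M\<^esub> y \<in> K"
  shows "x \<in> K \<longleftrightarrow> y \<in> K"
proof
  assume "y \<in> K"
  then have "(x \<ominus>\<^bsub>M\<^esub> y) \<oplus>\<^bsub>M\<^esub> y \<in> K" using submoduleE(5)[OF assms(1)] assms(4) by blast
  then show "x \<in> K" using assms by (simp add: minus_eq M.a_assoc M.l_neg)
next
  assume "x \<in> K"
  then have "x \<ominus>\<^bsub>M\<^esub> (x \<ominus>\<^bsub>M\<^esub> y) \<in> K" by (rule submodule_minus_closed[OF assms(1) _ assms(4)])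
  then show "y \<in> K" using assms by (simp add: minus_eq M.minus_add M.a_ac M.add_swap_cancel)
qed

text \<open>This is the colon submodule (K : r). For r outside a prime p it enlarges K without
  changing its localization at p, which makes maximal choices of K saturated.\<close>

lemma (in module) submodule_preimage_smult:
  assumes "submodule K R M" "r \<in> carrier R"
  shows "submodule {x \<in> carrier M. r \<odot>\<^bsub>M\<^esub> x \<in> K} R M"
proof -
  note K = submoduleE[OF assms(1)]
  show ?thesis
  proof (rule submoduleI)
    fix t x assume "t \<in> carrier R" "x \<in> {x \<in> carrier M. r \<odot>\<^bsub>M\<^esub> x \<in> K}"
    moreover from this have "r \<odot>\<^bsub>M\<^esub> (t \<odot>\<^bsub>M\<^esub> x) = t \<odot>\<^bsub>M\<^esub> (r \<odot>\<^bsub>M\<^esub> x)"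
      using assms(2) by (metis (mono_tags) mem_Collect_eq smult_assoc1 R.m_comm)
    ultimately show "t \<odot>\<^bsub>M\<^esub> x \<in> {x \<in> carrier M. r \<odot>\<^bsub>M\<^esub> x \<in> K}" using K by simp
  qed (use K assms submodule_zero in \<open>auto simp: smult_r_distr smult_r_minus\<close>)
qed

text \<open>The set is B + R x. The congruence form exposes the coefficient r, from which ideals and
  functionals are built later.\<close>

lemma (in module) submodule_adjoin:
  assumes "submodule B R M" "x \<in> carrier M"
  shows "submodule {y \<in> carrier M. \<exists>r\<in>carrier R. y \<ominus>\<^bsub>M\<^esub> r \<odot>\<^bsub>M\<^esub> x \<in> B} R M"
    and "B \<subseteq> {y \<in> carrier M. \<exists>r\<in>carrier R. y \<ominus>\<^bsub>M\<^esub> r \<odot>\<^bsub>M\<^esub> x \<in> B}"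
    and "x \<in> {y \<in> carrier M. \<exists>r\<in>carrier R. y \<ominus>\<^bsub>M\<^esub> r \<odot>\<^bsub>M\<^esub> x \<in> B}"
proof -
  let ?A = "{y \<in> carrier M. \<exists>r\<in>carrier R. y \<ominus>\<^bsub>M\<^esub> r \<odot>\<^bsub>M\<^esub> x \<in> B}"
  note B = submoduleE[OF assms(1)]
  show sub: "B \<subseteq> ?A"
  proof
    fix y assume "y \<in> B"
    moreover from this have "y \<ominus>\<^bsub>M\<^esub> \<zero> \<odot>\<^bsub>M\<^esub> x \<in> B"
      using assms submodule_zero submodule_minus_closed by simp
    ultimately show "y \<in> ?A" using submodule_carrier[OF assms(1)] by blast
  qed
  have "x \<ominus>\<^bsub>M\<^esub> \<one> \<odot>\<^bsub>M\<^esub> x \<in> B" using assms submodule_zero by (simp add: minus_eq M.r_neg)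
  then show "x \<in> ?A" using assms by blast
  show "submodule ?A R M"
  proof (rule submoduleI)
    show "\<zero>\<^bsub>M\<^esub> \<in> ?A" using sub submodule_zero[OF assms(1)] by blast
  next
    fix y assume "y \<in> ?A"
    then obtain r where r: "y \<in> carrier M" "r \<in> carrier R" "y \<ominus>\<^bsub>M\<^esub> r \<odot>\<^bsub>M\<^esub> x \<in> B" by blast
    have "\<ominus>\<^bsub>M\<^esub> y \<ominus>\<^bsub>M\<^esub> (\<ominus> r) \<odot>\<^bsub>M\<^esub> x = \<ominus>\<^bsub>M\<^esub> (y \<ominus>\<^bsub>M\<^esub> r \<odot>\<^bsub>M\<^esub> x)"
      using r assms by (simp add: minus_eq M.minus_add smult_l_minus)
    then show "\<ominus>\<^bsub>M\<^esub> y \<in> ?A" using r B(3)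
      by (intro CollectI conjI bexI[where x = "\<ominus> r"]) auto
  next
    fix y y' assume "y \<in> ?A" "y' \<in> ?A"
    then obtain r r' where r: "y \<in> carrier M" "r \<in> carrier R" "y \<ominus>\<^bsub>M\<^esub> r \<odot>\<^bsub>M\<^esub> x \<in> B"
      and r': "y' \<in> carrier M" "r' \<in> carrier R" "y' \<ominus>\<^bsub>M\<^esub> r' \<odot>\<^bsub>M\<^esub> x \<in> B" by blast
    have "(y \<oplus>\<^bsub>M\<^esub> y') \<ominus>\<^bsub>M\<^esub> (r \<oplus> r') \<odot>\<^bsub>M\<^esub> x = (y \<ominus>\<^bsub>M\<^esub> r \<odot>\<^bsub>M\<^esub> x) \<oplus>\<^bsub>M\<^esub> (y' \<ominus>\<^bsub>M\<^esub> r' \<odot>\<^bsub>M\<^esub> x)"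
      using r r' assms by (simp add: smult_l_distr M.add_minus_add)
    then show "y \<oplus>\<^bsub>M\<^esub> y' \<in> ?A" using r r' B(5)
      by (intro CollectI conjI bexI[where x = "r \<oplus> r'"]) auto
  next
    fix t y assume "y \<in> ?A" and t: "t \<in> carrier R"
    then obtain r where r: "y \<in> carrier M" "r \<in> carrier R" "y \<ominus>\<^bsub>M\<^esub> r \<odot>\<^bsub>M\<^esub> x \<in> B" by blast
    have "t \<odot>\<^bsub>M\<^esub> y \<ominus>\<^bsub>M\<^esub> (t \<otimes> r) \<odot>\<^bsub>M\<^esub> x = t \<odot>\<^bsub>M\<^esub> (y \<ominus>\<^bsub>M\<^esub> r \<odot>\<^bsub>M\<^esub> x)"
      using r t assms by (simp add: smult_minus_distr smult_assoc1)
    then show "t \<odot>\<^bsub>M\<^esub> y \<in> ?A" using r t B(4)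
      by (intro CollectI conjI bexI[where x = "t \<otimes> r"]) auto
  qed blast
qed

lemma (in module) submodule_of_smult_closed:
  assumes "H \<subseteq> carrier M" "\<zero>\<^bsub>M\<^esub> \<in> H"
    and "\<And>x y. x \<in> H \<Longrightarrow> y \<in> H \<Longrightarrow> x \<oplus>\<^bsub>M\<^esub> y \<in> H"
    and sm: "\<And>r x. r \<in> carrier R \<Longrightarrow> x \<in> H \<Longrightarrow> r \<odot>\<^bsub>M\<^esub> x \<in> H"
  shows "submodule H R M"
proof (rule submoduleI)
  fix x assume x: "x \<in> H"
  then have "(\<ominus> \<one>) \<odot>\<^bsub>M\<^esub> x = \<ominus>\<^bsub>M\<^esub> x" using assms(1) by (subst smult_l_minus) auto
  then show "\<ominus>\<^bsub>M\<^esub> x \<in> H" using sm[of "\<ominus> \<one>" x] x by simp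
qed (use assms in auto)

text \<open>The set is L + x M, the submodule that corresponds to dividing M / L by the image of
  x.\<close>

lemma (in module) submodule_add_image:
  assumes "submodule L R M" "x \<in> carrier R"
  shows "submodule {y \<in> carrier M. \<exists>z\<in>carrier M. y \<ominus>\<^bsub>M\<^esub> x \<odot>\<^bsub>M\<^esub> z \<in> L} R M" (is "submodule ?A R M")
    and "L \<subseteq> {y \<in> carrier M. \<exists>z\<in>carrier M. y \<ominus>\<^bsub>M\<^esub> x \<odot>\<^bsub>M\<^esub> z \<in> L}"
    and "z \<in> carrier M \<Longrightarrow> x \<odot>\<^bsub>M\<^esub> z \<in> {y \<in> carrier M. \<exists>z\<in>carrier M. y \<ominus>\<^bsub>M\<^esub> x \<odot>\<^bsub>M\<^esub> z \<in> L}"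
proof -
  note L = submoduleE[OF assms(1)] and L0 = submodule_zero[OF assms(1)]
  show sub: "L \<subseteq> ?A"
  proof
    fix y assume y: "y \<in> L"
    then have "y \<ominus>\<^bsub>M\<^esub> x \<odot>\<^bsub>M\<^esub> \<zero>\<^bsub>M\<^esub> \<in> L" using assms(2) submodule_minus_closed[OF assms(1) y L0] by simp
    then show "y \<in> ?A" using y L(1) M.zero_closed by blast
  qed
  show "x \<odot>\<^bsub>M\<^esub> z \<in> ?A" if "z \<in> carrier M" for z
  proof -
    have "x \<odot>\<^bsub>M\<^esub> z \<ominus>\<^bsub>M\<^esub> x \<odot>\<^bsub>M\<^esub> z \<in> L" using that assms(2) L0 by (simp add: minus_eq M.r_neg)
    then show ?thesis using that assms(2) by blast
  qed
  show "submodule ?A R M"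
  proof (rule submodule_of_smult_closed)
    show "\<zero>\<^bsub>M\<^esub> \<in> ?A" using sub L0 by blast
  next
    fix y y' assume "y \<in> ?A" "y' \<in> ?A"
    then obtain z z' where z: "y \<in> carrier M" "z \<in> carrier M" "y \<ominus>\<^bsub>M\<^esub> x \<odot>\<^bsub>M\<^esub> z \<in> L"
      and z': "y' \<in> carrier M" "z' \<in> carrier M" "y' \<ominus>\<^bsub>M\<^esub> x \<odot>\<^bsub>M\<^esub> z' \<in> L" by blast
    have "(y \<oplus>\<^bsub>M\<^esub> y') \<ominus>\<^bsub>M\<^esub> x \<odot>\<^bsub>M\<^esub> (z \<oplus>\<^bsub>M\<^esub> z') \<in> L"
      using L(5)[OF z(3) z'(3)] z z' assms(2) by (simp add: smult_r_distr M.add_minus_add)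
    then show "y \<oplus>\<^bsub>M\<^esub> y' \<in> ?A" using z z' M.a_closed by blast
  next
    fix r y assume r: "r \<in> carrier R" and "y \<in> ?A"
    then obtain z where z: "y \<in> carrier M" "z \<in> carrier M" "y \<ominus>\<^bsub>M\<^esub> x \<odot>\<^bsub>M\<^esub> z \<in> L" by blast
    have "r \<odot>\<^bsub>M\<^esub> (x \<odot>\<^bsub>M\<^esub> z) = x \<odot>\<^bsub>M\<^esub> (r \<odot>\<^bsub>M\<^esub> z)"
      using r z assms(2) by (metis smult_assoc1 R.m_comm)
    then have "r \<odot>\<^bsub>M\<^esub> y \<ominus>\<^bsub>M\<^esub> x \<odot>\<^bsub>M\<^esub> (r \<odot>\<^bsub>M\<^esub> z) \<in> L"
      using L(4)[OF r z(3)] r z assms(2) by (simp add: smult_minus_distr)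
    then show "r \<odot>\<^bsub>M\<^esub> y \<in> ?A" using r z smult_closed by blast
  qed blast
qed

lemma (in module) submodule_module_span:
  assumes "S \<subseteq> carrier M"
  shows "submodule (module_span R M S) R M" "S \<subseteq> module_span R M S"
proof -
  let ?K = "{K. submodule K R M \<and> S \<subseteq> K}"
  have c: "carrier M \<in> ?K" using assms carrier_is_submodule by simp
  show "S \<subseteq> module_span R M S" unfolding module_span_def by blast
  show "submodule (module_span R M S) R M"
  proof (rule submodule_of_smult_closed; unfold module_span_def)
    show "\<Inter>?K \<subseteq> carrier M" using c by blast
    show "\<zero>\<^bsub>M\<^esub> \<in> \<Inter>?K" using submodule_zero by simp
    show "x \<oplus>\<^bsub>M\<^esub> y \<in> \<Inter>?K" if "x \<in> \<Inter>?K" "y \<in> \<Inter>?K" for x y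
      using that submoduleE(5) by simp
    show "r \<odot>\<^bsub>M\<^esub> x \<in> \<Inter>?K" if "r \<in> carrier R" "x \<in> \<Inter>?K" for r x
      using that submoduleE(4) by simp
  qed
qed

text \<open>Induction over generators: a property whose solutions form a submodule need only be
  checked on S.\<close>

lemma module_span_carrierD:
  assumes "module_span R M S = carrier M" "submodule A R M" "S \<subseteq> A"
  shows "carrier M \<subseteq> A"
  using assms unfolding module_span_def by blast

section \<open>Linear maps and the module of homomorphisms\<close>

lemma module_hom_closed: "h \<in> module_hom R M N \<Longrightarrow> x \<in> carrier M \<Longrightarrow> h x \<in> carrier N"
  and module_hom_add: "h \<in> module_hom R M N \<Longrightarrow> x \<in> carrier M \<Longrightarrow> y \<in> carrier M
    \<Longrightarrow> h (x \<oplus>\<^bsub>M\<^esub> y) = h x \<oplus>\<^bsub>N\<^esub> h y"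
  and module_hom_smult: "h \<in> module_hom R M N \<Longrightarrow> r \<in> carrier R \<Longrightarrow> x \<in> carrier M
    \<Longrightarrow> h (r \<odot>\<^bsub>M\<^esub> x) = r \<odot>\<^bsub>N\<^esub> h x"
  and module_hom_outside: "h \<in> module_hom R M N \<Longrightarrow> x \<notin> carrier M \<Longrightarrow> h x = undefined"
  by (auto simp: module_hom_def)

lemma module_hom_minus:
  assumes "module R M" "module R N" "h \<in> module_hom R M N" "x \<in> carrier M" "y \<in> carrier M"
  shows "h (x \<ominus>\<^bsub>M\<^esub> y) = h x \<ominus>\<^bsub>N\<^esub> h y"
proof -
  interpret M: module R M by fact
  interpret N: module R N by fact
  have "h (x \<ominus>\<^bsub>M\<^esub> y) \<oplus>\<^bsub>N\<^esub> h y = h x"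
    using assms(4,5) module_hom_add[OF assms(3), of "x \<ominus>\<^bsub>M\<^esub> y" y]
    by (simp add: M.minus_eq M.M.a_assoc M.M.l_neg)
  then show ?thesis
    using assms(4,5) module_hom_closed[OF assms(3)] by (metis M.M.minus_closed N.add.inv_solve_right N.minus_eq)
qed

lemma Hom_module_simps:
  "carrier (Hom_module R M N) = module_hom R M N"
  "\<zero>\<^bsub>Hom_module R M N\<^esub> = (\<lambda>x\<in>carrier M. \<zero>\<^bsub>N\<^esub>)"
  "f \<oplus>\<^bsub>Hom_module R M N\<^esub> g = (\<lambda>x\<in>carrier M. f x \<oplus>\<^bsub>N\<^esub> g x)"
  "r \<odot>\<^bsub>Hom_module R M N\<^esub> f = (\<lambda>x\<in>carrier M. r \<odot>\<^bsub>N\<^esub> f x)"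
  by (simp_all add: Hom_module_def)

lemma module_Hom_module:
  assumes "module R M" "module R N" shows "module R (Hom_module R M N)"
proof -
  interpret M: module R M by fact
  interpret N: module R N by fact
  note c = module_hom_closed module_hom_add module_hom_smult
  have neg: "(\<lambda>x\<in>carrier M. \<ominus>\<^bsub>N\<^esub> f x) \<in> module_hom R M N" if f: "f \<in> module_hom R M N" for f
    using c[OF f] unfolding module_hom_def
    by (auto simp: N.M.minus_add N.M.a_comm N.smult_r_minus)
  have z: "(\<lambda>x\<in>carrier M. \<zero>\<^bsub>N\<^esub>) \<in> module_hom R M N"
    by (auto simp: module_hom_def)
  have a: "(\<lambda>x\<in>carrier M. f x \<oplus>\<^bsub>N\<^esub> g x) \<in> module_hom R M N"
    if f: "f \<in> module_hom R M N" and g: "g \<in> module_hom R M N" for f g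
    using c[OF f] c[OF g] unfolding module_hom_def
    by (auto simp: N.M.a_ac N.smult_r_distr)
  have s: "(\<lambda>x\<in>carrier M. r \<odot>\<^bsub>N\<^esub> f x) \<in> module_hom R M N"
    if f: "f \<in> module_hom R M N" and r: "r \<in> carrier R" for f r
  proof -
    have "r \<odot>\<^bsub>N\<^esub> (t \<odot>\<^bsub>N\<^esub> y) = t \<odot>\<^bsub>N\<^esub> (r \<odot>\<^bsub>N\<^esub> y)" if "t \<in> carrier R" "y \<in> carrier N" for t y
      using that r by (metis N.smult_assoc1 M.R.m_comm)
    then show ?thesis using c[OF f] r unfolding module_hom_def by (auto simp: N.smult_r_distr)
  qed
  have l0: "(\<lambda>x\<in>carrier M. (\<lambda>x\<in>carrier M. \<zero>\<^bsub>N\<^esub>) x \<oplus>\<^bsub>N\<^esub> f x) = f"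
    and l1: "(\<lambda>x\<in>carrier M. \<one>\<^bsub>R\<^esub> \<odot>\<^bsub>N\<^esub> f x) = f" if f: "f \<in> module_hom R M N" for f
    using c(1)[OF f] module_hom_outside[OF f] by (auto simp: restrict_def fun_eq_iff)
  show ?thesis
  proof (rule moduleI)
    show "abelian_group (Hom_module R M N)"
    proof (rule abelian_groupI, unfold Hom_module_simps)
      fix f g h assume f: "f \<in> module_hom R M N" and g: "g \<in> module_hom R M N"
        and h: "h \<in> module_hom R M N"
      note cl = c(1)[OF f] c(1)[OF g] c(1)[OF h]
      show "(\<lambda>x\<in>carrier M. (\<lambda>x\<in>carrier M. f x \<oplus>\<^bsub>N\<^esub> g x) x \<oplus>\<^bsub>N\<^esub> h x) =
          (\<lambda>x\<in>carrier M. f x \<oplus>\<^bsub>N\<^esub> (\<lambda>x\<in>carrier M. g x \<oplus>\<^bsub>N\<^esub> h x) x)"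
        by (rule restrict_ext) (simp add: cl N.M.a_assoc)
      show "(\<lambda>x\<in>carrier M. f x \<oplus>\<^bsub>N\<^esub> g x) = (\<lambda>x\<in>carrier M. g x \<oplus>\<^bsub>N\<^esub> f x)"
        by (rule restrict_ext) (simp add: cl N.M.a_comm)
    next
      fix f assume f: "f \<in> module_hom R M N"
      show "\<exists>g\<in>module_hom R M N. (\<lambda>x\<in>carrier M. g x \<oplus>\<^bsub>N\<^esub> f x) = (\<lambda>x\<in>carrier M. \<zero>\<^bsub>N\<^esub>)"
        by (rule bexI[OF _ neg[OF f]], rule restrict_ext) (simp add: c(1)[OF f] N.M.l_neg)
    qed (use a z l0 in auto)
  next
    fix r t f g assume r: "r \<in> carrier R" "t \<in> carrier R"
      and "f \<in> carrier (Hom_module R M N)" "g \<in> carrier (Hom_module R M N)"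
    then have "f \<in> module_hom R M N" "g \<in> module_hom R M N" by (simp_all add: Hom_module_simps)
    note cl = r c(1)[OF this(1)] c(1)[OF this(2)]
    show "(r \<oplus>\<^bsub>R\<^esub> t) \<odot>\<^bsub>Hom_module R M N\<^esub> f =
        r \<odot>\<^bsub>Hom_module R M N\<^esub> f \<oplus>\<^bsub>Hom_module R M N\<^esub> t \<odot>\<^bsub>Hom_module R M N\<^esub> f"
      "r \<odot>\<^bsub>Hom_module R M N\<^esub> (f \<oplus>\<^bsub>Hom_module R M N\<^esub> g) =
        r \<odot>\<^bsub>Hom_module R M N\<^esub> f \<oplus>\<^bsub>Hom_module R M N\<^esub> r \<odot>\<^bsub>Hom_module R M N\<^esub> g"
      "(r \<otimes>\<^bsub>R\<^esub> t) \<odot>\<^bsub>Hom_module R M N\<^esub> f =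
        r \<odot>\<^bsub>Hom_module R M N\<^esub> (t \<odot>\<^bsub>Hom_module R M N\<^esub> f)"
      unfolding Hom_module_simps
      by (rule restrict_ext, simp add: cl N.smult_l_distr N.smult_r_distr N.smult_assoc1)+
  qed (use M.R.is_cring s l1 in \<open>auto simp: Hom_module_simps\<close>)
qed

section \<open>Quotient modules in terms of cosets\<close>

lemma submodule_abelian_subgroup:
  assumes "module R M" "submodule K R M" shows "abelian_subgroup K M"
proof -
  interpret module R M by fact
  show ?thesis
    by (rule abelian_subgroupI3[OF additive_subgroup.intro[OF submodule.axioms(1)[OF assms(2)]] M.abelian_group_axioms])
qed

lemma quotient_module_simps:
  "carrier (quotient_module M K) = a_rcosets\<^bsub>M\<^esub> K"
  "\<zero>\<^bsub>quotient_module M K\<^esub> = K"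
  "A \<oplus>\<^bsub>quotient_module M K\<^esub> B = A <+>\<^bsub>M\<^esub> B"
  "r \<odot>\<^bsub>quotient_module M K\<^esub> A = (\<Union>x\<in>A. K +>\<^bsub>M\<^esub> (r \<odot>\<^bsub>M\<^esub> x))"
  by (simp_all add: quotient_module_def)

lemma quotient_module_coset:
  assumes "module R M" "submodule K R M"
  shows "carrier (quotient_module M K) = (\<lambda>x. K +>\<^bsub>M\<^esub> x) ` carrier M"
    and "x \<in> carrier M \<Longrightarrow> y \<in> carrier M \<Longrightarrow>
      (K +>\<^bsub>M\<^esub> x) \<oplus>\<^bsub>quotient_module M K\<^esub> (K +>\<^bsub>M\<^esub> y) = K +>\<^bsub>M\<^esub> (x \<oplus>\<^bsub>M\<^esub> y)"
    and "r \<in> carrier R \<Longrightarrow> x \<in> carrier M \<Longrightarrow>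
      r \<odot>\<^bsub>quotient_module M K\<^esub> (K +>\<^bsub>M\<^esub> x) = K +>\<^bsub>M\<^esub> (r \<odot>\<^bsub>M\<^esub> x)"
    and "x \<in> carrier M \<Longrightarrow> y \<in> carrier M \<Longrightarrow> K +>\<^bsub>M\<^esub> x = K +>\<^bsub>M\<^esub> y \<longleftrightarrow> x \<ominus>\<^bsub>M\<^esub> y \<in> K"
    and "x \<in> carrier M \<Longrightarrow> K +>\<^bsub>M\<^esub> x = K \<longleftrightarrow> x \<in> K"
proof -
  interpret module R M by fact
  interpret K: abelian_subgroup K M by (rule submodule_abelian_subgroup) fact+
  note sub = submoduleE[OF assms(2)]
  show "carrier (quotient_module M K) = (\<lambda>x. K +>\<^bsub>M\<^esub> x) ` carrier M"
    by (auto simp: quotient_module_simps A_RCOSETS_def' )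
  show "x \<in> carrier M \<Longrightarrow> y \<in> carrier M \<Longrightarrow>
      (K +>\<^bsub>M\<^esub> x) \<oplus>\<^bsub>quotient_module M K\<^esub> (K +>\<^bsub>M\<^esub> y) = K +>\<^bsub>M\<^esub> (x \<oplus>\<^bsub>M\<^esub> y)"
    by (simp add: quotient_module_simps K.a_rcos_sum)
  show eq: "K +>\<^bsub>M\<^esub> x = K +>\<^bsub>M\<^esub> y \<longleftrightarrow> x \<ominus>\<^bsub>M\<^esub> y \<in> K" if "x \<in> carrier M" "y \<in> carrier M" for x y
  proof
    assume "K +>\<^bsub>M\<^esub> x = K +>\<^bsub>M\<^esub> y"
    then have "x \<in> K +>\<^bsub>M\<^esub> y" using K.a_rcos_self[OF that(1)] by simp
    then show "x \<ominus>\<^bsub>M\<^esub> y \<in> K" using K.a_rcos_module_imp that by (simp add: minus_eq)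
  next
    assume "x \<ominus>\<^bsub>M\<^esub> y \<in> K"
    then have "x \<in> K +>\<^bsub>M\<^esub> y" using K.a_rcos_module_rev that by (simp add: minus_eq)
    then show "K +>\<^bsub>M\<^esub> x = K +>\<^bsub>M\<^esub> y" using K.a_repr_independence' that by simp
  qed
  show "K +>\<^bsub>M\<^esub> x = K \<longleftrightarrow> x \<in> K" if "x \<in> carrier M"
    using eq[of x "\<zero>\<^bsub>M\<^esub>"] that sub(1) by (simp add: minus_eq, metis M.add.inv_one M.r_zero a_inv_def)
  show "r \<odot>\<^bsub>quotient_module M K\<^esub> (K +>\<^bsub>M\<^esub> x) = K +>\<^bsub>M\<^esub> (r \<odot>\<^bsub>M\<^esub> x)"
    if "r \<in> carrier R" "x \<in> carrier M"
  proof -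
    \<comment> \<open>Scalar multiplication on cosets is a union over all representatives; they all
      give the same coset, so the union collapses.\<close>
    have "K +>\<^bsub>M\<^esub> (r \<odot>\<^bsub>M\<^esub> y) = K +>\<^bsub>M\<^esub> (r \<odot>\<^bsub>M\<^esub> x)" if y: "y \<in> K +>\<^bsub>M\<^esub> x" for y
    proof -
      have yc: "y \<in> carrier M" using y \<open>x \<in> carrier M\<close> K.a_elemrcos_carrier by blast
      have "y \<ominus>\<^bsub>M\<^esub> x \<in> K" using y yc \<open>x \<in> carrier M\<close> K.a_rcos_module_imp by (simp add: minus_eq)
      then have "r \<odot>\<^bsub>M\<^esub> (y \<ominus>\<^bsub>M\<^esub> x) \<in> K" using sub \<open>r \<in> carrier R\<close> by blast
      then have "r \<odot>\<^bsub>M\<^esub> y \<ominus>\<^bsub>M\<^esub> r \<odot>\<^bsub>M\<^esub> x \<in> K"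
        using yc \<open>x \<in> carrier M\<close> \<open>r \<in> carrier R\<close> by (simp add: minus_eq smult_r_distr smult_r_minus)
      then show ?thesis using eq yc \<open>x \<in> carrier M\<close> \<open>r \<in> carrier R\<close> by simp
    qed
    moreover have "x \<in> K +>\<^bsub>M\<^esub> x" using that K.a_rcos_self by blast
    ultimately show ?thesis unfolding quotient_module_simps by blast
  qed
qed

lemma module_quotient_module:
  assumes "module R M" "submodule K R M" shows "module R (quotient_module M K)"
proof -
  interpret module R M by fact
  interpret K: abelian_subgroup K M by (rule submodule_abelian_subgroup) fact+
  note q = quotient_module_coset[OF assms]
  have z: "\<zero>\<^bsub>quotient_module M K\<^esub> = K +>\<^bsub>M\<^esub> \<zero>\<^bsub>M\<^esub>"
    using q(5)[of "\<zero>\<^bsub>M\<^esub>"] by (simp add: quotient_module_simps)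
  show ?thesis
  proof (rule moduleI)
    show "abelian_group (quotient_module M K)"
    proof (rule abelian_groupI)
      fix A assume "A \<in> carrier (quotient_module M K)"
      then obtain x where x: "x \<in> carrier M" "A = K +>\<^bsub>M\<^esub> x" using q(1) by auto
      show "\<exists>B\<in>carrier (quotient_module M K). B \<oplus>\<^bsub>quotient_module M K\<^esub> A = \<zero>\<^bsub>quotient_module M K\<^esub>"
        by (rule bexI[where x = "K +>\<^bsub>M\<^esub> \<ominus>\<^bsub>M\<^esub> x"]) (use x in \<open>auto simp: z q M.l_neg\<close>)
    qed (auto simp: z q M.a_ac)
  qed (auto simp: q R.is_cring smult_l_distr smult_r_distr smult_assoc1)
qed

section \<open>Combinations of linear maps, and maps out of free modules\<close>

lemma module_hom_minus_smult:
  assumes "module R M" "module R N" "f \<in> module_hom R M N" "g \<in> module_hom R M N"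
    "s \<in> carrier R" "t \<in> carrier R"
  shows "(\<lambda>v\<in>carrier M. s \<odot>\<^bsub>N\<^esub> f v \<ominus>\<^bsub>N\<^esub> t \<odot>\<^bsub>N\<^esub> g v) \<in> module_hom R M N"
proof -
  interpret M: module R M by fact
  interpret N: module R N by fact
  note cl = module_hom_closed[OF assms(3)] module_hom_closed[OF assms(4)]
  have comm: "a \<odot>\<^bsub>N\<^esub> (b \<odot>\<^bsub>N\<^esub> x) = b \<odot>\<^bsub>N\<^esub> (a \<odot>\<^bsub>N\<^esub> x)"
    if "a \<in> carrier R" "b \<in> carrier R" "x \<in> carrier N" for a b x
    using that by (metis N.smult_assoc1 M.R.m_comm)
  show ?thesis unfolding module_hom_def
  proof (intro CollectI conjI ballI)
    fix x y assume xy: "x \<in> carrier M" "y \<in> carrier M"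
    then show "(\<lambda>v\<in>carrier M. s \<odot>\<^bsub>N\<^esub> f v \<ominus>\<^bsub>N\<^esub> t \<odot>\<^bsub>N\<^esub> g v) (x \<oplus>\<^bsub>M\<^esub> y) =
        (\<lambda>v\<in>carrier M. s \<odot>\<^bsub>N\<^esub> f v \<ominus>\<^bsub>N\<^esub> t \<odot>\<^bsub>N\<^esub> g v) x \<oplus>\<^bsub>N\<^esub>
        (\<lambda>v\<in>carrier M. s \<odot>\<^bsub>N\<^esub> f v \<ominus>\<^bsub>N\<^esub> t \<odot>\<^bsub>N\<^esub> g v) y"
      using cl assms(5,6) module_hom_add[OF assms(3) xy] module_hom_add[OF assms(4) xy]
      by (simp add: N.smult_r_distr N.M.add_minus_add)
  next
    fix r x assume rx: "r \<in> carrier R" "x \<in> carrier M"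
    then show "(\<lambda>v\<in>carrier M. s \<odot>\<^bsub>N\<^esub> f v \<ominus>\<^bsub>N\<^esub> t \<odot>\<^bsub>N\<^esub> g v) (r \<odot>\<^bsub>M\<^esub> x) =
        r \<odot>\<^bsub>N\<^esub> (\<lambda>v\<in>carrier M. s \<odot>\<^bsub>N\<^esub> f v \<ominus>\<^bsub>N\<^esub> t \<odot>\<^bsub>N\<^esub> g v) x"
      using cl assms(5,6) module_hom_smult[OF assms(3) rx] module_hom_smult[OF assms(4) rx]
      by (simp add: N.smult_minus_distr comm)
  qed (use cl assms(5,6) in auto)
qed

text \<open>Projectivity of a free module in relational form. P is a linear relation between the
  free module and N; choosing a partner for each basis vector and extending linearly gives a map
  inside P. It produces lifts along differentials and lifts of maps into N / L without forming N /
  L.\<close>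

lemma free_module_hom_choice:
  fixes R :: "('r, 'k) ring_scheme" and N :: "('r, 'n, 'l) module_scheme"
  assumes "module R N"
    and P0: "P \<zero>\<^bsub>free_module R X\<^esub> \<zero>\<^bsub>N\<^esub>"
    and Padd: "\<And>u v x y. \<lbrakk>u \<in> carrier (free_module R X); v \<in> carrier (free_module R X);
      x \<in> carrier N; y \<in> carrier N; P u x; P v y\<rbrakk> \<Longrightarrow> P (u \<oplus>\<^bsub>free_module R X\<^esub> v) (x \<oplus>\<^bsub>N\<^esub> y)"
    and Psmult: "\<And>r u x. \<lbrakk>r \<in> carrier R; u \<in> carrier (free_module R X); x \<in> carrier N; P u x\<rbrakk>
      \<Longrightarrow> P (r \<odot>\<^bsub>free_module R X\<^esub> u) (r \<odot>\<^bsub>N\<^esub> x)"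
    and ex: "\<And>b. b \<in> X \<Longrightarrow> \<exists>x\<in>carrier N. P (free_basis R b) x"
  shows "\<exists>h\<in>module_hom R (free_module R X) N. \<forall>u\<in>carrier (free_module R X). P u (h u)"
proof -
  interpret N: module R N by fact
  let ?F = "free_module R X"
  have cr: "cring R" by (rule N.R.is_cring)
  have F: "module R ?F" by (rule module_free_module[OF cr])
  interpret F: module R ?F by (rule F)
  obtain \<phi> where \<phi>: "\<And>b. b \<in> X \<Longrightarrow> \<phi> b \<in> carrier N" "\<And>b. b \<in> X \<Longrightarrow> P (free_basis R b) (\<phi> b)"
    using ex by metis
  have \<phi>X: "\<phi> \<in> X \<rightarrow> carrier N" using \<phi>(1) by blast
  have bX: "free_basis R \<in> X \<rightarrow> carrier ?F" using free_basis_closed[OF cr] by auto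
  let ?h = "free_lift R X N \<phi>"
  have h: "?h \<in> module_hom R ?F N" by (rule free_lift_hom[OF assms(1) \<phi>X])
  have "P u (?h u)" if u: "u \<in> carrier ?F" for u
  proof -
    obtain ws where ws: "set ws \<subseteq> carrier R \<times> X" "lin_comb ?F (free_basis R) ws = u"
      using free_module_eq_lin_comb[OF cr u] .
    have "P (lin_comb ?F (free_basis R) ws) (lin_comb N \<phi> ws)" using ws(1)
    proof (induction ws)
      case (Cons w ws)
      obtain r b where w: "w = (r, b)" "r \<in> carrier R" "b \<in> X" using Cons.prems by (cases w) auto
      have ws: "set ws \<subseteq> carrier R \<times> X" using Cons.prems by simp
      note cl = lin_comb_closed[OF F bX ws] lin_comb_closed[OF assms(1) \<phi>X ws]
        free_basis_closed[OF cr w(3)] \<phi>(1)[OF w(3)]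
      show ?case unfolding w(1) lin_comb_simps
        by (rule Padd; (rule Psmult)?) (use cl w \<phi>(2) Cons.IH[OF ws] in auto)
    qed (simp add: P0)
    moreover have "?h (lin_comb ?F (free_basis R) ws) = lin_comb N \<phi> ws"
      by (rule lin_comb_hom[OF F assms(1) h bX ws(1)]) (rule free_lift_basis[OF assms(1) \<phi>X])
    ultimately show ?thesis using ws(2) by simp
  qed
  with h show ?thesis by blast
qed

lemma free_module_submodule_top:
  assumes "cring R" "submodule W R (free_module R X)" "\<And>b. b \<in> X \<Longrightarrow> free_basis R b \<in> W"
  shows "carrier (free_module R X) \<subseteq> W"
proof
  fix u assume u: "u \<in> carrier (free_module R X)"
  interpret module R "free_module R X" by (rule module_free_module[OF assms(1)])
  note W = submoduleE[OF assms(2)]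
  obtain ws where ws: "set ws \<subseteq> carrier R \<times> X" "lin_comb (free_module R X) (free_basis R) ws = u"
    using free_module_eq_lin_comb[OF assms(1) u] .
  have "lin_comb (free_module R X) (free_basis R) ws \<in> W" using ws(1)
    by (induction ws) (use W(4,5) submodule_zero[OF assms(2)] assms(3) in auto)
  then show "u \<in> W" by (simp add: ws(2))
qed

section \<open>Support of a module\<close>

lemma fraction_rel_equiv:
  assumes "module R M" "primeideal p R"
  shows "equiv (carrier M \<times> (carrier R - p)) (fraction_rel R M p)"
proof -
  interpret module R M by fact
  interpret p: primeideal p R by fact
  let ?S = "carrier R - p"
  note S = p.complement_submonoid
  have c: "r \<odot>\<^bsub>M\<^esub> (t \<odot>\<^bsub>M\<^esub> y) = t \<odot>\<^bsub>M\<^esub> (r \<odot>\<^bsub>M\<^esub> y)"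
    if "r \<in> carrier R" "t \<in> carrier R" "y \<in> carrier M" for r t y
    using that by (metis smult_assoc1 R.m_comm)
  have "trans (fraction_rel R M p)"
  proof (rule transI, clarsimp simp: fraction_rel_def)
    fix x y z s t r u v
    assume A: "x \<in> carrier M" "y \<in> carrier M" "z \<in> carrier M"
      and s: "s \<in> carrier R" "s \<notin> p" and t: "t \<in> carrier R" "t \<notin> p" and r: "r \<in> carrier R" "r \<notin> p"
      and u: "u \<in> carrier R" "u \<notin> p" and v: "v \<in> carrier R" "v \<notin> p"
      and 1: "u \<odot>\<^bsub>M\<^esub> (t \<odot>\<^bsub>M\<^esub> x) = u \<odot>\<^bsub>M\<^esub> (s \<odot>\<^bsub>M\<^esub> y)"
      and 2: "v \<odot>\<^bsub>M\<^esub> (r \<odot>\<^bsub>M\<^esub> y) = v \<odot>\<^bsub>M\<^esub> (t \<odot>\<^bsub>M\<^esub> z)"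
    \<comment> \<open>The factors u and v witness the two given equalities; the middle denominator t
      has to be cleared as well.\<close>
    let ?w = "u \<otimes>\<^bsub>R\<^esub> (v \<otimes>\<^bsub>R\<^esub> t)"
    note C = A s(1) t(1) r(1) u(1) v(1)
    have "?w \<odot>\<^bsub>M\<^esub> (r \<odot>\<^bsub>M\<^esub> x) = v \<odot>\<^bsub>M\<^esub> (r \<odot>\<^bsub>M\<^esub> (u \<odot>\<^bsub>M\<^esub> (t \<odot>\<^bsub>M\<^esub> x)))"
      using C by (simp add: smult_assoc1 c)
    also have "\<dots> = u \<odot>\<^bsub>M\<^esub> (s \<odot>\<^bsub>M\<^esub> (v \<odot>\<^bsub>M\<^esub> (r \<odot>\<^bsub>M\<^esub> y)))"
      unfolding 1 using C by (simp add: c)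
    also have "\<dots> = ?w \<odot>\<^bsub>M\<^esub> (s \<odot>\<^bsub>M\<^esub> z)"
      unfolding 2 using C by (simp add: smult_assoc1 c)
    finally show "\<exists>w\<in>?S. w \<odot>\<^bsub>M\<^esub> (r \<odot>\<^bsub>M\<^esub> x) = w \<odot>\<^bsub>M\<^esub> (s \<odot>\<^bsub>M\<^esub> z)"
      using S(2)[of u "v \<otimes>\<^bsub>R\<^esub> t"] S(2)[of v t] u v t by blast
  qed
  moreover have "sym (fraction_rel R M p)"
    by (rule symI, clarsimp simp: fraction_rel_def) (metis DiffI)
  moreover have "refl_on (carrier M \<times> ?S) (fraction_rel R M p)"
    using S(1) by (auto simp: refl_on_def fraction_rel_def)
  moreover have "fraction_rel R M p \<subseteq> (carrier M \<times> ?S) \<times> (carrier M \<times> ?S)"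
    by (auto simp: fraction_rel_def)
  ultimately show ?thesis by (simp add: equiv_def)
qed

text \<open>A fraction x / s vanishes exactly when some element outside p kills x, so the
  denominator s is irrelevant and only the numerators remain.\<close>

lemma Supp_iff:
  assumes "module R M"
  shows "p \<in> Supp R M \<longleftrightarrow>
    primeideal p R \<and> (\<exists>x\<in>carrier M. \<forall>s\<in>carrier R - p. s \<odot>\<^bsub>M\<^esub> x \<noteq> \<zero>\<^bsub>M\<^esub>)"
proof (cases "primeideal p R")
  case True
  interpret module R M by fact
  interpret p: primeideal p R by fact
  let ?S = "carrier R - p" and ?E = "fraction_rel R M p"
  note S = p.complement_submonoid
  have cls: "?E `` {(x, s)} = ?E `` {(\<zero>\<^bsub>M\<^esub>, \<one>\<^bsub>R\<^esub>)} \<longleftrightarrow> (\<exists>u\<in>?S. u \<odot>\<^bsub>M\<^esub> x = \<zero>\<^bsub>M\<^esub>)"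
    if "x \<in> carrier M" "s \<in> ?S" for x s
    using eq_equiv_class_iff[OF fraction_rel_equiv[OF assms True], of "(x, s)" "(\<zero>\<^bsub>M\<^esub>, \<one>\<^bsub>R\<^esub>)"] that S(1)
    by (auto simp: fraction_rel_def)
  have car: "carrier (localized_module R M p) =
      (\<lambda>(x, s). ?E `` {(x, s)}) ` (carrier M \<times> ?S)"
    by (auto simp: localized_module_def quotient_def)
  have zer: "\<zero>\<^bsub>localized_module R M p\<^esub> = ?E `` {(\<zero>\<^bsub>M\<^esub>, \<one>\<^bsub>R\<^esub>)}"
    by (simp add: localized_module_def)
  have "carrier (localized_module R M p) \<noteq> {\<zero>\<^bsub>localized_module R M p\<^esub>} \<longleftrightarrow>
    (\<exists>x\<in>carrier M. \<exists>s\<in>?S. ?E `` {(x, s)} \<noteq> ?E `` {(\<zero>\<^bsub>M\<^esub>, \<one>\<^bsub>R\<^esub>)})"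
  proof -
    have "f ` A \<noteq> {f a} \<longleftrightarrow> (\<exists>b\<in>A. f b \<noteq> f a)" if "a \<in> A" for f :: "'c \<times> 'a \<Rightarrow> ('c \<times> 'a) set" and a A
      using that by blast
    from this[of "(\<zero>\<^bsub>M\<^esub>, \<one>\<^bsub>R\<^esub>)" "carrier M \<times> ?S" "\<lambda>(x, s). ?E `` {(x, s)}"]
    show ?thesis using S(1) unfolding car zer by simp
  qed
  also have "\<dots> \<longleftrightarrow> (\<exists>x\<in>carrier M. \<forall>s\<in>?S. s \<odot>\<^bsub>M\<^esub> x \<noteq> \<zero>\<^bsub>M\<^esub>)"
    using cls S(1) by blast
  finally show ?thesis using True by (simp add: Supp_def)
qed (simp add: Supp_def)

lemma Supp_quotient_module:
  assumes "module R M" "submodule K R M"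
  shows "p \<in> Supp R (quotient_module M K) \<longleftrightarrow>
    primeideal p R \<and> (\<exists>x\<in>carrier M. \<forall>s\<in>carrier R - p. s \<odot>\<^bsub>M\<^esub> x \<notin> K)"
proof -
  interpret module R M by fact
  note q = quotient_module_coset[OF assms]
  show ?thesis
    unfolding Supp_iff[OF module_quotient_module[OF assms]]
    by (auto simp: q quotient_module_simps(2))
qed

section \<open>Noetherian modules\<close>

text \<open>In a noetherian ring the union of a nonempty chain of ideals is a member of the chain.
  It is therefore an upper bound inside the given family, and Zorn's lemma applies to any nonempty
  family.\<close>

lemma (in noetherian_ring) maximal_ideal_in_family:
  assumes "\<C> \<subseteq> {I. ideal I R}" "\<C> \<noteq> {}"
  shows "\<exists>I\<in>\<C>. \<forall>J\<in>\<C>. I \<subseteq> J \<longrightarrow> J = I"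
proof (rule subset_Zorn)
  fix C assume C: "subset.chain \<C> C"
  show "\<exists>U\<in>\<C>. \<forall>X\<in>C. X \<subseteq> U"
  proof (cases "C = {}")
    case False
    have "subset.chain {I. ideal I R} C"
      using C assms(1) unfolding subset_chain_def by blast
    then have "\<Union>C \<in> C" by (rule ideal_chain_is_trivial[OF False])
    then show ?thesis
      using C by (intro bexI[where x = "\<Union>C"]) (auto simp: subset_chain_def)
  qed (use assms(2) in blast)
qed

text \<open>The chain condition is stated as existence of maximal members because each use below
  picks a submodule maximal with some property.\<close>

locale noetherian_module = module +
  assumes maximal_submodule_in_family:
    "\<lbrakk>\<C> \<subseteq> {K. submodule K R M}; \<C> \<noteq> {}\<rbrakk> \<Longrightarrow> \<exists>K\<in>\<C>. \<forall>K'\<in>\<C>. K \<subseteq> K' \<longrightarrow> K' = K"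

text \<open>A submodule \<open>K\<close> of \<open>B + R x\<close> is determined, among the submodules containing it, by the ideal
  \<open>{r. r x \<in> K + B}\<close> and by \<open>K \<inter> B\<close>.\<close>

lemma (in module) maximal_submodule_adjoin:
  assumes "noetherian_ring R" "submodule B R M" "x \<in> carrier M"
    and B_max: "\<And>\<C>. \<C> \<subseteq> {K. submodule K R M \<and> K \<subseteq> B} \<Longrightarrow> \<C> \<noteq> {} \<Longrightarrow>
      \<exists>K\<in>\<C>. \<forall>K'\<in>\<C>. K \<subseteq> K' \<longrightarrow> K' = K"
    and C: "\<C> \<subseteq> {K. submodule K R M \<and> K \<subseteq> {y \<in> carrier M. \<exists>r\<in>carrier R. y \<ominus>\<^bsub>M\<^esub> r \<odot>\<^bsub>M\<^esub> x \<in> B}}"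
    and "\<C> \<noteq> {}"
  shows "\<exists>K\<in>\<C>. \<forall>K'\<in>\<C>. K \<subseteq> K' \<longrightarrow> K' = K"
proof -
  define I where "I K = {r \<in> carrier R. \<exists>k\<in>K. k \<ominus>\<^bsub>M\<^esub> r \<odot>\<^bsub>M\<^esub> x \<in> B}" for K
  note B = submoduleE[OF assms(2)]
  have ideal: "ideal (I K) R" if K: "submodule K R M" for K
  proof (rule idealI)
    note KE = submoduleE[OF K]
    note Kc = submodule_carrier[OF K]
    show "subgroup (I K) (add_monoid R)"
    proof (rule R.add.subgroupI; (unfold monoid_record_simps a_inv_def[symmetric])?)
      have "\<zero>\<^bsub>M\<^esub> \<ominus>\<^bsub>M\<^esub> \<zero> \<odot>\<^bsub>M\<^esub> x \<in> B" using assms submodule_minus_closed[OF assms(2) submodule_zero submodule_zero] by simp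
      then show "I K \<noteq> {}" unfolding I_def using submodule_zero[OF K] by blast
    next
      fix r assume "r \<in> I K"
      then obtain k where r: "k \<in> K" "r \<in> carrier R" "k \<ominus>\<^bsub>M\<^esub> r \<odot>\<^bsub>M\<^esub> x \<in> B"
        unfolding I_def by blast
      have "\<ominus>\<^bsub>M\<^esub> k \<ominus>\<^bsub>M\<^esub> (\<ominus> r) \<odot>\<^bsub>M\<^esub> x = \<ominus>\<^bsub>M\<^esub> (k \<ominus>\<^bsub>M\<^esub> r \<odot>\<^bsub>M\<^esub> x)"
        using r Kc assms by (simp add: minus_eq M.minus_add smult_l_minus)
      then show "\<ominus> r \<in> I K" unfolding I_def using r B(3) KE(3)
        by (intro CollectI conjI bexI[where x = "\<ominus>\<^bsub>M\<^esub> k"]) auto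
    next
      fix r r' assume "r \<in> I K" "r' \<in> I K"
      then obtain k k' where r: "k \<in> K" "r \<in> carrier R" "k \<ominus>\<^bsub>M\<^esub> r \<odot>\<^bsub>M\<^esub> x \<in> B"
        and r': "k' \<in> K" "r' \<in> carrier R" "k' \<ominus>\<^bsub>M\<^esub> r' \<odot>\<^bsub>M\<^esub> x \<in> B" unfolding I_def by blast
      have "(k \<oplus>\<^bsub>M\<^esub> k') \<ominus>\<^bsub>M\<^esub> (r \<oplus> r') \<odot>\<^bsub>M\<^esub> x = (k \<ominus>\<^bsub>M\<^esub> r \<odot>\<^bsub>M\<^esub> x) \<oplus>\<^bsub>M\<^esub> (k' \<ominus>\<^bsub>M\<^esub> r' \<odot>\<^bsub>M\<^esub> x)"
        using r r' Kc assms by (simp add: smult_l_distr M.add_minus_add)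
      then show "r \<oplus> r' \<in> I K" unfolding I_def using r r' B(5) KE(5)
        by (intro CollectI conjI bexI[where x = "k \<oplus>\<^bsub>M\<^esub> k'"]) auto
    qed (auto simp: I_def)
    have t: "t \<otimes> r \<in> I K" if rI: "r \<in> I K" and t: "t \<in> carrier R" for r t
    proof -
      obtain k where r: "k \<in> K" "r \<in> carrier R" "k \<ominus>\<^bsub>M\<^esub> r \<odot>\<^bsub>M\<^esub> x \<in> B"
        using rI unfolding I_def by blast
      have "t \<odot>\<^bsub>M\<^esub> k \<ominus>\<^bsub>M\<^esub> (t \<otimes> r) \<odot>\<^bsub>M\<^esub> x = t \<odot>\<^bsub>M\<^esub> (k \<ominus>\<^bsub>M\<^esub> r \<odot>\<^bsub>M\<^esub> x)"
        using r t assms Kc by (simp add: smult_minus_distr smult_assoc1)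
      then show ?thesis unfolding I_def using r t B(4) KE(4)
        by (intro CollectI conjI bexI[where x = "t \<odot>\<^bsub>M\<^esub> k"]) auto
    qed
    show "t \<otimes> r \<in> I K" if "r \<in> I K" "t \<in> carrier R" for r t by (rule t[OF that])
    show "r \<otimes> t \<in> I K" if "r \<in> I K" "t \<in> carrier R" for r t
      using t[OF that] that R.m_comm by (simp add: I_def)
  qed (rule R.ring_axioms)
  have "I ` \<C> \<subseteq> {I. ideal I R}" using C ideal by blast
  moreover have "I ` \<C> \<noteq> {}" using assms(6) by simp
  ultimately have "\<exists>K\<in>I ` \<C>. \<forall>K'\<in>I ` \<C>. K \<subseteq> K' \<longrightarrow> K' = K"
    by (rule noetherian_ring.maximal_ideal_in_family[OF assms(1)])
  then obtain J where J: "J \<in> I ` \<C>" "\<forall>K'\<in>I ` \<C>. J \<subseteq> K' \<longrightarrow> K' = J"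
    by (rule bexE) (rule that)
  obtain K0 where K0: "K0 \<in> \<C>" "J = I K0" using J(1) by blast
  \<comment> \<open>Among the members of the family whose ideal is the maximal one
    \<open>I K0\<close>, the intersection with B is maximized next.\<close>
  let ?D = "{K \<inter> B | K. K \<in> \<C> \<and> I K = I K0}"
  have "submodule (K \<inter> B) R M" if "submodule K R M" for K
    by (rule submoduleI) (use submoduleE[OF that] B submodule_zero that assms(2) in auto)
  then have "?D \<subseteq> {K. submodule K R M \<and> K \<subseteq> B}" using C by blast
  moreover have "?D \<noteq> {}" using K0(1) by blast
  ultimately have "\<exists>K\<in>?D. \<forall>K'\<in>?D. K \<subseteq> K' \<longrightarrow> K' = K" by (rule B_max)
  then obtain D where D: "D \<in> ?D" "\<forall>K'\<in>?D. D \<subseteq> K' \<longrightarrow> K' = D"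
    by (rule bexE) (rule that)
  obtain K1 where K1: "K1 \<in> \<C>" "I K1 = I K0" "D = K1 \<inter> B" using D(1) by blast
  have "K' = K1" if K': "K' \<in> \<C>" "K1 \<subseteq> K'" for K'
  proof -
    have "I K1 \<subseteq> I K'" using that(2) unfolding I_def by blast
    then have I: "I K' = I K1" using J(2) K0(2) K1(2) that(1) by simp
    have IB: "K' \<inter> B = K1 \<inter> B" unfolding K1(3)[symmetric]
      by (rule D(2)[rule_format]) (use I K1 K' in auto)
    have sub: "submodule K' R M" "submodule K1 R M" using K1(1) K'(1) C by auto
    \<comment> \<open>Write y = r x + b. Since the ideals of K' and K1 agree, some k in K1 has the
      same coefficient r, and y - k lies in K' and in B, hence in K1.\<close>
    have "y \<in> K1" if y: "y \<in> K'" for y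
    proof -
      obtain r where r: "y \<in> carrier M" "r \<in> carrier R" "y \<ominus>\<^bsub>M\<^esub> r \<odot>\<^bsub>M\<^esub> x \<in> B"
        using y K'(1) C by blast
      then have "r \<in> I K1" using I y unfolding I_def by blast
      then obtain k where k: "k \<in> K1" "k \<ominus>\<^bsub>M\<^esub> r \<odot>\<^bsub>M\<^esub> x \<in> B" unfolding I_def by blast
      have kc: "k \<in> carrier M" using submodule_carrier[OF sub(2) k(1)] .
      have "y \<ominus>\<^bsub>M\<^esub> k \<in> B"
        using submodule_minus_closed[OF assms(2) r(3) k(2)] r kc assms(3)
        by (simp add: M.minus_minus_cancel_right)
      moreover have "y \<ominus>\<^bsub>M\<^esub> k \<in> K'" using submodule_minus_closed[OF sub(1) y] k(1) K'(2) by blast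
      ultimately have "y \<ominus>\<^bsub>M\<^esub> k \<in> K1" using IB by blast
      then show ?thesis using submodule_cong[OF sub(2) r(1) kc] k(1) by simp
    qed
    then show ?thesis using that(2) by blast
  qed
  then show ?thesis using K1(1) by blast
qed

text \<open>The induction over the generators carries some submodule B that contains them and has
  the maximal condition below it, rather than their span. A new generator x replaces B by B + R x;
  only at the end does spanning force B to be everything.\<close>

lemma (in module) noetherian_moduleI:
  assumes "noetherian_ring R" "finitely_generated R M"
  shows "noetherian_module R M"
proof -
  obtain S where S: "finite S" "S \<subseteq> carrier M" "module_span R M S = carrier M"
    using assms(2) unfolding finitely_generated_def by blast
  have "\<exists>B. submodule B R M \<and> S \<subseteq> B \<and> (\<forall>\<C> \<subseteq> {K. submodule K R M \<and> K \<subseteq> B}. \<C> \<noteq> {} \<longrightarrow>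
      (\<exists>K\<in>\<C>. \<forall>K'\<in>\<C>. K \<subseteq> K' \<longrightarrow> K' = K))"
    using S(1,2)
  proof (induction S rule: finite_induct)
    case empty
    have "submodule {\<zero>\<^bsub>M\<^esub>} R M" by (rule submoduleI) auto
    moreover have "K = {\<zero>\<^bsub>M\<^esub>}" if "submodule K R M" "K \<subseteq> {\<zero>\<^bsub>M\<^esub>}" for K
      using that submodule_zero by blast
    ultimately have "\<exists>K\<in>\<C>. \<forall>K'\<in>\<C>. K \<subseteq> K' \<longrightarrow> K' = K"
      if "\<C> \<subseteq> {K. submodule K R M \<and> K \<subseteq> {\<zero>\<^bsub>M\<^esub>}}" "\<C> \<noteq> {}" for \<C>
      using that by (metis (no_types, lifting) all_not_in_conv mem_Collect_eq subsetD)
    with \<open>submodule {\<zero>\<^bsub>M\<^esub>} R M\<close> show ?case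
      by (intro exI[where x = "{\<zero>\<^bsub>M\<^esub>}"]) simp
  next
    case (insert x S)
    then obtain B where B: "submodule B R M" "S \<subseteq> B"
      "\<And>\<C>. \<C> \<subseteq> {K. submodule K R M \<and> K \<subseteq> B} \<Longrightarrow> \<C> \<noteq> {} \<Longrightarrow>
        \<exists>K\<in>\<C>. \<forall>K'\<in>\<C>. K \<subseteq> K' \<longrightarrow> K' = K" by auto
    have x: "x \<in> carrier M" using insert.prems by simp
    note A = submodule_adjoin[OF B(1) x]
    show ?case
      by (rule exI[where x = "{y \<in> carrier M. \<exists>r\<in>carrier R. y \<ominus>\<^bsub>M\<^esub> r \<odot>\<^bsub>M\<^esub> x \<in> B}"],
          intro conjI allI impI A(1), use A(2,3) B(2) in blast)
         (rule maximal_submodule_adjoin[OF assms(1) B(1) x B(3)])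
  qed
  then obtain B where B: "submodule B R M" "S \<subseteq> B"
    "\<And>\<C>. \<C> \<subseteq> {K. submodule K R M \<and> K \<subseteq> B} \<Longrightarrow> \<C> \<noteq> {} \<Longrightarrow>
      \<exists>K\<in>\<C>. \<forall>K'\<in>\<C>. K \<subseteq> K' \<longrightarrow> K' = K" by blast
  have "carrier M \<subseteq> B" using B(1,2) unfolding S(3)[symmetric] module_span_def by blast
  then have "K \<subseteq> B" if "submodule K R M" for K using submodule_carrier[OF that] by blast
  then show ?thesis by unfold_locales (rule B(3), blast+)
qed

section \<open>Localization at a prime\<close>

text \<open>Replaces the usual product of denominators over a finite set of generators: a maximal
  colon submodule (L : s) with s outside p is already all of M.\<close>

lemma (in noetherian_module) uniform_denominator:
  assumes "primeideal p R" "submodule L R M"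
    and "\<And>y. y \<in> carrier M \<Longrightarrow> \<exists>s\<in>carrier R - p. s \<odot>\<^bsub>M\<^esub> y \<in> L"
  shows "\<exists>s\<in>carrier R - p. \<forall>y\<in>carrier M. s \<odot>\<^bsub>M\<^esub> y \<in> L"
proof -
  interpret p: primeideal p R by fact
  let ?C = "{{y \<in> carrier M. s \<odot>\<^bsub>M\<^esub> y \<in> L} | s. s \<in> carrier R - p}"
  have "?C \<subseteq> {K. submodule K R M}" using submodule_preimage_smult[OF assms(2)] by blast
  moreover have "{y \<in> carrier M. \<one> \<odot>\<^bsub>M\<^esub> y \<in> L} \<in> ?C" using p.complement_submonoid(1) by blast
  ultimately have "\<exists>K\<in>?C. \<forall>K'\<in>?C. K \<subseteq> K' \<longrightarrow> K' = K"
    by (intro maximal_submodule_in_family) auto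
  then obtain K where K: "K \<in> ?C" "\<forall>K'\<in>?C. K \<subseteq> K' \<longrightarrow> K' = K"
    by (rule bexE) (rule that)
  obtain s where s: "s \<in> carrier R - p" "K = {y \<in> carrier M. s \<odot>\<^bsub>M\<^esub> y \<in> L}" using K(1) by blast
  have max: "{y \<in> carrier M. t \<odot>\<^bsub>M\<^esub> y \<in> L} = {y \<in> carrier M. s \<odot>\<^bsub>M\<^esub> y \<in> L}"
    if "t \<in> carrier R - p" "{y \<in> carrier M. s \<odot>\<^bsub>M\<^esub> y \<in> L} \<subseteq> {y \<in> carrier M. t \<odot>\<^bsub>M\<^esub> y \<in> L}" for t
    using K(2)[rule_format, of "{y \<in> carrier M. t \<odot>\<^bsub>M\<^esub> y \<in> L}"] that unfolding s(2) by blast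
  have "s \<odot>\<^bsub>M\<^esub> y \<in> L" if y: "y \<in> carrier M" for y
  proof -
    obtain t where t: "t \<in> carrier R - p" "t \<odot>\<^bsub>M\<^esub> y \<in> L" using assms(3)[OF y] by blast
    note L = submoduleE(4)[OF assms(2)]
    \<comment> \<open>(L : t s) contains (L : s), so both agree by maximality; it also contains y
      because t y lies in L.\<close>
    have ts: "t \<otimes> s \<in> carrier R - p" using p.complement_submonoid(2) s t(1) by blast
    have "(t \<otimes> s) \<odot>\<^bsub>M\<^esub> z \<in> L" if "z \<in> carrier M" "s \<odot>\<^bsub>M\<^esub> z \<in> L" for z
      using that s t(1) L by (simp add: smult_assoc1)
    then have "{y \<in> carrier M. (t \<otimes> s) \<odot>\<^bsub>M\<^esub> y \<in> L} = {y \<in> carrier M. s \<odot>\<^bsub>M\<^esub> y \<in> L}"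
      by (intro max[OF ts]) blast
    moreover have "(t \<otimes> s) \<odot>\<^bsub>M\<^esub> y \<in> L"
      using y s t L smult_assoc1[of s t y] R.m_comm[of s t] by simp
    ultimately show ?thesis using y by blast
  qed
  then show ?thesis using s by blast
qed

lemma (in noetherian_module) uniform_annihilator:
  assumes "primeideal p R" "p \<notin> Supp R M"
  shows "\<exists>s\<in>carrier R - p. \<forall>x\<in>carrier M. s \<odot>\<^bsub>M\<^esub> x = \<zero>\<^bsub>M\<^esub>"
proof -
  have "submodule {\<zero>\<^bsub>M\<^esub>} R M" by (rule submoduleI) auto
  from uniform_denominator[OF assms(1) this] show ?thesis
    using assms by (simp add: Supp_iff[OF module_axioms])
qed

text \<open>If \<open>(M / L)\<^sub>p \<noteq> 0\<close> then a submodule \<open>K \<supseteq> L\<close> maximal with \<open>(M / K)\<^sub>p \<noteq> 0\<close> makes \<open>M / K\<close> a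
  torsion-free \<open>R / p\<close>-module of rank one, which embeds into \<open>R / p\<close>. The map
  \<open>M \<rightarrow> M / K \<rightarrow> R / p\<close> is given by representatives \<open>\<rho>\<close>.\<close>

lemma (in noetherian_module) ex_functional_mod_prime:
  assumes "primeideal p R" "submodule L R M" "y0 \<in> carrier M"
    and y0: "\<And>s. s \<in> carrier R - p \<Longrightarrow> s \<odot>\<^bsub>M\<^esub> y0 \<notin> L"
  obtains \<rho> a where "\<forall>x\<in>carrier M. \<rho> x \<in> carrier R"
    and "\<forall>x\<in>carrier M. \<forall>y\<in>carrier M. \<rho> (x \<oplus>\<^bsub>M\<^esub> y) \<ominus> (\<rho> x \<oplus> \<rho> y) \<in> p"
    and "\<forall>r\<in>carrier R. \<forall>x\<in>carrier M. \<rho> (r \<odot>\<^bsub>M\<^esub> x) \<ominus> r \<otimes> \<rho> x \<in> p"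
    and "\<forall>x\<in>L. \<rho> x \<in> p" and "a \<in> carrier M" "\<rho> a \<notin> p"
proof -
  interpret p: primeideal p R by fact
  let ?S = "carrier R - p"
  note S = p.complement_submonoid
  let ?C = "{K. submodule K R M \<and> L \<subseteq> K \<and> (\<exists>y\<in>carrier M. \<forall>s\<in>?S. s \<odot>\<^bsub>M\<^esub> y \<notin> K)}"
  have "\<exists>K\<in>?C. \<forall>K'\<in>?C. K \<subseteq> K' \<longrightarrow> K' = K"
    by (rule maximal_submodule_in_family) (use assms in blast)+
  then obtain K where "K \<in> ?C" and max: "\<forall>K'\<in>?C. K \<subseteq> K' \<longrightarrow> K' = K"
    by (rule bexE) (rule that)
  then obtain y1 where K: "submodule K R M" "L \<subseteq> K"
    and y1: "y1 \<in> carrier M" "\<And>s. s \<in> ?S \<Longrightarrow> s \<odot>\<^bsub>M\<^esub> y1 \<notin> K" by blast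
  note KE = submoduleE[OF K(1)]
  \<comment> \<open>(K : s) still belongs to the family, as the same \<open>y1\<close> shows, so it
    equals K: elements outside p act injectively on M / K.\<close>
  have tf: "y \<in> K" if s: "s \<in> ?S" and y: "y \<in> carrier M" "s \<odot>\<^bsub>M\<^esub> y \<in> K" for s y
  proof -
    let ?K' = "{y \<in> carrier M. s \<odot>\<^bsub>M\<^esub> y \<in> K}"
    have sub: "submodule ?K' R M" by (rule submodule_preimage_smult[OF K(1)]) (use s in blast)
    have "K \<subseteq> ?K'" using KE s by blast
    moreover have "\<forall>t\<in>?S. t \<odot>\<^bsub>M\<^esub> y1 \<notin> ?K'"
    proof
      fix t assume t: "t \<in> ?S"
      have "(s \<otimes> t) \<odot>\<^bsub>M\<^esub> y1 \<notin> K" using y1(2) S(2)[OF s t] .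
      then show "t \<odot>\<^bsub>M\<^esub> y1 \<notin> ?K'" using s t y1(1) by (simp add: smult_assoc1)
    qed
    ultimately have "?K' \<in> ?C" using sub K(2) y1(1) by blast
    from max[rule_format, OF this \<open>K \<subseteq> ?K'\<close>] show ?thesis using y by blast
  qed
  have "y1 \<notin> K" using y1(2)[OF S(1)] y1(1) by simp
  \<comment> \<open>Adjoining a leaves the family, so M / (K + R a) vanishes at p, and one s moves
    all of M into K + R a. This is rank one at p.\<close>
  have line: "\<exists>s\<in>?S. \<forall>y\<in>carrier M. \<exists>r\<in>carrier R. s \<odot>\<^bsub>M\<^esub> y \<ominus>\<^bsub>M\<^esub> r \<odot>\<^bsub>M\<^esub> a \<in> K"
    if a: "a \<in> carrier M" "a \<notin> K" for a
  proof -
    let ?A = "{y \<in> carrier M. \<exists>r\<in>carrier R. y \<ominus>\<^bsub>M\<^esub> r \<odot>\<^bsub>M\<^esub> a \<in> K}"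
    note A = submodule_adjoin[OF K(1) a(1)]
    have "?A \<notin> ?C" using max[rule_format, OF _ A(2)] A(3) a(2) by blast
    then have "\<forall>y\<in>carrier M. \<exists>s\<in>?S. s \<odot>\<^bsub>M\<^esub> y \<in> ?A" using A K(2) by blast
    then have "\<exists>s\<in>?S. \<forall>y\<in>carrier M. s \<odot>\<^bsub>M\<^esub> y \<in> ?A"
      by (intro uniform_denominator assms(1) A(1)) blast
    then show ?thesis by blast
  qed
  \<comment> \<open>Applied to a = r b, the previous fact gives (s - t r) b in K with s - t r
    outside p, so b is in K by \<open>tf\<close>: a contradiction. Thus p annihilates M / K.\<close>
  have pK: "r \<odot>\<^bsub>M\<^esub> b \<in> K" if r: "r \<in> p" and b: "b \<in> carrier M" for r b
  proof (rule ccontr)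
    assume rb: "r \<odot>\<^bsub>M\<^esub> b \<notin> K"
    have rc: "r \<in> carrier R" using r p.a_subset by blast
    obtain s t where s: "s \<in> ?S" and t: "t \<in> carrier R"
      "s \<odot>\<^bsub>M\<^esub> b \<ominus>\<^bsub>M\<^esub> t \<odot>\<^bsub>M\<^esub> (r \<odot>\<^bsub>M\<^esub> b) \<in> K"
      using line[OF _ rb] b rc by blast
    have "(s \<ominus> t \<otimes> r) \<odot>\<^bsub>M\<^esub> b \<in> K"
      using t s rc b by (simp add: smult_diff_distr smult_assoc1)
    moreover have "s \<ominus> t \<otimes> r \<in> ?S"
    proof -
      have "t \<otimes> r \<in> p" using p.I_l_closed r t(1) by blast
      moreover have "(s \<ominus> t \<otimes> r) \<oplus> t \<otimes> r = s"
        using s t(1) rc by (simp add: R.minus_eq R.a_assoc R.l_neg)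
      ultimately have "s \<ominus> t \<otimes> r \<notin> p" using s p.a_closed by fastforce
      then show ?thesis using s t(1) rc by simp
    qed
    ultimately have "b \<in> K" using tf b by blast
    then show False using rb KE(4) rc by blast
  qed
  obtain s where s: "s \<in> ?S" and "\<forall>y\<in>carrier M. \<exists>r\<in>carrier R. s \<odot>\<^bsub>M\<^esub> y \<ominus>\<^bsub>M\<^esub> r \<odot>\<^bsub>M\<^esub> y1 \<in> K"
    using line[OF y1(1) \<open>y1 \<notin> K\<close>] by blast
  \<comment> \<open>The coordinate of s y along \<open>y1\<close>. It is determined only modulo p,
    the annihilator of \<open>y1\<close> modulo K; the choice therefore is linear only modulo
    p.\<close>
  then obtain \<rho> where \<rho>: "\<And>y. y \<in> carrier M \<Longrightarrow> \<rho> y \<in> carrier R"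
    "\<And>y. y \<in> carrier M \<Longrightarrow> s \<odot>\<^bsub>M\<^esub> y \<ominus>\<^bsub>M\<^esub> \<rho> y \<odot>\<^bsub>M\<^esub> y1 \<in> K" by metis
  have inp: "r \<in> p" if "r \<in> carrier R" "r \<odot>\<^bsub>M\<^esub> y1 \<in> K" for r
    using tf[of r y1] that y1(1) \<open>y1 \<notin> K\<close> by blast
  have uniq: "r \<ominus> t \<in> p"
    if "y \<in> carrier M" "r \<in> carrier R" "t \<in> carrier R"
      "s \<odot>\<^bsub>M\<^esub> y \<ominus>\<^bsub>M\<^esub> r \<odot>\<^bsub>M\<^esub> y1 \<in> K" "s \<odot>\<^bsub>M\<^esub> y \<ominus>\<^bsub>M\<^esub> t \<odot>\<^bsub>M\<^esub> y1 \<in> K" for y r t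
  proof (rule inp)
    have sc: "s \<in> carrier R" using s by blast
    have "(s \<odot>\<^bsub>M\<^esub> y \<ominus>\<^bsub>M\<^esub> t \<odot>\<^bsub>M\<^esub> y1) \<ominus>\<^bsub>M\<^esub> (s \<odot>\<^bsub>M\<^esub> y \<ominus>\<^bsub>M\<^esub> r \<odot>\<^bsub>M\<^esub> y1) = (r \<ominus> t) \<odot>\<^bsub>M\<^esub> y1"
      using that(1-3) y1(1) sc
      by (simp add: smult_diff_distr minus_eq M.minus_add M.a_ac M.add_swap_cancel M.r_neg2)
    then show "(r \<ominus> t) \<odot>\<^bsub>M\<^esub> y1 \<in> K" using submodule_minus_closed[OF K(1) that(5,4)] by simp
  qed (use that in simp)
  have sc: "s \<in> carrier R" using s by blast
  have "\<rho> (x \<oplus>\<^bsub>M\<^esub> y) \<ominus> (\<rho> x \<oplus> \<rho> y) \<in> p" if "x \<in> carrier M" "y \<in> carrier M" for x y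
  proof (rule uniq)
    have "s \<odot>\<^bsub>M\<^esub> (x \<oplus>\<^bsub>M\<^esub> y) \<ominus>\<^bsub>M\<^esub> (\<rho> x \<oplus> \<rho> y) \<odot>\<^bsub>M\<^esub> y1 =
        (s \<odot>\<^bsub>M\<^esub> x \<ominus>\<^bsub>M\<^esub> \<rho> x \<odot>\<^bsub>M\<^esub> y1) \<oplus>\<^bsub>M\<^esub> (s \<odot>\<^bsub>M\<^esub> y \<ominus>\<^bsub>M\<^esub> \<rho> y \<odot>\<^bsub>M\<^esub> y1)"
      using that \<rho>(1) sc y1(1) by (simp add: smult_l_distr smult_r_distr M.add_minus_add)
    then show "s \<odot>\<^bsub>M\<^esub> (x \<oplus>\<^bsub>M\<^esub> y) \<ominus>\<^bsub>M\<^esub> (\<rho> x \<oplus> \<rho> y) \<odot>\<^bsub>M\<^esub> y1 \<in> K"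
      using KE(5) \<rho>(2) that by simp
  qed (use that \<rho> in auto)
  moreover have "\<rho> (r \<odot>\<^bsub>M\<^esub> x) \<ominus> r \<otimes> \<rho> x \<in> p" if "r \<in> carrier R" "x \<in> carrier M" for r x
  proof (rule uniq)
    have "s \<odot>\<^bsub>M\<^esub> (r \<odot>\<^bsub>M\<^esub> x) = r \<odot>\<^bsub>M\<^esub> (s \<odot>\<^bsub>M\<^esub> x)"
      using that sc by (metis smult_assoc1 R.m_comm)
    then have "s \<odot>\<^bsub>M\<^esub> (r \<odot>\<^bsub>M\<^esub> x) \<ominus>\<^bsub>M\<^esub> (r \<otimes> \<rho> x) \<odot>\<^bsub>M\<^esub> y1 =
        r \<odot>\<^bsub>M\<^esub> (s \<odot>\<^bsub>M\<^esub> x \<ominus>\<^bsub>M\<^esub> \<rho> x \<odot>\<^bsub>M\<^esub> y1)"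
      using that \<rho>(1) sc y1(1) by (simp add: smult_assoc1 smult_minus_distr)
    then show "s \<odot>\<^bsub>M\<^esub> (r \<odot>\<^bsub>M\<^esub> x) \<ominus>\<^bsub>M\<^esub> (r \<otimes> \<rho> x) \<odot>\<^bsub>M\<^esub> y1 \<in> K"
      using KE(4) \<rho>(2) that by simp
  qed (use that \<rho> in auto)
  moreover have "\<rho> x \<in> p" if x: "x \<in> L" for x
  proof (rule inp)
    have "x \<in> K" using x K(2) by blast
    then have xc: "x \<in> carrier M" "x \<in> K" by (simp_all add: submodule_carrier[OF K(1)])
    then show "\<rho> x \<in> carrier R" using \<rho>(1) by blast
    have "s \<odot>\<^bsub>M\<^esub> x \<in> K" using KE(4) xc sc by blast
    then show "\<rho> x \<odot>\<^bsub>M\<^esub> y1 \<in> K"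
      using submodule_cong[OF K(1) _ _ \<rho>(2)[OF xc(1)]] xc \<rho>(1) y1(1) sc by simp
  qed
  \<comment> \<open>\<open>\<rho> y1\<close> is congruent to s modulo p: otherwise \<open>pK\<close>
    would place s \<open>y1\<close> in K.\<close>
  moreover have "\<rho> y1 \<notin> p"
  proof
    assume "\<rho> y1 \<in> p"
    then have "\<rho> y1 \<odot>\<^bsub>M\<^esub> y1 \<in> K" using pK y1(1) by blast
    then have "s \<odot>\<^bsub>M\<^esub> y1 \<in> K"
      using submodule_cong[OF K(1) _ _ \<rho>(2)[OF y1(1)]] \<rho>(1) y1(1) sc by simp
    then show False using y1(2) s by blast
  qed
  ultimately show thesis using \<rho>(1) y1(1) by (intro that[of \<rho> y1] ballI)
qed

lemma (in noetherian_module) Supp_functional: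
  assumes "p \<in> Supp R M"
  obtains \<rho> a where "\<forall>x\<in>carrier M. \<rho> x \<in> carrier R"
    and "\<forall>x\<in>carrier M. \<forall>y\<in>carrier M. \<rho> (x \<oplus>\<^bsub>M\<^esub> y) \<ominus> (\<rho> x \<oplus> \<rho> y) \<in> p"
    and "\<forall>r\<in>carrier R. \<forall>x\<in>carrier M. \<rho> (r \<odot>\<^bsub>M\<^esub> x) \<ominus> r \<otimes> \<rho> x \<in> p"
    and "\<rho> \<zero>\<^bsub>M\<^esub> \<in> p" and "a \<in> carrier M" "\<rho> a \<notin> p"
proof -
  have Z: "submodule {\<zero>\<^bsub>M\<^esub>} R M" by (rule submoduleI) auto
  obtain x0 where p: "primeideal p R"
    and x0: "x0 \<in> carrier M" "\<And>s. s \<in> carrier R - p \<Longrightarrow> s \<odot>\<^bsub>M\<^esub> x0 \<notin> {\<zero>\<^bsub>M\<^esub>}"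
    using assms unfolding Supp_iff[OF module_axioms] by blast
  show thesis
    by (rule ex_functional_mod_prime[OF p Z x0]) (assumption | rule that | simp)+
qed

text \<open>A functional to R / p that kills L also kills x M, since x is in p. It kills L + x M but
  no multiple s a with s outside p, which keeps M / (L + x M) nonzero at p.\<close>

lemma (in noetherian_module) nakayama_at_prime:
  assumes "primeideal p R" "submodule L R M" "y0 \<in> carrier M"
    and "\<And>s. s \<in> carrier R - p \<Longrightarrow> s \<odot>\<^bsub>M\<^esub> y0 \<notin> L" and x: "x \<in> p"
  shows "\<exists>y\<in>carrier M. \<forall>s\<in>carrier R - p.
    s \<odot>\<^bsub>M\<^esub> y \<notin> {y \<in> carrier M. \<exists>z\<in>carrier M. y \<ominus>\<^bsub>M\<^esub> x \<odot>\<^bsub>M\<^esub> z \<in> L}"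
proof -
  interpret p: primeideal p R by fact
  obtain \<rho> a where "\<forall>x\<in>carrier M. \<rho> x \<in> carrier R"
    and "\<forall>x\<in>carrier M. \<forall>y\<in>carrier M. \<rho> (x \<oplus>\<^bsub>M\<^esub> y) \<ominus> (\<rho> x \<oplus> \<rho> y) \<in> p"
    and "\<forall>r\<in>carrier R. \<forall>x\<in>carrier M. \<rho> (r \<odot>\<^bsub>M\<^esub> x) \<ominus> r \<otimes> \<rho> x \<in> p"
    and "\<forall>x\<in>L. \<rho> x \<in> p" and a: "a \<in> carrier M" "\<rho> a \<notin> p"
    by (rule ex_functional_mod_prime[OF assms(1-3) assms(4)]) (assumption | rule that)+
  note \<rho>c = this(1)[rule_format] and add = this(2)[rule_format] and sm = this(3)[rule_format]
    and \<rho>L = this(4)[rule_format]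
  have cong: "r \<in> p \<longleftrightarrow> t \<in> p" if "r \<in> carrier R" "t \<in> carrier R" "r \<ominus> t \<in> p" for r t
    by (rule p.cong_mem_iff[OF that])
  have "s \<odot>\<^bsub>M\<^esub> a \<notin> {y \<in> carrier M. \<exists>z\<in>carrier M. y \<ominus>\<^bsub>M\<^esub> x \<odot>\<^bsub>M\<^esub> z \<in> L}"
    if s: "s \<in> carrier R - p" for s
  proof
    assume "s \<odot>\<^bsub>M\<^esub> a \<in> {y \<in> carrier M. \<exists>z\<in>carrier M. y \<ominus>\<^bsub>M\<^esub> x \<odot>\<^bsub>M\<^esub> z \<in> L}"
    then obtain z where z: "z \<in> carrier M" "s \<odot>\<^bsub>M\<^esub> a \<ominus>\<^bsub>M\<^esub> x \<odot>\<^bsub>M\<^esub> z \<in> L" by blast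
    have xc: "x \<in> carrier R" using x p.a_subset by blast
    define l where "l = s \<odot>\<^bsub>M\<^esub> a \<ominus>\<^bsub>M\<^esub> x \<odot>\<^bsub>M\<^esub> z"
    have l: "l \<in> L" "l \<in> carrier M" using z s a xc unfolding l_def by auto
    have "s \<odot>\<^bsub>M\<^esub> a = l \<oplus>\<^bsub>M\<^esub> x \<odot>\<^bsub>M\<^esub> z"
      using z(1) s a(1) xc by (simp add: l_def minus_eq M.a_assoc M.l_neg)
    then have "\<rho> (s \<odot>\<^bsub>M\<^esub> a) \<ominus> (\<rho> l \<oplus> \<rho> (x \<odot>\<^bsub>M\<^esub> z)) \<in> p" using add[OF l(2), of "x \<odot>\<^bsub>M\<^esub> z"] z(1) xc by simp
    moreover have "\<rho> (x \<odot>\<^bsub>M\<^esub> z) \<in> p"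
      using cong[OF _ _ sm[OF xc z(1)]] z(1) xc \<rho>c p.I_r_closed[OF x] by simp
    then have "\<rho> l \<oplus> \<rho> (x \<odot>\<^bsub>M\<^esub> z) \<in> p" using \<rho>L[OF l(1)] by simp
    ultimately have "\<rho> (s \<odot>\<^bsub>M\<^esub> a) \<in> p"
      using cong[of "\<rho> (s \<odot>\<^bsub>M\<^esub> a)" "\<rho> l \<oplus> \<rho> (x \<odot>\<^bsub>M\<^esub> z)"] \<rho>c s a(1) l(2) z(1) xc by simp
    then have "s \<otimes> \<rho> a \<in> p" using cong[OF _ _ sm[of s a]] s a(1) \<rho>c by simp
    then show False using p.I_prime[of s "\<rho> a"] s a \<rho>c by blast
  qed
  then show ?thesis using a(1) by blast
qed

section \<open>Zero divisors and prime avoidance\<close>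

text \<open>A product of elements of the ideals, one from each and all outside P, stays outside P.
  Contrapositively, a prime that contains a finite intersection of ideals contains one of
  them.\<close>

lemma (in cring) ex_common_element_avoiding_prime:
  assumes "finite \<F>" "\<And>I. I \<in> \<F> \<Longrightarrow> ideal I R" "primeideal P R" "\<And>I. I \<in> \<F> \<Longrightarrow> \<not> I \<subseteq> P"
  shows "\<exists>z\<in>carrier R - P. \<forall>I\<in>\<F>. z \<in> I"
  using assms(1,2,4)
proof (induction \<F> rule: finite_induct)
  case empty
  then show ?case using primeideal.complement_submonoid(1)[OF assms(3)] by blast
next
  case (insert I \<F>)
  interpret P: primeideal P R by fact
  interpret I: ideal I R using insert.prems by blast
  obtain z where z: "z \<in> carrier R - P" "\<forall>J\<in>\<F>. z \<in> J" using insert by blast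
  obtain b where b: "b \<in> I" "b \<notin> P" using insert.prems by blast
  have bc: "b \<in> carrier R" using b(1) I.a_subset by blast
  have "z \<otimes> b \<in> carrier R - P" using P.complement_submonoid(2) z(1) b bc by blast
  moreover have "z \<otimes> b \<in> J" if "J \<in> \<F>" for J
    using ideal.I_r_closed[of J R z b] insert.prems that z(2) bc by blast
  moreover have "z \<otimes> b \<in> I" using I.I_l_closed b z by blast
  ultimately show ?case by blast
qed

lemma (in cring) prime_avoidance_antichain:
  assumes "finite \<F>" "\<And>P. P \<in> \<F> \<Longrightarrow> primeideal P R" "ideal I R" "\<And>P. P \<in> \<F> \<Longrightarrow> \<not> I \<subseteq> P"
    and "\<And>P Q. P \<in> \<F> \<Longrightarrow> Q \<in> \<F> \<Longrightarrow> P \<subseteq> Q \<Longrightarrow> P = Q"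
  shows "\<exists>x\<in>I. \<forall>P\<in>\<F>. x \<notin> P"
  using assms(1,2,4,5)
proof (induction \<F> rule: finite_induct)
  case empty
  then show ?case using additive_subgroup.zero_closed ideal.axioms(1) assms(3) by blast
next
  case (insert P \<F>)
  interpret I: ideal I R by fact
  interpret P: primeideal P R using insert.prems by blast
  obtain x where x: "x \<in> I" "\<And>Q. Q \<in> \<F> \<Longrightarrow> x \<notin> Q"
  proof -
    have "\<exists>x\<in>I. \<forall>Q\<in>\<F>. x \<notin> Q" by (rule insert.IH) (use insert.prems in auto)
    with that show ?thesis by blast
  qed
  show ?case
  proof (cases "x \<in> P")
    case False
    then show ?thesis using x by blast
  next
    case True
    \<comment> \<open>By the antichain condition no member of \<F> lies in P, and neither does I.
      For the z obtained, x + z avoids every prime: in P lies x but not z, in the others z but not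
      x.\<close>
    have "\<exists>z\<in>carrier R - P. \<forall>J\<in>insert I \<F>. z \<in> J"
    proof (rule ex_common_element_avoiding_prime)
      show "\<not> J \<subseteq> P" if "J \<in> insert I \<F>" for J
        using that insert.prems(2)[of P] insert.prems(3)[of J P] insert.hyps(2) by blast
      show "ideal J R" if "J \<in> insert I \<F>" for J
        using that assms(3) insert.prems(1) primeideal.axioms(1) by blast
    qed (use insert P.primeideal_axioms in auto)
    then obtain z where z: "z \<in> carrier R" "z \<notin> P" "z \<in> I" "\<And>Q. Q \<in> \<F> \<Longrightarrow> z \<in> Q" by blast
    have xc: "x \<in> carrier R" using x(1) I.a_subset by blast
    have 1: "(x \<oplus> z) \<ominus> z = x" "(x \<oplus> z) \<ominus> x = z"
      using xc z(1) by (simp_all add: minus_eq a_ac add_swap_cancel r_neg)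
    have minus: "b \<ominus> c \<in> Q" if "ideal Q R" "b \<in> Q" "c \<in> Q" for Q b c
      using that additive_subgroup.a_closed additive_subgroup.a_inv_closed abelian_group_axioms
      unfolding minus_eq by (metis ideal.axioms(1))
    have "x \<oplus> z \<notin> Q" if "Q \<in> insert P \<F>" for Q
    proof
      assume "x \<oplus> z \<in> Q"
      moreover have "ideal Q R" using that insert.prems(1) primeideal.axioms(1) by blast
      ultimately show False using minus[of Q "x \<oplus> z"] 1 z(2,4) x(2) True that by (metis insertE)
    qed
    moreover have "x \<oplus> z \<in> I" using x z by blast
    ultimately show ?thesis by blast
  qed
qed

lemma (in module) ideal_annihilator_mod:
  assumes "submodule L R M" "y \<in> carrier M"
  shows "ideal {r \<in> carrier R. r \<odot>\<^bsub>M\<^esub> y \<in> L} R"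
proof (rule idealI)
  note L = submoduleE[OF assms(1)]
  show "subgroup {r \<in> carrier R. r \<odot>\<^bsub>M\<^esub> y \<in> L} (add_monoid R)"
  proof (rule R.add.subgroupI; (unfold monoid_record_simps a_inv_def[symmetric])?)
    have "\<zero> \<odot>\<^bsub>M\<^esub> y \<in> L" using assms submodule_zero by simp
    then show "{r \<in> carrier R. r \<odot>\<^bsub>M\<^esub> y \<in> L} \<noteq> {}" by blast
  qed (use assms L in \<open>auto simp: smult_l_distr smult_l_minus\<close>)
  show "t \<otimes> r \<in> {r \<in> carrier R. r \<odot>\<^bsub>M\<^esub> y \<in> L}"
    if "r \<in> {r \<in> carrier R. r \<odot>\<^bsub>M\<^esub> y \<in> L}" "t \<in> carrier R" for r t
    using that L(4) assms(2) by (auto simp: smult_assoc1)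
  then show "r \<otimes> t \<in> {r \<in> carrier R. r \<odot>\<^bsub>M\<^esub> y \<in> L}"
    if "r \<in> {r \<in> carrier R. r \<odot>\<^bsub>M\<^esub> y \<in> L}" "t \<in> carrier R" for r t
    using that R.m_comm[of r t] by auto
qed (rule R.ring_axioms)

text \<open>The maximal annihilators of nonzero elements of \<open>M / L\<close> are prime, and by the chain condition on
  \<open>M\<close> there are only finitely many of them, so prime avoidance applies.\<close>

lemma (in noetherian_module) ideal_of_zero_divisors_annihilates:
  assumes "noetherian_ring R" "submodule L R M" "ideal I R"
    and zd: "\<And>x. x \<in> I \<Longrightarrow> \<exists>y\<in>carrier M - L. x \<odot>\<^bsub>M\<^esub> y \<in> L"
  shows "\<exists>y\<in>carrier M - L. \<forall>x\<in>I. x \<odot>\<^bsub>M\<^esub> y \<in> L"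
proof -
  note L = submoduleE[OF assms(2)]
  define Ann where "Ann y = {r \<in> carrier R. r \<odot>\<^bsub>M\<^esub> y \<in> L}" for y
  define \<A> where "\<A> = {P \<in> Ann ` (carrier M - L). \<forall>Q\<in>Ann ` (carrier M - L). P \<subseteq> Q \<longrightarrow> Q = P}"
  have id: "ideal (Ann y) R" if "y \<in> carrier M" for y
    unfolding Ann_def by (rule ideal_annihilator_mod[OF assms(2) that])
  have prime: "primeideal P R" if P: "P \<in> \<A>" for P
  proof -
    obtain y where y: "y \<in> carrier M" "y \<notin> L" "P = Ann y" using P unfolding \<A>_def by blast
    show ?thesis
    proof (rule primeidealI)
      show "ideal P R" using id y by simp
      have "\<one> \<notin> P" using y by (simp add: Ann_def)
      then show "carrier R \<noteq> P" by blast
    next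
      fix a b assume ab: "a \<in> carrier R" "b \<in> carrier R" "a \<otimes> b \<in> P"
      have "a \<in> P" if "b \<notin> P"
      proof -
        have bY: "b \<odot>\<^bsub>M\<^esub> y \<in> carrier M - L" using that ab(2) y by (simp add: Ann_def)
        \<comment> \<open>By maximality of P the annihilator of b y modulo L is P again; so a b in P
          means a in Ann (b y) = P.\<close>
        moreover have "P \<subseteq> Ann (b \<odot>\<^bsub>M\<^esub> y)"
        proof
          fix r assume "r \<in> P"
          then have r: "r \<in> carrier R" "r \<odot>\<^bsub>M\<^esub> y \<in> L" using y by (auto simp: Ann_def)
          have "r \<odot>\<^bsub>M\<^esub> (b \<odot>\<^bsub>M\<^esub> y) = b \<odot>\<^bsub>M\<^esub> (r \<odot>\<^bsub>M\<^esub> y)"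
            using r(1) ab(2) y(1) by (metis smult_assoc1 R.m_comm)
          then show "r \<in> Ann (b \<odot>\<^bsub>M\<^esub> y)" using r L(4) ab(2) by (simp add: Ann_def)
        qed
        ultimately have "Ann (b \<odot>\<^bsub>M\<^esub> y) = P" using P unfolding \<A>_def by blast
        then show ?thesis using ab y by (auto simp: Ann_def smult_assoc1)
      qed
      then show "a \<in> P \<or> b \<in> P" by blast
    qed (rule R.is_cring)
  qed
  have above: "\<exists>P\<in>\<A>. Ann y \<subseteq> P" if y: "y \<in> carrier M - L" for y
  proof -
    have "\<exists>P\<in>{P \<in> Ann ` (carrier M - L). Ann y \<subseteq> P}.
      \<forall>Q\<in>{P \<in> Ann ` (carrier M - L). Ann y \<subseteq> P}. P \<subseteq> Q \<longrightarrow> Q = P"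
      by (rule noetherian_ring.maximal_ideal_in_family[OF assms(1)]) (use y id in auto)
    then obtain P where "P \<in> {P \<in> Ann ` (carrier M - L). Ann y \<subseteq> P}"
      and max: "\<forall>Q\<in>{P \<in> Ann ` (carrier M - L). Ann y \<subseteq> P}. P \<subseteq> Q \<longrightarrow> Q = P"
      by (rule bexE) (rule that)
    then have P: "P \<in> Ann ` (carrier M - L)" "Ann y \<subseteq> P" by simp_all
    have "P \<in> \<A>" unfolding \<A>_def
    proof (intro CollectI conjI ballI impI P(1))
      show "Q = P" if "Q \<in> Ann ` (carrier M - L)" "P \<subseteq> Q" for Q
        by (rule max[rule_format]) (use that P(2) in auto)
    qed
    then show ?thesis using P(2) by blast
  qed
  \<comment> \<open>\<open>Z \<F>\<close> consists of the elements that the intersection of \<F>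
    sends into L. It grows with \<F>, so the maximal condition on M stops it at a finite
    \<F>.\<close>
  define Z where "Z \<F> = {y \<in> carrier M. \<forall>r\<in>carrier R. (\<forall>Q\<in>\<F>. r \<in> Q) \<longrightarrow> r \<odot>\<^bsub>M\<^esub> y \<in> L}"
    for \<F> :: "'a set set"
  have "submodule (Z \<F>) R M" for \<F>
  proof (rule submoduleI)
    fix t x assume t: "t \<in> carrier R" and x: "x \<in> Z \<F>"
    have "r \<odot>\<^bsub>M\<^esub> (t \<odot>\<^bsub>M\<^esub> x) = t \<odot>\<^bsub>M\<^esub> (r \<odot>\<^bsub>M\<^esub> x)" if "r \<in> carrier R" for r
      using that t x unfolding Z_def by (metis (no_types, lifting) mem_Collect_eq smult_assoc1 R.m_comm)
    then show "t \<odot>\<^bsub>M\<^esub> x \<in> Z \<F>" using t x L(4) unfolding Z_def by simp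
  qed (use L submodule_zero[OF assms(2)] in \<open>auto simp: Z_def smult_r_distr smult_r_minus\<close>)
  then have "\<exists>K\<in>Z ` {\<F>. finite \<F> \<and> \<F> \<subseteq> \<A>}. \<forall>K'\<in>Z ` {\<F>. finite \<F> \<and> \<F> \<subseteq> \<A>}. K \<subseteq> K' \<longrightarrow> K' = K"
    by (intro maximal_submodule_in_family) auto
  then obtain K where K: "K \<in> Z ` {\<F>. finite \<F> \<and> \<F> \<subseteq> \<A>}"
    "\<forall>K'\<in>Z ` {\<F>. finite \<F> \<and> \<F> \<subseteq> \<A>}. K \<subseteq> K' \<longrightarrow> K' = K" by (rule bexE) (rule that)
  obtain \<F> where F: "finite \<F>" "\<F> \<subseteq> \<A>" "K = Z \<F>" using K(1) by blast
  have max: "Z \<G> = Z \<F>" if "finite \<G>" "\<G> \<subseteq> \<A>" "Z \<F> \<subseteq> Z \<G>" for \<G>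
    using K(2)[rule_format, of "Z \<G>"] that unfolding F(3) by simp
  \<comment> \<open>Adding P cannot enlarge \<open>Z \<F>\<close>, so the y with P = Ann y is
    already in it. The intersection of \<F> then lies in P, hence some Q in \<F> does, and Q = P
    since Q is maximal.\<close>
  have "P \<in> \<F>" if P: "P \<in> \<A>" for P
  proof -
    obtain y where y: "y \<in> carrier M" "y \<notin> L" "P = Ann y" using P unfolding \<A>_def by blast
    have "Z (insert P \<F>) = Z \<F>" by (rule max) (use F P in \<open>auto simp: Z_def\<close>)
    moreover have "y \<in> Z (insert P \<F>)" using y by (auto simp: Z_def Ann_def)
    ultimately have "y \<in> Z \<F>" by blast
    then have "r \<in> P" if "r \<in> carrier R" "\<forall>Q\<in>\<F>. r \<in> Q" for r
      using that y(3) by (auto simp: Z_def Ann_def)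
    then have "\<not> (\<exists>z\<in>carrier R - P. \<forall>Q\<in>\<F>. z \<in> Q)" by blast
    moreover have "ideal Q R" if "Q \<in> \<F>" for Q
      using that F(2) prime primeideal.axioms(1) by blast
    ultimately obtain Q where Q: "Q \<in> \<F>" "Q \<subseteq> P"
      using R.ex_common_element_avoiding_prime[OF F(1) _ prime[OF P]] by metis
    have "\<forall>P'\<in>Ann ` (carrier M - L). Q \<subseteq> P' \<longrightarrow> P' = Q" using F(2) Q(1) unfolding \<A>_def by blast
    then have "P = Q" using Q(2) y by blast
    then show ?thesis using Q(1) by simp
  qed
  then have fin: "finite \<A>" by (rule finite_subset[OF subsetI F(1)])
  have "\<exists>P\<in>\<A>. I \<subseteq> P"
  proof (rule ccontr)
    assume no: "\<not> ?thesis"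
    then obtain x where x: "x \<in> I" "\<And>P. P \<in> \<A> \<Longrightarrow> x \<notin> P"
    proof -
      have "\<exists>x\<in>I. \<forall>P\<in>\<A>. x \<notin> P"
      proof (rule R.prime_avoidance_antichain[OF fin prime assms(3)])
        show "P = Q" if "P \<in> \<A>" "Q \<in> \<A>" "P \<subseteq> Q" for P Q
          using that unfolding \<A>_def by blast
      qed (use no in blast)+
      with that show ?thesis by blast
    qed
    obtain y where y: "y \<in> carrier M - L" "x \<odot>\<^bsub>M\<^esub> y \<in> L" using zd[OF x(1)] by blast
    have "x \<in> Ann y" using y(2) x(1) additive_subgroup.a_subset[OF ideal.axioms(1)[OF assms(3)]]
      by (auto simp: Ann_def)
    then show False using above[OF y(1)] x(2) by blast
  qed
  then obtain y where "y \<in> carrier M - L" "I \<subseteq> Ann y" unfolding \<A>_def by blast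
  then show ?thesis unfolding Ann_def by blast
qed

section \<open>Complexes of free modules\<close>

text \<open>Free terms and \<open>d n (d (Suc n) u)\<close> = 0 are what the transfer of acyclicity
  from L to larger submodules consumes. Exactness enters with \<open>free_res\<close>, for the
  homotopies.\<close>

locale free_complex = cring R
  for R :: "('a, 'k) ring_scheme" (structure) and F :: "nat \<Rightarrow> ('a, 'x \<Rightarrow> 'a) module" and X :: "nat \<Rightarrow> 'x set"
    and d :: "nat \<Rightarrow> ('x \<Rightarrow> 'a) \<Rightarrow> ('x \<Rightarrow> 'a)" +
  assumes free: "F n = free_module R (X n)"
    and d_hom: "d n \<in> module_hom R (F (Suc n)) (F n)"
    and d_d: "u \<in> carrier (F (Suc (Suc n))) \<Longrightarrow> d n (d (Suc n) u) = \<zero>\<^bsub>F n\<^esub>"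
begin

lemma F_module: "module R (F n)"
  unfolding free by (rule module_free_module[OF is_cring])

lemma d_closed: "u \<in> carrier (F (Suc n)) \<Longrightarrow> d n u \<in> carrier (F n)"
  by (rule module_hom_closed[OF d_hom])

lemma Hom_diff_hom: "h \<in> module_hom R (F n) N \<Longrightarrow> Hom_diff F d n h \<in> module_hom R (F (Suc n)) N"
  unfolding Hom_diff_def by (rule module_hom_compose[OF F_module d_hom])

lemma Hom_cocycles_iff:
  "h \<in> Hom_cocycles R F d N n \<longleftrightarrow>
    h \<in> module_hom R (F n) N \<and> (\<forall>u\<in>carrier (F (Suc n)). h (d n u) = \<zero>\<^bsub>N\<^esub>)"
proof -
  have "(\<lambda>x\<in>A. h (d n x)) = (\<lambda>x\<in>A. z) \<longleftrightarrow> (\<forall>u\<in>A. h (d n u) = z)" for A z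
    by (auto simp: restrict_def fun_eq_iff split: if_splits)
  then show ?thesis by (simp add: Hom_cocycles_def Hom_diff_def Hom_module_simps)
qed

lemma Hom_coboundaries_sub_cocycles:
  assumes "module R N" shows "Hom_coboundaries R F d N n \<subseteq> Hom_cocycles R F d N n"
proof (cases n)
  case 0
  interpret H: module R "Hom_module R (F 0) N" by (rule module_Hom_module[OF F_module assms])
  show ?thesis using H.M.zero_closed d_closed
    by (auto simp: 0 Hom_coboundaries_def Hom_cocycles_iff Hom_module_simps)
next
  case (Suc k)
  have "Hom_diff F d k h (d n u) = \<zero>\<^bsub>N\<^esub>" if "h \<in> module_hom R (F k) N" "u \<in> carrier (F (Suc n))" for h u
    using that d_closed d_d module_hom_zero[OF F_module assms] by (simp add: Hom_diff_def Suc)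
  then show ?thesis using Hom_diff_hom by (auto simp: Suc Hom_coboundaries_def Hom_cocycles_iff)
qed

lemma Hom_cocycles_submodule:
  assumes "module R N" shows "submodule (Hom_cocycles R F d N n) R (Hom_module R (F n) N)"
proof -
  interpret N: module R N by fact
  interpret H: module R "Hom_module R (F n) N" by (rule module_Hom_module[OF F_module assms])
  note cl = H.M.zero_closed H.M.a_closed H.smult_closed
  show ?thesis
    by (rule H.submodule_of_smult_closed)
       (use cl d_closed in \<open>auto simp: Hom_cocycles_iff Hom_module_simps\<close>)
qed

lemma Hom_coboundaries_submodule:
  assumes "module R N"
  shows "submodule (Hom_coboundaries R F d N n) R
    ((Hom_module R (F n) N)\<lparr>carrier := Hom_cocycles R F d N n\<rparr>)"
proof -
  interpret N: module R N by fact
  let ?H = "Hom_module R (F n) N"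
  interpret H: module R ?H by (rule module_Hom_module[OF F_module assms])
  interpret Z: module R "?H\<lparr>carrier := Hom_cocycles R F d N n\<rparr>"
    by (rule submodule.submodule_is_module[OF Hom_cocycles_submodule[OF assms]
        module_Hom_module[OF F_module assms]])
  let ?B = "Hom_coboundaries R F d N n"
  have "\<zero>\<^bsub>?H\<^esub> \<in> ?B \<and> (\<forall>f\<in>?B. \<forall>g\<in>?B. f \<oplus>\<^bsub>?H\<^esub> g \<in> ?B) \<and> (\<forall>r\<in>carrier R. \<forall>f\<in>?B. r \<odot>\<^bsub>?H\<^esub> f \<in> ?B)"
  proof (cases n)
    case 0
    then show ?thesis
      using H.M.l_zero[OF H.M.zero_closed] H.smult_r_null by (simp add: Hom_coboundaries_def)
  next
    case (Suc k)
    let ?G = "Hom_module R (F k) N"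
    interpret G: module R ?G by (rule module_Hom_module[OF F_module assms])
    have D: "Hom_diff F d k \<zero>\<^bsub>?G\<^esub> = \<zero>\<^bsub>?H\<^esub>"
      "Hom_diff F d k (f \<oplus>\<^bsub>?G\<^esub> g) = Hom_diff F d k f \<oplus>\<^bsub>?H\<^esub> Hom_diff F d k g"
      "Hom_diff F d k (r \<odot>\<^bsub>?G\<^esub> f) = r \<odot>\<^bsub>?H\<^esub> Hom_diff F d k f" for f g r
      unfolding Hom_module_simps Hom_diff_def Suc
      by (rule restrict_ext, simp add: d_closed)+
    have B: "?B = Hom_diff F d k ` carrier ?G"
      by (simp add: Suc Hom_coboundaries_def Hom_module_simps(1))
    have "\<zero>\<^bsub>?H\<^esub> \<in> Hom_diff F d k ` carrier ?G"
        unfolding D(1)[symmetric] by (rule imageI) (rule G.M.zero_closed)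
    moreover have "Hom_diff F d k f \<oplus>\<^bsub>?H\<^esub> Hom_diff F d k g \<in> Hom_diff F d k ` carrier ?G"
        if "f \<in> carrier ?G" "g \<in> carrier ?G" for f g
        unfolding D(2)[symmetric] by (rule imageI) (rule G.M.a_closed[OF that])
    moreover have "r \<odot>\<^bsub>?H\<^esub> Hom_diff F d k f \<in> Hom_diff F d k ` carrier ?G"
        if "r \<in> carrier R" "f \<in> carrier ?G" for r f
        unfolding D(3)[symmetric] by (rule imageI) (rule G.smult_closed[OF that])
    ultimately show ?thesis unfolding B by blast
  qed
  then show ?thesis
    using Hom_coboundaries_sub_cocycles[OF assms] by (intro Z.submodule_of_smult_closed) auto
qed

lemma Supp_Hom_cohomology:
  assumes "module R N"
  shows "p \<in> Supp R (Hom_cohomology R F d N n) \<longleftrightarrow> primeideal p R \<and>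
    (\<exists>f\<in>Hom_cocycles R F d N n. \<forall>s\<in>carrier R - p.
      (\<lambda>v\<in>carrier (F n). s \<odot>\<^bsub>N\<^esub> f v) \<notin> Hom_coboundaries R F d N n)"
  unfolding Hom_cohomology_def
  by (subst Supp_quotient_module[OF submodule.submodule_is_module[OF Hom_cocycles_submodule[OF assms]
        module_Hom_module[OF F_module assms]] Hom_coboundaries_submodule[OF assms]])
     (simp add: Hom_module_simps)

text \<open>The class of f at p vanishes in the cohomology of Hom(F, N / L). The coboundary b may be
  taken with values in N because its primitive lifts from N / L, as F is free.\<close>

definition coboundary_up_to ::
  "('a, 'n, 'l) module_scheme \<Rightarrow> 'a set \<Rightarrow> 'n set \<Rightarrow> nat \<Rightarrow> (('x \<Rightarrow> 'a) \<Rightarrow> 'n) \<Rightarrow> bool" where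
  "coboundary_up_to N p L n f \<longleftrightarrow> (\<exists>s\<in>carrier R - p. \<exists>b\<in>Hom_coboundaries R F d N n.
    \<forall>v\<in>carrier (F n). s \<odot>\<^bsub>N\<^esub> f v \<ominus>\<^bsub>N\<^esub> b v \<in> L)"

text \<open>For a submodule \<open>L\<close> of \<open>N\<close> the following says that the localizations at \<open>p\<close> of all
  cohomology modules of \<open>Hom(F, N / L)\<close> vanish. As \<open>F\<close> is free, cochains with values in \<open>N / L\<close> lift
  to \<open>N\<close>, so the quotient need not be formed.\<close>

definition locally_acyclic_mod ::
  "('a, 'n, 'l) module_scheme \<Rightarrow> 'a set \<Rightarrow> 'n set \<Rightarrow> bool" where
  "locally_acyclic_mod N p L \<longleftrightarrow> (\<forall>n. \<forall>f\<in>module_hom R (F n) N.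
     (\<forall>u\<in>carrier (F (Suc n)). f (d n u) \<in> L) \<longrightarrow> coboundary_up_to N p L n f)"

lemma locally_acyclic_mod_zero:
  assumes "module R N" "primeideal p R" "\<And>n. p \<notin> Supp R (Hom_cohomology R F d N n)"
  shows "locally_acyclic_mod N p {\<zero>\<^bsub>N\<^esub>}"
  unfolding locally_acyclic_mod_def
proof (intro allI ballI impI)
  interpret N: module R N by fact
  fix n f assume f: "f \<in> module_hom R (F n) N" "\<forall>u\<in>carrier (F (Suc n)). f (d n u) \<in> {\<zero>\<^bsub>N\<^esub>}"
  then have "f \<in> Hom_cocycles R F d N n" by (simp add: Hom_cocycles_iff)
  then obtain s where s: "s \<in> carrier R - p"
    "(\<lambda>v\<in>carrier (F n). s \<odot>\<^bsub>N\<^esub> f v) \<in> Hom_coboundaries R F d N n"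
    using assms(2,3) Supp_Hom_cohomology[OF assms(1)] by blast
  moreover have "s \<odot>\<^bsub>N\<^esub> f v \<ominus>\<^bsub>N\<^esub> (\<lambda>v\<in>carrier (F n). s \<odot>\<^bsub>N\<^esub> f v) v \<in> {\<zero>\<^bsub>N\<^esub>}"
    if "v \<in> carrier (F n)" for v
    using that s(1) module_hom_closed[OF f(1)] by (simp add: N.minus_eq N.M.r_neg)
  ultimately show "coboundary_up_to N p {\<zero>\<^bsub>N\<^esub>} n f"
    unfolding coboundary_up_to_def by blast
qed

text \<open>If f is a cocycle modulo (L : s), then s f is one modulo L. The factor s is absorbed
  into the denominator, and L is contained in (L : s).\<close>

lemma locally_acyclic_mod_saturate:
  assumes "module R N" "primeideal p R" "submodule L R N" "locally_acyclic_mod N p L"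
    and s: "s \<in> carrier R - p"
  shows "locally_acyclic_mod N p {y \<in> carrier N. s \<odot>\<^bsub>N\<^esub> y \<in> L}"
  unfolding locally_acyclic_mod_def
proof (intro allI ballI impI)
  interpret N: module R N by fact
  interpret p: primeideal p R by fact
  note L = N.submoduleE[OF assms(3)]
  fix n f assume f: "f \<in> module_hom R (F n) N"
    and fd: "\<forall>u\<in>carrier (F (Suc n)). f (d n u) \<in> {y \<in> carrier N. s \<odot>\<^bsub>N\<^esub> y \<in> L}"
  let ?g = "\<lambda>v\<in>carrier (F n). s \<odot>\<^bsub>N\<^esub> f v"
  interpret H: module R "Hom_module R (F n) N" by (rule module_Hom_module[OF F_module assms(1)])
  have "?g \<in> module_hom R (F n) N"
    using H.smult_closed[of s f] s f by (simp add: Hom_module_simps)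
  moreover have "\<forall>u\<in>carrier (F (Suc n)). ?g (d n u) \<in> L" using fd d_closed by simp
  ultimately have "coboundary_up_to N p L n ?g" using assms(4) unfolding locally_acyclic_mod_def by blast
  then obtain t b where t: "t \<in> carrier R - p" and b: "b \<in> Hom_coboundaries R F d N n"
    and eq: "\<And>v. v \<in> carrier (F n) \<Longrightarrow> t \<odot>\<^bsub>N\<^esub> ?g v \<ominus>\<^bsub>N\<^esub> b v \<in> L"
    unfolding coboundary_up_to_def by blast
  have "b \<in> module_hom R (F n) N" using b Hom_coboundaries_sub_cocycles[OF assms(1)] Hom_cocycles_iff by blast
  have "(t \<otimes> s) \<odot>\<^bsub>N\<^esub> f v \<ominus>\<^bsub>N\<^esub> b v \<in> {y \<in> carrier N. s \<odot>\<^bsub>N\<^esub> y \<in> L}"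
    if v: "v \<in> carrier (F n)" for v
  proof -
    have "(t \<otimes> s) \<odot>\<^bsub>N\<^esub> f v \<ominus>\<^bsub>N\<^esub> b v \<in> L"
      using eq[OF v] v s t module_hom_closed[OF f v] by (simp add: N.smult_assoc1)
    then show ?thesis using L(1,4) s by blast
  qed
  moreover have "t \<otimes> s \<in> carrier R - p" using p.complement_submonoid(2) s t by blast
  ultimately show "coboundary_up_to N p {y \<in> carrier N. s \<odot>\<^bsub>N\<^esub> y \<in> L} n f"
    unfolding coboundary_up_to_def using b by blast
qed

text \<open>The relevant part of the long exact sequence for multiplication by x on N / L, carried
  out on cochains. It uses acyclicity modulo L in degree n + 1 for the connecting cocycle g, and
  again in degree n for the corrected cochain.\<close>

lemma locally_acyclic_mod_regular:
  assumes "module R N" "primeideal p R" "submodule L R N" "locally_acyclic_mod N p L"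
    and x: "x \<in> carrier R" and reg: "\<And>y. y \<in> carrier N \<Longrightarrow> x \<odot>\<^bsub>N\<^esub> y \<in> L \<Longrightarrow> y \<in> L"
  shows "locally_acyclic_mod N p {y \<in> carrier N. \<exists>z\<in>carrier N. y \<ominus>\<^bsub>N\<^esub> x \<odot>\<^bsub>N\<^esub> z \<in> L}"
  unfolding locally_acyclic_mod_def
proof (intro allI ballI impI)
  let ?L' = "{y \<in> carrier N. \<exists>z\<in>carrier N. y \<ominus>\<^bsub>N\<^esub> x \<odot>\<^bsub>N\<^esub> z \<in> L}"
  interpret N: module R N by fact
  interpret p: primeideal p R by fact
  note L = N.submoduleE[OF assms(3)]
  have comm: "a \<odot>\<^bsub>N\<^esub> (b \<odot>\<^bsub>N\<^esub> z) = b \<odot>\<^bsub>N\<^esub> (a \<odot>\<^bsub>N\<^esub> z)"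
    if "a \<in> carrier R" "b \<in> carrier R" "z \<in> carrier N" for a b z
    using that by (metis N.smult_assoc1 m_comm)
  fix n f assume f: "f \<in> module_hom R (F n) N" and fd: "\<forall>u\<in>carrier (F (Suc n)). f (d n u) \<in> ?L'"
  note fc = module_hom_closed[OF f]
  let ?F1 = "F (Suc n)"
  interpret Fn: module R "F n" by (rule F_module)
  interpret F1: module R ?F1 by (rule F_module)
  have F1: "free_module R (X (Suc n)) = ?F1" by (simp add: free)
  \<comment> \<open>The connecting map: f d takes values in L + x N, and freeness lets the
    coefficient of x be chosen linearly.\<close>
  have "\<exists>g\<in>module_hom R ?F1 N. \<forall>u\<in>carrier ?F1. f (d n u) \<ominus>\<^bsub>N\<^esub> x \<odot>\<^bsub>N\<^esub> g u \<in> L"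
  proof (rule free_module_hom_choice[OF assms(1),
        of "\<lambda>u y. f (d n u) \<ominus>\<^bsub>N\<^esub> x \<odot>\<^bsub>N\<^esub> y \<in> L" "X (Suc n)", unfolded F1])
    show "f (d n \<zero>\<^bsub>?F1\<^esub>) \<ominus>\<^bsub>N\<^esub> x \<odot>\<^bsub>N\<^esub> \<zero>\<^bsub>N\<^esub> \<in> L"
      using N.submodule_zero[OF assms(3)] x
      by (simp add: module_hom_zero[OF F_module F_module d_hom] module_hom_zero[OF F_module assms(1) f]
          N.submodule_minus_closed[OF assms(3)])
  next
    fix u v y z assume *: "u \<in> carrier ?F1" "v \<in> carrier ?F1" "y \<in> carrier N" "z \<in> carrier N"
      and "f (d n u) \<ominus>\<^bsub>N\<^esub> x \<odot>\<^bsub>N\<^esub> y \<in> L" "f (d n v) \<ominus>\<^bsub>N\<^esub> x \<odot>\<^bsub>N\<^esub> z \<in> L"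
    then have "(f (d n u) \<ominus>\<^bsub>N\<^esub> x \<odot>\<^bsub>N\<^esub> y) \<oplus>\<^bsub>N\<^esub> (f (d n v) \<ominus>\<^bsub>N\<^esub> x \<odot>\<^bsub>N\<^esub> z) \<in> L" using L(5) by blast
    then show "f (d n (u \<oplus>\<^bsub>?F1\<^esub> v)) \<ominus>\<^bsub>N\<^esub> x \<odot>\<^bsub>N\<^esub> (y \<oplus>\<^bsub>N\<^esub> z) \<in> L"
      using * x fc d_closed
      by (simp add: module_hom_add[OF d_hom] module_hom_add[OF f] N.smult_r_distr N.M.add_minus_add)
  next
    fix r u y assume *: "r \<in> carrier R" "u \<in> carrier ?F1" "y \<in> carrier N"
      and "f (d n u) \<ominus>\<^bsub>N\<^esub> x \<odot>\<^bsub>N\<^esub> y \<in> L"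
    then have "r \<odot>\<^bsub>N\<^esub> (f (d n u) \<ominus>\<^bsub>N\<^esub> x \<odot>\<^bsub>N\<^esub> y) \<in> L" using L(4) by blast
    then show "f (d n (r \<odot>\<^bsub>?F1\<^esub> u)) \<ominus>\<^bsub>N\<^esub> x \<odot>\<^bsub>N\<^esub> (r \<odot>\<^bsub>N\<^esub> y) \<in> L"
      using * x fc d_closed
      by (simp add: module_hom_smult[OF d_hom] module_hom_smult[OF f] N.smult_minus_distr comm[of x r])
  next
    fix b assume "b \<in> X (Suc n)"
    then have "free_basis R b \<in> carrier ?F1" unfolding free by (rule free_basis_closed[OF is_cring])
    then show "\<exists>y\<in>carrier N. f (d n (free_basis R b)) \<ominus>\<^bsub>N\<^esub> x \<odot>\<^bsub>N\<^esub> y \<in> L" using fd by blast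
  qed
  then obtain g where g: "g \<in> module_hom R ?F1 N"
    and fg: "\<And>u. u \<in> carrier ?F1 \<Longrightarrow> f (d n u) \<ominus>\<^bsub>N\<^esub> x \<odot>\<^bsub>N\<^esub> g u \<in> L" by blast
  note gc = module_hom_closed[OF g]
  \<comment> \<open>Modulo L, x g d agrees with f d d = 0, and x is regular on N / L.\<close>
  have "g (d (Suc n) w) \<in> L" if w: "w \<in> carrier (F (Suc (Suc n)))" for w
  proof (rule reg)
    have dw: "d (Suc n) w \<in> carrier ?F1" using d_closed w by blast
    then show "g (d (Suc n) w) \<in> carrier N" by (rule gc)
    have *: "\<zero>\<^bsub>N\<^esub> \<ominus>\<^bsub>N\<^esub> x \<odot>\<^bsub>N\<^esub> g (d (Suc n) w) \<in> L"
      using fg[OF dw] d_d[OF w] module_hom_zero[OF F_module assms(1) f] by simp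
    then show "x \<odot>\<^bsub>N\<^esub> g (d (Suc n) w) \<in> L"
      using N.submodule_cong[OF assms(3) _ _ *] N.submodule_zero[OF assms(3)] x gc[OF dw] by simp
  qed
  then have "coboundary_up_to N p L (Suc n) g" using assms(4) g unfolding locally_acyclic_mod_def by blast
  then obtain s h where s: "s \<in> carrier R - p" and h: "h \<in> module_hom R (F n) N"
    and gh: "\<And>u. u \<in> carrier ?F1 \<Longrightarrow> s \<odot>\<^bsub>N\<^esub> g u \<ominus>\<^bsub>N\<^esub> h (d n u) \<in> L"
    unfolding coboundary_up_to_def Hom_coboundaries_def Hom_diff_def by auto
  note hc = module_hom_closed[OF h]
  \<comment> \<open>Up to s, g is the coboundary h d modulo L. Subtracting x h turns s f into a
    cocycle modulo L, because s f d - x h d = s (f d - x g) + x (s g - h d).\<close>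
  let ?k = "\<lambda>v\<in>carrier (F n). s \<odot>\<^bsub>N\<^esub> f v \<ominus>\<^bsub>N\<^esub> x \<odot>\<^bsub>N\<^esub> h v"
  have k: "?k \<in> module_hom R (F n) N"
    by (rule module_hom_minus_smult[OF F_module assms(1) f h]) (use s x in auto)
  have "?k (d n u) \<in> L" if u: "u \<in> carrier ?F1" for u
  proof -
    have "s \<odot>\<^bsub>N\<^esub> (f (d n u) \<ominus>\<^bsub>N\<^esub> x \<odot>\<^bsub>N\<^esub> g u) \<oplus>\<^bsub>N\<^esub> x \<odot>\<^bsub>N\<^esub> (s \<odot>\<^bsub>N\<^esub> g u \<ominus>\<^bsub>N\<^esub> h (d n u)) \<in> L"
      using fg[OF u] gh[OF u] s x L(4,5) by blast
    moreover have "s \<odot>\<^bsub>N\<^esub> (f (d n u) \<ominus>\<^bsub>N\<^esub> x \<odot>\<^bsub>N\<^esub> g u) \<oplus>\<^bsub>N\<^esub> x \<odot>\<^bsub>N\<^esub> (s \<odot>\<^bsub>N\<^esub> g u \<ominus>\<^bsub>N\<^esub> h (d n u)) =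
        s \<odot>\<^bsub>N\<^esub> f (d n u) \<ominus>\<^bsub>N\<^esub> x \<odot>\<^bsub>N\<^esub> h (d n u)"
      using s x fc[OF d_closed[OF u]] gc[OF u] hc[OF d_closed[OF u]]
      by (simp add: N.smult_r_distr N.smult_r_minus comm[of x s] N.minus_eq N.M.a_assoc N.M.r_neg1)
    ultimately show ?thesis using d_closed[OF u] by simp
  qed
  then have "coboundary_up_to N p L n ?k" using assms(4) k unfolding locally_acyclic_mod_def by blast
  then obtain t b where t: "t \<in> carrier R - p" and b: "b \<in> Hom_coboundaries R F d N n"
    and kb: "\<And>v. v \<in> carrier (F n) \<Longrightarrow> t \<odot>\<^bsub>N\<^esub> ?k v \<ominus>\<^bsub>N\<^esub> b v \<in> L"
    unfolding coboundary_up_to_def by blast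
  have "b \<in> module_hom R (F n) N" using b Hom_coboundaries_sub_cocycles[OF assms(1)] Hom_cocycles_iff by blast
  note bc = module_hom_closed[OF this]
  \<comment> \<open>The correction x t h takes values in x N and so disappears modulo L + x
    N.\<close>
  have "(t \<otimes> s) \<odot>\<^bsub>N\<^esub> f v \<ominus>\<^bsub>N\<^esub> b v \<in> ?L'" if v: "v \<in> carrier (F n)" for v
  proof -
    have "t \<odot>\<^bsub>N\<^esub> ?k v \<ominus>\<^bsub>N\<^esub> b v = ((t \<otimes> s) \<odot>\<^bsub>N\<^esub> f v \<ominus>\<^bsub>N\<^esub> b v) \<ominus>\<^bsub>N\<^esub> x \<odot>\<^bsub>N\<^esub> (t \<odot>\<^bsub>N\<^esub> h v)"
      using v s t x fc[OF v] hc[OF v] bc[OF v]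
      by (simp add: N.smult_r_distr N.smult_r_minus N.smult_assoc1 N.M.minus_add comm[of x t] N.minus_eq N.M.a_ac)
    then have "((t \<otimes> s) \<odot>\<^bsub>N\<^esub> f v \<ominus>\<^bsub>N\<^esub> b v) \<ominus>\<^bsub>N\<^esub> x \<odot>\<^bsub>N\<^esub> (t \<odot>\<^bsub>N\<^esub> h v) \<in> L" using kb[OF v] by simp
    moreover have "t \<odot>\<^bsub>N\<^esub> h v \<in> carrier N" using t hc[OF v] by simp
    moreover have "(t \<otimes> s) \<odot>\<^bsub>N\<^esub> f v \<ominus>\<^bsub>N\<^esub> b v \<in> carrier N" using s t fc[OF v] bc[OF v] by simp
    ultimately show ?thesis by blast
  qed
  moreover have "t \<otimes> s \<in> carrier R - p" using p.complement_submonoid(2) s t by blast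
  ultimately show "coboundary_up_to N p ?L' n f" unfolding coboundary_up_to_def using b by blast
qed

end

section \<open>Support of Ext\<close>

lemma free_complex_free_res:
  assumes "module R M"
  shows "free_complex R (free_res R M) (syz_basis R M) (free_res_diff R M)"
proof -
  interpret module R M by fact
  show ?thesis
  proof
    show "free_res R M n = free_module R (syz_basis R M n)" for n by (rule free_res_def)
    show "free_res_diff R M n \<in> module_hom R (free_res R M (Suc n)) (free_res R M n)" for n
      by (rule free_res_exact(2)[OF assms])
    show "free_res_diff R M n (free_res_diff R M (Suc n) u) = \<zero>\<^bsub>free_res R M n\<^esub>"
      if "u \<in> carrier (free_res R M (Suc (Suc n)))" for u n
      using free_res_exact(6)[OF assms, of n] that by blast
  qed
qed

text \<open>The map \<open>h\<close> is the component in degree \<open>n\<close> of a null-homotopy of multiplication by \<open>s\<close>. The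
  homotopy equation \<open>d h + h d = s\<close> is composed with \<open>d\<close>, which eliminates the component in degree
  \<open>n - 1\<close>.\<close>

lemma free_res_homotopy:
  assumes "module R M" and s: "s \<in> carrier R" "\<And>x. x \<in> carrier M \<Longrightarrow> s \<odot>\<^bsub>M\<^esub> x = \<zero>\<^bsub>M\<^esub>"
  shows "\<exists>h\<in>module_hom R (free_res R M n) (free_res R M (Suc n)).
    \<forall>u\<in>carrier (free_res R M (Suc n)). free_res_diff R M n (h (free_res_diff R M n u)) =
      s \<odot>\<^bsub>free_res R M n\<^esub> free_res_diff R M n u"
proof (induction n)
  let ?F = "free_res R M" and ?d = "free_res_diff R M" and ?e = "free_res_aug R M"
  interpret free_complex R ?F "syz_basis R M" ?d by (rule free_complex_free_res[OF assms(1)])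
  have basis: "free_basis R b \<in> carrier (?F n)" if "b \<in> syz_basis R M n" for b n
    unfolding free_res_def by (rule free_basis_closed[OF is_cring that])
  have comm: "s \<odot>\<^bsub>?F n\<^esub> (r \<odot>\<^bsub>?F n\<^esub> x) = r \<odot>\<^bsub>?F n\<^esub> (s \<odot>\<^bsub>?F n\<^esub> x)"
    if "r \<in> carrier R" "x \<in> carrier (?F n)" for r x n
    using that s(1) module.smult_assoc1[OF F_module] m_comm by metis
  {
    case 0
    interpret F0: module R "?F 0" by (rule F_module)
    interpret F1: module R "?F (Suc 0)" by (rule F_module)
    \<comment> \<open>Since s kills M, the augmentation kills every s v, and exactness lifts it
      along the differential; on basis vectors this determines h.\<close>
    have "\<exists>h\<in>module_hom R (?F 0) (?F (Suc 0)). \<forall>v\<in>carrier (?F 0). ?d 0 (h v) = s \<odot>\<^bsub>?F 0\<^esub> v"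
    proof (rule free_module_hom_choice[OF F_module, of "\<lambda>v y. ?d 0 y = s \<odot>\<^bsub>?F 0\<^esub> v" "syz_basis R M 0",
          folded free_res_def])
      fix b assume "b \<in> syz_basis R M 0"
      note b = basis[OF this]
      have "?e (s \<odot>\<^bsub>?F 0\<^esub> free_basis R b) = \<zero>\<^bsub>M\<^esub>"
        using module_hom_smult[OF free_res_exact(3)[OF assms(1)] s(1) b]
          s(2) module_hom_closed[OF free_res_exact(3)[OF assms(1)] b] by simp
      moreover have "s \<odot>\<^bsub>?F 0\<^esub> free_basis R b \<in> carrier (?F 0)" using s(1) b by simp
      ultimately have "s \<odot>\<^bsub>?F 0\<^esub> free_basis R b \<in> ?d 0 ` carrier (?F (Suc 0))"
        using free_res_exact(5)[OF assms(1)] by simp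
      then show "\<exists>y\<in>carrier (?F (Suc 0)). ?d 0 y = s \<odot>\<^bsub>?F 0\<^esub> free_basis R b" by force
    qed (use s(1) comm in \<open>auto simp: module_hom_zero[OF F_module F_module d_hom] module_hom_add[OF d_hom]
        module_hom_smult[OF d_hom] F0.smult_r_distr\<close>)
    then show ?case using d_closed by blast
  next
    case (Suc n)
    interpret F0: module R "?F n" by (rule F_module)
    interpret F1: module R "?F (Suc n)" by (rule F_module)
    interpret F2: module R "?F (Suc (Suc n))" by (rule F_module)
    obtain h where h: "h \<in> module_hom R (?F n) (?F (Suc n))"
      and dh: "\<And>u. u \<in> carrier (?F (Suc n)) \<Longrightarrow> ?d n (h (?d n u)) = s \<odot>\<^bsub>?F n\<^esub> ?d n u"
      using Suc.IH by blast
    note hc = module_hom_closed[OF h]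
    \<comment> \<open>The right-hand side is a cycle: d (s v - h d v) = s d v - d h d v, which is
      zero by the induction hypothesis. Exactness provides a preimage on each basis vector.\<close>
    have "\<exists>k\<in>module_hom R (?F (Suc n)) (?F (Suc (Suc n))). \<forall>v\<in>carrier (?F (Suc n)).
      ?d (Suc n) (k v) = s \<odot>\<^bsub>?F (Suc n)\<^esub> v \<ominus>\<^bsub>?F (Suc n)\<^esub> h (?d n v)"
    proof (rule free_module_hom_choice[OF F_module, of
          "\<lambda>v y. ?d (Suc n) y = s \<odot>\<^bsub>?F (Suc n)\<^esub> v \<ominus>\<^bsub>?F (Suc n)\<^esub> h (?d n v)" "syz_basis R M (Suc n)",
          folded free_res_def])
      fix b assume "b \<in> syz_basis R M (Suc n)"
      note b = basis[OF this]
      let ?x = "s \<odot>\<^bsub>?F (Suc n)\<^esub> free_basis R b \<ominus>\<^bsub>?F (Suc n)\<^esub> h (?d n (free_basis R b))"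
      have "?d n ?x = \<zero>\<^bsub>?F n\<^esub>"
        using b s(1) hc[OF d_closed[OF b]] d_closed[OF b]
        by (simp add: module_hom_minus[OF F_module F_module d_hom] module_hom_smult[OF d_hom] dh[OF b]
            F0.minus_eq F0.M.r_neg)
      moreover have "?x \<in> carrier (?F (Suc n))" using s(1) b hc[OF d_closed[OF b]] by simp
      ultimately have "?x \<in> ?d (Suc n) ` carrier (?F (Suc (Suc n)))"
        using free_res_exact(6)[OF assms(1)] by simp
      then show "\<exists>y\<in>carrier (?F (Suc (Suc n))). ?d (Suc n) y = ?x" by force
    next
      fix u v y z assume *: "u \<in> carrier (?F (Suc n))" "v \<in> carrier (?F (Suc n))"
        "y \<in> carrier (?F (Suc (Suc n)))" "z \<in> carrier (?F (Suc (Suc n)))"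
        "?d (Suc n) y = s \<odot>\<^bsub>?F (Suc n)\<^esub> u \<ominus>\<^bsub>?F (Suc n)\<^esub> h (?d n u)"
        "?d (Suc n) z = s \<odot>\<^bsub>?F (Suc n)\<^esub> v \<ominus>\<^bsub>?F (Suc n)\<^esub> h (?d n v)"
      then show "?d (Suc n) (y \<oplus>\<^bsub>?F (Suc (Suc n))\<^esub> z) =
          s \<odot>\<^bsub>?F (Suc n)\<^esub> (u \<oplus>\<^bsub>?F (Suc n)\<^esub> v) \<ominus>\<^bsub>?F (Suc n)\<^esub> h (?d n (u \<oplus>\<^bsub>?F (Suc n)\<^esub> v))"
        using s(1) hc d_closed by (simp add: module_hom_add[OF d_hom] module_hom_add[OF h]
            F1.smult_r_distr F1.M.add_minus_add)
    next
      fix r u y assume "r \<in> carrier R" "u \<in> carrier (?F (Suc n))" "y \<in> carrier (?F (Suc (Suc n)))"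
        "?d (Suc n) y = s \<odot>\<^bsub>?F (Suc n)\<^esub> u \<ominus>\<^bsub>?F (Suc n)\<^esub> h (?d n u)"
      then show "?d (Suc n) (r \<odot>\<^bsub>?F (Suc (Suc n))\<^esub> y) =
          s \<odot>\<^bsub>?F (Suc n)\<^esub> (r \<odot>\<^bsub>?F (Suc n)\<^esub> u) \<ominus>\<^bsub>?F (Suc n)\<^esub> h (?d n (r \<odot>\<^bsub>?F (Suc n)\<^esub> u))"
        using s(1) hc d_closed by (simp add: module_hom_smult[OF d_hom] module_hom_smult[OF h]
            F1.smult_minus_distr comm)
    qed (use s(1) in \<open>simp add: module_hom_zero[OF F_module F_module d_hom]
        module_hom_zero[OF F_module F_module h] F1.minus_eq F1.M.r_neg\<close>)
    then obtain k where k: "k \<in> module_hom R (?F (Suc n)) (?F (Suc (Suc n)))"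
      "\<And>v. v \<in> carrier (?F (Suc n)) \<Longrightarrow>
        ?d (Suc n) (k v) = s \<odot>\<^bsub>?F (Suc n)\<^esub> v \<ominus>\<^bsub>?F (Suc n)\<^esub> h (?d n v)" by blast
    have "?d (Suc n) (k (?d (Suc n) u)) = s \<odot>\<^bsub>?F (Suc n)\<^esub> ?d (Suc n) u"
      if "u \<in> carrier (?F (Suc (Suc n)))" for u
      using k(2)[OF d_closed[OF that]] d_d[OF that] d_closed[OF that] s(1)
      by (simp add: module_hom_zero[OF F_module F_module h] F1.minus_eq)
    then show ?case using k(1) by blast
  }
qed

text \<open>In positive degree, s v - h d v is a cycle, hence a boundary by exactness, and the
  cocycle f vanishes on boundaries. So s f = (f h) d, with f h as primitive. In degree 0, s v is
  itself a boundary and s f = 0.\<close>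

lemma smult_cocycle_coboundary:
  assumes M: "module R M" and N: "module R N"
    and s: "s \<in> carrier R" "\<And>x. x \<in> carrier M \<Longrightarrow> s \<odot>\<^bsub>M\<^esub> x = \<zero>\<^bsub>M\<^esub>"
    and f: "f \<in> Hom_cocycles R (free_res R M) (free_res_diff R M) N n"
  shows "(\<lambda>v\<in>carrier (free_res R M n). s \<odot>\<^bsub>N\<^esub> f v) \<in>
    Hom_coboundaries R (free_res R M) (free_res_diff R M) N n"
proof -
  let ?F = "free_res R M" and ?d = "free_res_diff R M" and ?e = "free_res_aug R M"
  interpret free_complex R ?F "syz_basis R M" ?d by (rule free_complex_free_res[OF M])
  interpret N: module R N by fact
  have fh: "f \<in> module_hom R (?F n) N" and fd: "\<And>u. u \<in> carrier (?F (Suc n)) \<Longrightarrow> f (?d n u) = \<zero>\<^bsub>N\<^esub>"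
    using f Hom_cocycles_iff by blast+
  interpret Fn: module R "?F n" by (rule F_module)
  show ?thesis
  proof (cases n)
    case 0
    have "s \<odot>\<^bsub>N\<^esub> f v = \<zero>\<^bsub>N\<^esub>" if v: "v \<in> carrier (?F 0)" for v
    proof -
      have "?e (s \<odot>\<^bsub>?F 0\<^esub> v) = \<zero>\<^bsub>M\<^esub>"
        using module_hom_smult[OF free_res_exact(3)[OF M] s(1) v]
          s(2) module_hom_closed[OF free_res_exact(3)[OF M] v] by simp
      then have "s \<odot>\<^bsub>?F 0\<^esub> v \<in> ?d 0 ` carrier (?F (Suc 0))"
        using free_res_exact(5)[OF M] v s(1) Fn.smult_closed unfolding 0 by simp
      then have "f (s \<odot>\<^bsub>?F 0\<^esub> v) = \<zero>\<^bsub>N\<^esub>" using fd unfolding 0 by auto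
      then show ?thesis using module_hom_smult[OF fh s(1)] v unfolding 0 by simp
    qed
    then have "(\<lambda>v\<in>carrier (?F 0). s \<odot>\<^bsub>N\<^esub> f v) = (\<lambda>v\<in>carrier (?F 0). \<zero>\<^bsub>N\<^esub>)"
      by (rule restrict_ext)
    then show ?thesis by (simp add: 0 Hom_coboundaries_def Hom_module_simps)
  next
    case (Suc k)
    obtain h where h: "h \<in> module_hom R (?F k) (?F (Suc k))"
      and dh: "\<And>u. u \<in> carrier (?F (Suc k)) \<Longrightarrow> ?d k (h (?d k u)) = s \<odot>\<^bsub>?F k\<^esub> ?d k u"
      using free_res_homotopy[OF M s] by blast
    interpret Fk: module R "?F k" by (rule F_module)
    interpret Fsk: module R "?F (Suc k)" by (rule F_module)
    have "s \<odot>\<^bsub>N\<^esub> f v = f (h (?d k v))" if v: "v \<in> carrier (?F n)" for v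
    proof -
      let ?x = "s \<odot>\<^bsub>?F n\<^esub> v \<ominus>\<^bsub>?F n\<^esub> h (?d k v)"
      note c = v[unfolded Suc] d_closed[OF v[unfolded Suc]]
      note hc = module_hom_closed[OF h c(2)]
      have "?d k ?x = \<zero>\<^bsub>?F k\<^esub>"
        unfolding Suc using Fn.smult_closed[OF s(1) v] c hc s(1)
        by (simp add: Suc module_hom_minus[OF F_module F_module d_hom] module_hom_smult[OF d_hom] dh
            Fk.minus_eq Fk.M.r_neg)
      moreover have "?x \<in> carrier (?F n)" using v s(1) hc by (simp add: Suc)
      ultimately have "?x \<in> ?d (Suc k) ` carrier (?F (Suc (Suc k)))"
        using free_res_exact(6)[OF M, of k] by (simp add: Suc)
      then have "f ?x = \<zero>\<^bsub>N\<^esub>" using fd unfolding Suc by auto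
      moreover have "f ?x = s \<odot>\<^bsub>N\<^esub> f v \<ominus>\<^bsub>N\<^esub> f (h (?d k v))"
        using module_hom_minus[OF F_module N fh] module_hom_smult[OF fh s(1) v] v s(1) hc
        by (simp add: Suc)
      ultimately show ?thesis
        using module_hom_closed[OF fh v] module_hom_closed[OF fh, of "h (?d k v)"] hc s(1)
          N.M.eq_if_minus_eq_zero[of "s \<odot>\<^bsub>N\<^esub> f v" "f (h (?d k v))"] by (simp add: Suc)
    qed
    then have "(\<lambda>v\<in>carrier (?F n). s \<odot>\<^bsub>N\<^esub> f v) = Hom_diff ?F ?d k (\<lambda>x\<in>carrier (?F k). f (h x))"
      unfolding Hom_diff_def Suc by (intro restrict_ext) (simp add: d_closed)
    moreover have "(\<lambda>x\<in>carrier (?F k). f (h x)) \<in> module_hom R (?F k) N"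
      using module_hom_compose[OF F_module h fh[unfolded Suc]] .
    ultimately show ?thesis by (simp add: Suc Hom_coboundaries_def)
  qed
qed

text \<open>Finite generation turns p outside a support into one s outside p that kills the module.
  If it kills M, then s f is a coboundary by the homotopy; if it kills N, then s f = 0
  outright.\<close>

lemma Supp_Ext_subset:
  assumes "noetherian_ring R" and M: "module R M" "finitely_generated R M" and N: "module R N" "finitely_generated R N"
  shows "Supp R (Ext R n M N) \<subseteq> Supp R M \<inter> Supp R N"
proof
  fix p assume p: "p \<in> Supp R (Ext R n M N)"
  let ?F = "free_res R M" and ?d = "free_res_diff R M"
  interpret free_complex R ?F "syz_basis R M" ?d by (rule free_complex_free_res[OF M(1)])
  interpret M: noetherian_module R M by (rule module.noetherian_moduleI[OF M(1) assms(1) M(2)])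
  interpret N: noetherian_module R N by (rule module.noetherian_moduleI[OF N(1) assms(1) N(2)])
  obtain f where prime: "primeideal p R" and f: "f \<in> Hom_cocycles R ?F ?d N n"
    and nb: "\<And>s. s \<in> carrier R - p \<Longrightarrow>
      (\<lambda>v\<in>carrier (?F n). s \<odot>\<^bsub>N\<^esub> f v) \<notin> Hom_coboundaries R ?F ?d N n"
    using p unfolding Ext_def Supp_Hom_cohomology[OF N(1)] by blast
  have "p \<in> Supp R M"
  proof (rule ccontr)
    assume "p \<notin> Supp R M"
    then obtain s where s: "s \<in> carrier R - p" "\<And>x. x \<in> carrier M \<Longrightarrow> s \<odot>\<^bsub>M\<^esub> x = \<zero>\<^bsub>M\<^esub>"
      using M.uniform_annihilator[OF prime] by blast
    then show False using nb[OF s(1)] smult_cocycle_coboundary[OF M(1) N(1) _ s(2) f] by blast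
  qed
  moreover have "p \<in> Supp R N"
  proof (rule ccontr)
    assume "p \<notin> Supp R N"
    then obtain s where s: "s \<in> carrier R - p" "\<And>x. x \<in> carrier N \<Longrightarrow> s \<odot>\<^bsub>N\<^esub> x = \<zero>\<^bsub>N\<^esub>"
      using N.uniform_annihilator[OF prime] by blast
    have "f \<in> module_hom R (?F n) N" using f by (simp add: Hom_cocycles_iff)
    then have "(\<lambda>v\<in>carrier (?F n). s \<odot>\<^bsub>N\<^esub> f v) = \<zero>\<^bsub>Hom_module R (?F n) N\<^esub>"
      unfolding Hom_module_simps by (intro restrict_ext s(2)) (erule module_hom_closed)
    moreover have "\<zero>\<^bsub>Hom_module R (?F n) N\<^esub> \<in> Hom_coboundaries R ?F ?d N n"
      using module.submodule_zero[OF submodule.submodule_is_module[OF Hom_cocycles_submodule[OF N(1)]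
        module_Hom_module[OF F_module N(1)]] Hom_coboundaries_submodule[OF N(1)]] by simp
    ultimately show False using nb[OF s(1)] by simp
  qed
  ultimately show "p \<in> Supp R M \<inter> Supp R N" by blast
qed

text \<open>Take \<open>L \<subseteq> N\<close> maximal such that \<open>(N / L)\<^sub>p \<noteq> 0\<close> and all \<open>Ext\<^sup>i(M, N / L)\<^sub>p\<close> vanish. Then \<open>N / L\<close>
  has no \<open>p\<close>-torsion, and \<open>p\<close> contains no \<open>N / L\<close>-regular element \<open>x\<close>, as \<open>L + x N\<close> would be a
  larger such submodule. Hence \<open>R / p\<close> embeds into \<open>N / L\<close>, and composing with a nonzero map
  \<open>M \<rightarrow> R / p\<close> gives a contradiction to \<open>Hom(M, N / L)\<^sub>p = 0\<close>.\<close>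

lemma ex_Supp_Ext:
  fixes R (structure)
  assumes "noetherian_ring R" and M: "module R M" "finitely_generated R M"
    and N: "module R N" "finitely_generated R N"
    and pM: "p \<in> Supp R M" and pN: "p \<in> Supp R N"
  shows "\<exists>n. p \<in> Supp R (Ext R n M N)"
proof (rule ccontr)
  assume none: "\<nexists>n. p \<in> Supp R (Ext R n M N)"
  let ?F = "free_res R M" and ?d = "free_res_diff R M" and ?e = "free_res_aug R M"
  interpret free_complex R ?F "syz_basis R M" ?d by (rule free_complex_free_res[OF M(1)])
  interpret M: noetherian_module R M by (rule module.noetherian_moduleI[OF M(1) assms(1) M(2)])
  interpret N: noetherian_module R N by (rule module.noetherian_moduleI[OF N(1) assms(1) N(2)])
  have prime: "primeideal p R" using pM Supp_iff[OF M(1)] by blast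
  interpret p: primeideal p R by (rule prime)
  let ?S = "carrier R - p"
  let ?C = "{L. submodule L R N \<and> locally_acyclic_mod N p L \<and> (\<exists>y\<in>carrier N. \<forall>s\<in>?S. s \<odot>\<^bsub>N\<^esub> y \<notin> L)}"
  have "submodule {\<zero>\<^bsub>N\<^esub>} R N" by (rule N.submoduleI) auto
  moreover have "locally_acyclic_mod N p {\<zero>\<^bsub>N\<^esub>}"
    by (rule locally_acyclic_mod_zero[OF N(1) prime]) (use none in \<open>simp add: Ext_def\<close>)
  moreover have "\<exists>y\<in>carrier N. \<forall>s\<in>?S. s \<odot>\<^bsub>N\<^esub> y \<notin> {\<zero>\<^bsub>N\<^esub>}"
    using pN Supp_iff[OF N(1)] by simp
  ultimately have "{\<zero>\<^bsub>N\<^esub>} \<in> ?C" by blast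
  then have "?C \<noteq> {}" by (metis empty_iff)
  moreover have "?C \<subseteq> {L. submodule L R N}" by blast
  ultimately have "\<exists>L\<in>?C. \<forall>L'\<in>?C. L \<subseteq> L' \<longrightarrow> L' = L" by (intro N.maximal_submodule_in_family)
  then obtain L where L_in: "L \<in> ?C" and max: "\<forall>L'\<in>?C. L \<subseteq> L' \<longrightarrow> L' = L" by (rule bexE) (rule that)
  have L: "submodule L R N" and ac: "locally_acyclic_mod N p L" using L_in by simp_all
  obtain y0 where y0: "y0 \<in> carrier N" "\<And>s. s \<in> ?S \<Longrightarrow> s \<odot>\<^bsub>N\<^esub> y0 \<notin> L" using L_in by blast
  note LE = N.submoduleE[OF L]
  \<comment> \<open>Passing to (L : s) preserves acyclicity and nonvanishing at p, so maximality
    gives (L : s) = L.\<close>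
  have tf: "y \<in> L" if s: "s \<in> ?S" and y: "y \<in> carrier N" "s \<odot>\<^bsub>N\<^esub> y \<in> L" for s y
  proof -
    let ?L' = "{y \<in> carrier N. s \<odot>\<^bsub>N\<^esub> y \<in> L}"
    have "L \<subseteq> ?L'" using LE s by blast
    have "t \<odot>\<^bsub>N\<^esub> y0 \<notin> ?L'" if t: "t \<in> ?S" for t
    proof -
      have "(s \<otimes> t) \<odot>\<^bsub>N\<^esub> y0 \<notin> L" using y0(2) p.complement_submonoid(2)[OF s t] .
      then show ?thesis using s t y0(1) by (simp add: N.smult_assoc1)
    qed
    moreover have "submodule ?L' R N" by (rule N.submodule_preimage_smult[OF L]) (use s in simp)
    moreover have "locally_acyclic_mod N p ?L'"
      by (rule locally_acyclic_mod_saturate[OF N(1) prime L ac s])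
    ultimately have "?L' \<in> ?C" using y0(1) by blast
    from max[rule_format, OF this \<open>L \<subseteq> ?L'\<close>] show ?thesis using y by blast
  qed
  \<comment> \<open>For a regular x in p, L + x N is in the family: Nakayama keeps the quotient
    nonzero at p. Maximality then gives x \<open>y0\<close> in L, and regularity gives
    \<open>y0\<close> in L.\<close>
  have zd: "\<exists>y\<in>carrier N - L. x \<odot>\<^bsub>N\<^esub> y \<in> L" if x: "x \<in> p" for x
  proof (rule ccontr)
    assume "\<not> ?thesis"
    then have reg: "y \<in> L" if "y \<in> carrier N" "x \<odot>\<^bsub>N\<^esub> y \<in> L" for y using that by blast
    have xc: "x \<in> carrier R" using x p.a_subset by blast
    let ?L' = "{y \<in> carrier N. \<exists>z\<in>carrier N. y \<ominus>\<^bsub>N\<^esub> x \<odot>\<^bsub>N\<^esub> z \<in> L}"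
    have "locally_acyclic_mod N p ?L'"
      by (rule locally_acyclic_mod_regular[OF N(1) prime L ac xc]) (rule reg)
    moreover have "\<exists>y\<in>carrier N. \<forall>s\<in>?S. s \<odot>\<^bsub>N\<^esub> y \<notin> ?L'"
      by (rule N.nakayama_at_prime[OF prime L y0 x])
    moreover note N.submodule_add_image(1)[OF L xc]
    ultimately have "?L' \<in> ?C" by blast
    from max[rule_format, OF this N.submodule_add_image(2)[OF L xc]]
    have "x \<odot>\<^bsub>N\<^esub> y0 \<in> L" using N.submodule_add_image(3)[OF L xc y0(1)] by blast
    then have "y0 \<in> L" by (rule reg[OF y0(1)])
    then show False using y0(2)[OF p.complement_submonoid(1)] y0(1) by simp
  qed
  \<comment> \<open>Each x in p has its own annihilated element; here one y serves for all of p, so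
    that r -> r y induces R / p -> N / L.\<close>
  obtain y where y: "y \<in> carrier N" "y \<notin> L" and py: "\<And>x. x \<in> p \<Longrightarrow> x \<odot>\<^bsub>N\<^esub> y \<in> L"
    using N.ideal_of_zero_divisors_annihilates[OF assms(1) L p.is_ideal zd] by blast
  obtain \<rho> a where "\<forall>x\<in>carrier M. \<rho> x \<in> carrier R"
    and "\<forall>x\<in>carrier M. \<forall>y\<in>carrier M. \<rho> (x \<oplus>\<^bsub>M\<^esub> y) \<ominus> (\<rho> x \<oplus> \<rho> y) \<in> p"
    and "\<forall>r\<in>carrier R. \<forall>x\<in>carrier M. \<rho> (r \<odot>\<^bsub>M\<^esub> x) \<ominus> r \<otimes> \<rho> x \<in> p"
    and \<rho>0: "\<rho> \<zero>\<^bsub>M\<^esub> \<in> p" and a: "a \<in> carrier M" "\<rho> a \<notin> p"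
    by (rule M.Supp_functional[OF pM]) (rule that)
  note \<rho>c = this(1)[rule_format] and add = this(2)[rule_format] and sm = this(3)[rule_format]
  note e_hom = free_res_exact(3)[OF M(1)]
  have ec: "?e v \<in> carrier M" if "v \<in> carrier (?F 0)" for v using module_hom_closed[OF e_hom that] .
  \<comment> \<open>Representatives that differ by an element of p may be exchanged, because p y
    lies in L.\<close>
  have shift: "z \<ominus>\<^bsub>N\<^esub> r \<odot>\<^bsub>N\<^esub> y \<in> L"
    if "z \<in> carrier N" "r \<in> carrier R" "t \<in> carrier R" "r \<ominus> t \<in> p" "z \<ominus>\<^bsub>N\<^esub> t \<odot>\<^bsub>N\<^esub> y \<in> L" for z r t
  proof -
    have "(z \<ominus>\<^bsub>N\<^esub> t \<odot>\<^bsub>N\<^esub> y) \<ominus>\<^bsub>N\<^esub> (r \<ominus> t) \<odot>\<^bsub>N\<^esub> y = z \<ominus>\<^bsub>N\<^esub> r \<odot>\<^bsub>N\<^esub> y"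
      using that(1-3) y(1) by (simp add: N.smult_diff_distr N.M.minus_minus_cancel_right
        N.minus_eq N.M.minus_add N.M.a_ac N.M.add_swap_cancel N.M.r_neg1 N.M.r_neg2)
    then show ?thesis using N.submodule_minus_closed[OF L that(5) py[OF that(4)]] by simp
  qed
  interpret F0: module R "?F 0" by (rule F_module)
  \<comment> \<open>f lifts to N the composite of the augmentation with M -> R / p -> N / L.\<close>
  have "\<exists>f\<in>module_hom R (?F 0) N. \<forall>v\<in>carrier (?F 0). f v \<ominus>\<^bsub>N\<^esub> \<rho> (?e v) \<odot>\<^bsub>N\<^esub> y \<in> L"
  proof (rule free_module_hom_choice[OF N(1), of "\<lambda>v z. z \<ominus>\<^bsub>N\<^esub> \<rho> (?e v) \<odot>\<^bsub>N\<^esub> y \<in> L" "syz_basis R M 0",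
        folded free_res_def])
    have e0: "?e \<zero>\<^bsub>?F 0\<^esub> = \<zero>\<^bsub>M\<^esub>" by (rule module_hom_zero[OF F_module M(1) e_hom])
    show "\<zero>\<^bsub>N\<^esub> \<ominus>\<^bsub>N\<^esub> \<rho> (?e \<zero>\<^bsub>?F 0\<^esub>) \<odot>\<^bsub>N\<^esub> y \<in> L"
      unfolding e0 by (intro N.submodule_minus_closed[OF L] N.submodule_zero[OF L] py \<rho>0)
  next
    fix u v z w assume *: "u \<in> carrier (?F 0)" "v \<in> carrier (?F 0)" "z \<in> carrier N" "w \<in> carrier N"
      "z \<ominus>\<^bsub>N\<^esub> \<rho> (?e u) \<odot>\<^bsub>N\<^esub> y \<in> L" "w \<ominus>\<^bsub>N\<^esub> \<rho> (?e v) \<odot>\<^bsub>N\<^esub> y \<in> L"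
    show "(z \<oplus>\<^bsub>N\<^esub> w) \<ominus>\<^bsub>N\<^esub> \<rho> (?e (u \<oplus>\<^bsub>?F 0\<^esub> v)) \<odot>\<^bsub>N\<^esub> y \<in> L"
    proof (rule shift)
      show "\<rho> (?e (u \<oplus>\<^bsub>?F 0\<^esub> v)) \<ominus> (\<rho> (?e u) \<oplus> \<rho> (?e v)) \<in> p"
        unfolding module_hom_add[OF e_hom *(1,2)] by (rule add) (use * ec in auto)
      show "(z \<oplus>\<^bsub>N\<^esub> w) \<ominus>\<^bsub>N\<^esub> (\<rho> (?e u) \<oplus> \<rho> (?e v)) \<odot>\<^bsub>N\<^esub> y \<in> L"
        using LE(5)[OF *(5,6)] * \<rho>c ec y(1) by (simp add: N.smult_l_distr N.M.add_minus_add)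
    qed (use * \<rho>c ec in auto)
  next
    fix r u z assume *: "r \<in> carrier R" "u \<in> carrier (?F 0)" "z \<in> carrier N"
      "z \<ominus>\<^bsub>N\<^esub> \<rho> (?e u) \<odot>\<^bsub>N\<^esub> y \<in> L"
    show "r \<odot>\<^bsub>N\<^esub> z \<ominus>\<^bsub>N\<^esub> \<rho> (?e (r \<odot>\<^bsub>?F 0\<^esub> u)) \<odot>\<^bsub>N\<^esub> y \<in> L"
    proof (rule shift)
      show "\<rho> (?e (r \<odot>\<^bsub>?F 0\<^esub> u)) \<ominus> r \<otimes> \<rho> (?e u) \<in> p"
        unfolding module_hom_smult[OF e_hom *(1,2)] by (rule sm) (use * ec in auto)
      show "r \<odot>\<^bsub>N\<^esub> z \<ominus>\<^bsub>N\<^esub> (r \<otimes> \<rho> (?e u)) \<odot>\<^bsub>N\<^esub> y \<in> L"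
        using LE(4)[OF *(1,4)] * \<rho>c ec y(1) by (simp add: N.smult_assoc1 N.smult_minus_distr)
    qed (use * \<rho>c ec in auto)
  next
    fix b assume "b \<in> syz_basis R M 0"
    then have b: "free_basis R b \<in> carrier (?F 0)" unfolding free by (rule free_basis_closed[OF is_cring])
    let ?z = "\<rho> (?e (free_basis R b)) \<odot>\<^bsub>N\<^esub> y"
    have "?z \<in> carrier N" using b \<rho>c ec y(1) by simp
    moreover from this have "?z \<ominus>\<^bsub>N\<^esub> ?z \<in> L" using N.submodule_zero[OF L] by (simp add: N.minus_eq N.M.r_neg)
    ultimately show "\<exists>z\<in>carrier N. z \<ominus>\<^bsub>N\<^esub> ?z \<in> L" by blast
  qed
  then obtain f where f: "f \<in> module_hom R (?F 0) N"
    and fe: "\<And>v. v \<in> carrier (?F 0) \<Longrightarrow> f v \<ominus>\<^bsub>N\<^esub> \<rho> (?e v) \<odot>\<^bsub>N\<^esub> y \<in> L" by blast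
  note fc = module_hom_closed[OF f]
  have "f (?d 0 u) \<in> L" if u: "u \<in> carrier (?F (Suc 0))" for u
  proof -
    have "?e (?d 0 u) = \<zero>\<^bsub>M\<^esub>" using free_res_exact(5)[OF M(1)] u by blast
    then have "\<rho> (?e (?d 0 u)) \<odot>\<^bsub>N\<^esub> y \<in> L" using py \<rho>0 by simp
    then show ?thesis
      using N.submodule_cong[OF L _ _ fe[OF d_closed[OF u]]] fc[OF d_closed[OF u]] LE(1) by blast
  qed
  \<comment> \<open>In degree 0 the only coboundary is zero, so acyclicity says that some s outside
    p carries all values of f into L.\<close>
  then have "coboundary_up_to N p L 0 f" using ac f unfolding locally_acyclic_mod_def by blast
  then obtain s where s: "s \<in> ?S" and sf: "\<And>v. v \<in> carrier (?F 0) \<Longrightarrow> s \<odot>\<^bsub>N\<^esub> f v \<ominus>\<^bsub>N\<^esub> \<zero>\<^bsub>N\<^esub> \<in> L"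
    unfolding coboundary_up_to_def by (auto simp: Hom_coboundaries_def Hom_module_simps)
  have "a \<in> ?e ` carrier (?F 0)" unfolding free_res_exact(4)[OF M(1)] by (rule a(1))
  then obtain v where v: "v \<in> carrier (?F 0)" "?e v = a" by blast
  have "s \<odot>\<^bsub>N\<^esub> f v \<in> L"
    using N.submodule_cong[OF L _ _ sf[OF v(1)]] fc[OF v(1)] s N.submodule_zero[OF L] by simp
  then have "f v \<in> L" using tf[OF s] fc[OF v(1)] by blast
  \<comment> \<open>\<open>\<rho> a\<close> is outside p, so \<open>tf\<close> would put y into
    L.\<close>
  then have "\<rho> a \<odot>\<^bsub>N\<^esub> y \<in> L"
    using N.submodule_cong[OF L _ _ fe[OF v(1)]] fc[OF v(1)] v(2) \<rho>c[OF a(1)] y(1) by simp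
  then show False using tf[of "\<rho> a" y] y a \<rho>c by blast
qed

lemma UN_Supp_Ext:
  assumes "noetherian_ring R" "module R M" "finitely_generated R M" "module R N" "finitely_generated R N"
  shows "(\<Union>n. Supp R (Ext R n M N)) = Supp R M \<inter> Supp R N"
  using Supp_Ext_subset[OF assms] ex_Supp_Ext[OF assms] by blast

section \<open>The regular module and tensor products\<close>

lemma regular_module_simps:
  "carrier (regular_module R) = carrier R" "\<zero>\<^bsub>regular_module R\<^esub> = \<zero>\<^bsub>R\<^esub>"
  "x \<oplus>\<^bsub>regular_module R\<^esub> y = x \<oplus>\<^bsub>R\<^esub> y" "r \<odot>\<^bsub>regular_module R\<^esub> x = r \<otimes>\<^bsub>R\<^esub> x"
  "x \<ominus>\<^bsub>regular_module R\<^esub> y = x \<ominus>\<^bsub>R\<^esub> y"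
  by (simp_all add: regular_module_def a_minus_def a_inv_def m_inv_def)

lemma module_regular_module:
  assumes "cring R" shows "module R (regular_module R)"
proof -
  interpret cring R by fact
  have "abelian_group (regular_module R)"
    by (rule abelian_groupI)
       (auto simp: regular_module_simps a_ac intro: bexI[where x = "\<ominus>\<^bsub>R\<^esub> x" for x] l_neg)
  then show ?thesis
    by (rule moduleI[OF assms]) (auto simp: regular_module_simps l_distr r_distr m_assoc)
qed

lemma finitely_generated_regular_module:
  assumes "cring R" shows "finitely_generated R (regular_module R)"
proof -
  interpret cring R by fact
  interpret M: module R "regular_module R" by (rule module_regular_module[OF assms])
  have "x \<in> K" if "submodule K R (regular_module R)" "\<one>\<^bsub>R\<^esub> \<in> K" "x \<in> carrier R" for K x
    using M.submoduleE(4)[OF that(1) that(3,2)] that(3) by (simp add: regular_module_simps)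
  then have "module_span R (regular_module R) {\<one>\<^bsub>R\<^esub>} = carrier (regular_module R)"
    using M.carrier_is_submodule one_closed
    unfolding module_span_def by (auto simp: regular_module_simps)
  then show ?thesis unfolding finitely_generated_def
    by (intro exI[where x = "{\<one>\<^bsub>R\<^esub>}"]) (simp add: regular_module_simps)
qed

lemma Supp_regular_module:
  assumes "cring R" shows "Supp R (regular_module R) = {p. primeideal p R}"
proof -
  interpret cring R by fact
  have "\<exists>x\<in>carrier R. \<forall>s\<in>carrier R - p. s \<otimes>\<^bsub>R\<^esub> x \<noteq> \<zero>\<^bsub>R\<^esub>" if "primeideal p R" for p
  proof -
    have "\<zero>\<^bsub>R\<^esub> \<in> p" using that primeideal.axioms(1) ideal.axioms(1) additive_subgroup.zero_closed by blast
    then show ?thesis by (intro bexI[where x = "\<one>\<^bsub>R\<^esub>"]) auto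
  qed
  then show ?thesis
    by (auto simp: Supp_iff[OF module_regular_module[OF assms]] regular_module_simps)
qed

lemma Collect_triple_subset_iff:
  "{f x y z | x y z. x \<in> A \<and> y \<in> B \<and> z \<in> C} \<subseteq> W \<longleftrightarrow> (\<forall>x\<in>A. \<forall>y\<in>B. \<forall>z\<in>C. f x y z \<in> W)"
  by blast

section \<open>The tensor product as F / K, with \<open>e x y\<close> representing the pure tensor
  of x and y\<close>

locale module_pair = M: module R M + N: module R N
  for R :: "('r, 'k) ring_scheme" and M :: "('r, 'm, 'l) module_scheme"
    and N :: "('r, 'n, 'l2) module_scheme"
begin

definition F :: "('r, 'm \<times> 'n \<Rightarrow> 'r) module" where
  "F = free_module R (carrier M \<times> carrier N)"

definition K :: "('m \<times> 'n \<Rightarrow> 'r) set" where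
  "K = module_span R F (tensor_relations R M N)"

abbreviation e :: "'m \<Rightarrow> 'n \<Rightarrow> 'm \<times> 'n \<Rightarrow> 'r" where
  "e x y \<equiv> free_basis R (x, y)"

lemma tensor_module_eq: "tensor_module R M N = quotient_module F K"
  by (simp add: tensor_module_def F_def K_def Let_def)

lemma F_module: "module R F"
  unfolding F_def by (rule module_free_module[OF M.R.is_cring])

sublocale F: module R F by (rule F_module)

lemma e_closed: "x \<in> carrier M \<Longrightarrow> y \<in> carrier N \<Longrightarrow> e x y \<in> carrier F"
  unfolding F_def by (rule free_basis_closed[OF M.R.is_cring]) simp

lemma relations_subset:
  "tensor_relations R M N \<subseteq> W \<longleftrightarrow>
    (\<forall>x\<in>carrier M. \<forall>x'\<in>carrier M. \<forall>y\<in>carrier N. e (x \<oplus>\<^bsub>M\<^esub> x') y \<ominus>\<^bsub>F\<^esub> (e x y \<oplus>\<^bsub>F\<^esub> e x' y) \<in> W) \<and>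
    (\<forall>x\<in>carrier M. \<forall>y\<in>carrier N. \<forall>y'\<in>carrier N. e x (y \<oplus>\<^bsub>N\<^esub> y') \<ominus>\<^bsub>F\<^esub> (e x y \<oplus>\<^bsub>F\<^esub> e x y') \<in> W) \<and>
    (\<forall>r\<in>carrier R. \<forall>x\<in>carrier M. \<forall>y\<in>carrier N. e (r \<odot>\<^bsub>M\<^esub> x) y \<ominus>\<^bsub>F\<^esub> r \<odot>\<^bsub>F\<^esub> e x y \<in> W) \<and>
    (\<forall>r\<in>carrier R. \<forall>x\<in>carrier M. \<forall>y\<in>carrier N. e x (r \<odot>\<^bsub>N\<^esub> y) \<ominus>\<^bsub>F\<^esub> r \<odot>\<^bsub>F\<^esub> e x y \<in> W)"
  unfolding tensor_relations_def Let_def F_def[symmetric]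
  by (simp only: Un_subset_iff conj_assoc Collect_triple_subset_iff)

lemma relations_closed: "tensor_relations R M N \<subseteq> carrier F"
  unfolding relations_subset by (auto intro!: e_closed F.M.minus_closed F.M.a_closed F.smult_closed)

lemma K_submodule: "submodule K R F"
  and relations_sub_K: "tensor_relations R M N \<subseteq> K"
  unfolding K_def by (rule F.submodule_module_span[OF relations_closed])+

lemmas K_relations = relations_sub_K[unfolded relations_subset]

text \<open>Submodules W above K correspond to submodules of the tensor product. The bilinearity
  relations hold modulo K, so membership of pure tensors in W respects them.\<close>

lemma e_mem:
  assumes W: "submodule W R F" "K \<subseteq> W" and x: "x \<in> carrier M" and y: "y \<in> carrier N"
  shows "x' \<in> carrier M \<Longrightarrow> e x y \<in> W \<Longrightarrow> e x' y \<in> W \<Longrightarrow> e (x \<oplus>\<^bsub>M\<^esub> x') y \<in> W"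
    and "y' \<in> carrier N \<Longrightarrow> e x y \<in> W \<Longrightarrow> e x y' \<in> W \<Longrightarrow> e x (y \<oplus>\<^bsub>N\<^esub> y') \<in> W"
    and "r \<in> carrier R \<Longrightarrow> e (r \<odot>\<^bsub>M\<^esub> x) y \<in> W \<longleftrightarrow> r \<odot>\<^bsub>F\<^esub> e x y \<in> W"
    and "r \<in> carrier R \<Longrightarrow> e x (r \<odot>\<^bsub>N\<^esub> y) \<in> W \<longleftrightarrow> r \<odot>\<^bsub>F\<^esub> e x y \<in> W"
    and "e \<zero>\<^bsub>M\<^esub> y \<in> W" and "e x \<zero>\<^bsub>N\<^esub> \<in> W"
proof -
  note WE = F.submoduleE[OF W(1)]
  have cong: "u \<in> W \<longleftrightarrow> v \<in> W" if "u \<in> carrier F" "v \<in> carrier F" "u \<ominus>\<^bsub>F\<^esub> v \<in> K" for u v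
    by (rule F.submodule_cong[OF W(1)]) (use that W(2) in auto)
  have "e (x \<oplus>\<^bsub>M\<^esub> x') y \<ominus>\<^bsub>F\<^esub> (e x y \<oplus>\<^bsub>F\<^esub> e x' y) \<in> K" if "x' \<in> carrier M" for x'
    using K_relations x y that by blast
  from cong[OF _ _ this]
  show "x' \<in> carrier M \<Longrightarrow> e x y \<in> W \<Longrightarrow> e x' y \<in> W \<Longrightarrow> e (x \<oplus>\<^bsub>M\<^esub> x') y \<in> W"
    using WE(5) x y e_closed by simp
  have "e x (y \<oplus>\<^bsub>N\<^esub> y') \<ominus>\<^bsub>F\<^esub> (e x y \<oplus>\<^bsub>F\<^esub> e x y') \<in> K" if "y' \<in> carrier N" for y'
    using K_relations x y that by blast
  from cong[OF _ _ this]
  show "y' \<in> carrier N \<Longrightarrow> e x y \<in> W \<Longrightarrow> e x y' \<in> W \<Longrightarrow> e x (y \<oplus>\<^bsub>N\<^esub> y') \<in> W"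
    using WE(5) x y e_closed by simp
  have sM: "e (r \<odot>\<^bsub>M\<^esub> z) y \<in> W \<longleftrightarrow> r \<odot>\<^bsub>F\<^esub> e z y \<in> W" if "r \<in> carrier R" "z \<in> carrier M" for r z
    by (rule cong) (use K_relations that y in \<open>auto intro!: e_closed F.smult_closed\<close>)
  have sN: "e x (r \<odot>\<^bsub>N\<^esub> z) \<in> W \<longleftrightarrow> r \<odot>\<^bsub>F\<^esub> e x z \<in> W" if "r \<in> carrier R" "z \<in> carrier N" for r z
    by (rule cong) (use K_relations that x in \<open>auto intro!: e_closed F.smult_closed\<close>)
  show "r \<in> carrier R \<Longrightarrow> e (r \<odot>\<^bsub>M\<^esub> x) y \<in> W \<longleftrightarrow> r \<odot>\<^bsub>F\<^esub> e x y \<in> W" by (rule sM[OF _ x])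
  show "r \<in> carrier R \<Longrightarrow> e x (r \<odot>\<^bsub>N\<^esub> y) \<in> W \<longleftrightarrow> r \<odot>\<^bsub>F\<^esub> e x y \<in> W" by (rule sN[OF _ y])
  show "e \<zero>\<^bsub>M\<^esub> y \<in> W"
    using sM[of "\<zero>\<^bsub>R\<^esub>" "\<zero>\<^bsub>M\<^esub>"] F.submodule_zero[OF W(1)] e_closed[OF M.M.zero_closed y] by simp
  show "e x \<zero>\<^bsub>N\<^esub> \<in> W"
    using sN[of "\<zero>\<^bsub>R\<^esub>" "\<zero>\<^bsub>N\<^esub>"] F.submodule_zero[OF W(1)] e_closed[OF x N.M.zero_closed] by simp
qed

text \<open>Slices allow generators of M and of N to be used one variable at a time.\<close>

lemma slice_submodule_left:
  assumes "submodule W R F" "K \<subseteq> W" "y \<in> carrier N"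
  shows "submodule {x \<in> carrier M. e x y \<in> W} R M"
  using e_mem(1,3)[OF assms(1,2) _ assms(3)] e_mem(5)[OF assms(1,2) M.M.zero_closed assms(3)] F.submoduleE(4)[OF assms(1)]
  by (intro M.submodule_of_smult_closed) auto

lemma slice_submodule_right:
  assumes "submodule W R F" "K \<subseteq> W" "x \<in> carrier M"
  shows "submodule {y \<in> carrier N. e x y \<in> W} R N"
  using e_mem(2,4)[OF assms(1-3)] e_mem(6)[OF assms(1-3) N.M.zero_closed] F.submoduleE(4)[OF assms(1)]
  by (intro N.submodule_of_smult_closed) auto

lemma module_tensor_module: "module R (tensor_module R M N)"
  unfolding tensor_module_eq by (rule module_quotient_module[OF F_module K_submodule])

text \<open>Pure tensors of generators generate. A submodule V that contains them is pulled back to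
  a submodule of F above K, where the slices apply.\<close>

lemma finitely_generated_tensor_module:
  assumes "finitely_generated R M" "finitely_generated R N"
  shows "finitely_generated R (tensor_module R M N)"
proof -
  obtain A where A: "finite A" "A \<subseteq> carrier M" "module_span R M A = carrier M"
    using assms(1) unfolding finitely_generated_def by blast
  obtain B where B: "finite B" "B \<subseteq> carrier N" "module_span R N B = carrier N"
    using assms(2) unfolding finitely_generated_def by blast
  let ?T = "tensor_module R M N" and ?q = "\<lambda>u. K +>\<^bsub>F\<^esub> u"
  interpret T: module R ?T by (rule module_tensor_module)
  note q = quotient_module_coset[OF F_module K_submodule, folded tensor_module_eq]
  let ?S = "(\<lambda>(x, y). ?q (e x y)) ` (A \<times> B)"
  have S: "?S \<subseteq> carrier ?T" unfolding q(1)
    by (clarsimp intro!: imageI) (use A(2) B(2) e_closed in blast)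
  have "carrier ?T \<subseteq> V" if V: "submodule V R ?T" "?S \<subseteq> V" for V
  proof -
    note VE = T.submoduleE[OF V(1)]
    let ?W = "{u \<in> carrier F. ?q u \<in> V}"
    have W: "submodule ?W R F"
    proof (rule F.submodule_of_smult_closed)
      show "\<zero>\<^bsub>F\<^esub> \<in> ?W"
        using T.submodule_zero[OF V(1)] q(5)[OF F.M.zero_closed] F.submodule_zero[OF K_submodule]
        by (simp add: tensor_module_eq quotient_module_simps)
      show "u \<oplus>\<^bsub>F\<^esub> v \<in> ?W" if "u \<in> ?W" "v \<in> ?W" for u v
        using that VE(5)[of "?q u" "?q v"] q(2)[of u v] by simp
      show "r \<odot>\<^bsub>F\<^esub> u \<in> ?W" if "r \<in> carrier R" "u \<in> ?W" for r u
        using that VE(4)[of r "?q u"] q(3)[of r u] by simp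
    qed blast
    have KW: "K \<subseteq> ?W"
    proof
      fix u assume u: "u \<in> K"
      then have "u \<in> carrier F" by (rule submodule_carrier[OF K_submodule])
      then show "u \<in> ?W" using u q(5)[of u] T.submodule_zero[OF V(1)]
        by (simp add: tensor_module_eq quotient_module_simps)
    qed
    \<comment> \<open>The first variable is extended from A to M while y is still a generator from
      B.\<close>
    have 1: "carrier M \<subseteq> {x \<in> carrier M. e x y \<in> ?W}" if y: "y \<in> B" for y
    proof (rule module_span_carrierD[OF A(3) slice_submodule_left[OF W KW]])
      show "A \<subseteq> {x \<in> carrier M. e x y \<in> ?W}" using V(2) A(2) B(2) y e_closed[of _ y] by auto
    qed (use y B(2) in blast)
    \<comment> \<open>With all x available, the second variable extends from B to N.\<close>
    have 2: "carrier N \<subseteq> {y \<in> carrier N. e x y \<in> ?W}" if x: "x \<in> carrier M" for x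
    proof (rule module_span_carrierD[OF B(3) slice_submodule_right[OF W KW x]])
      show "B \<subseteq> {y \<in> carrier N. e x y \<in> ?W}" using 1 B(2) x by blast
    qed
    have "carrier F \<subseteq> ?W" unfolding F_def
      by (rule free_module_submodule_top[OF M.R.is_cring]) (use W 2 in \<open>auto simp: F_def\<close>)
    then show ?thesis using q(1) by auto
  qed
  then have "carrier ?T \<subseteq> module_span R ?T ?S" unfolding module_span_def by blast
  moreover have "module_span R ?T ?S \<subseteq> carrier ?T"
    using T.submoduleE(1)[OF T.submodule_module_span(1)[OF S]] .
  ultimately show ?thesis
    unfolding finitely_generated_def using A(1) B(1) S by (intro exI[where x = ?S]) auto
qed

text \<open>One s outside p kills M or N, hence all pure tensors. The colon submodule (K : s) then
  contains the basis of F and so is all of F.\<close>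

lemma Supp_tensor_module_subset:
  assumes "noetherian_module R M" "noetherian_module R N"
  shows "Supp R (tensor_module R M N) \<subseteq> Supp R M \<inter> Supp R N"
proof (rule subsetI, rule ccontr)
  fix p assume p: "p \<in> Supp R (tensor_module R M N)" and np: "p \<notin> Supp R M \<inter> Supp R N"
  obtain u where prime: "primeideal p R" and u: "u \<in> carrier F"
    "\<And>s. s \<in> carrier R - p \<Longrightarrow> s \<odot>\<^bsub>F\<^esub> u \<notin> K"
    using p unfolding tensor_module_eq Supp_quotient_module[OF F_module K_submodule] by blast
  have kill: "\<exists>s\<in>carrier R - p. \<forall>x\<in>carrier M. \<forall>y\<in>carrier N. s \<odot>\<^bsub>F\<^esub> e x y \<in> K"
  proof (cases "p \<in> Supp R M")
    case False
    then obtain s where s: "s \<in> carrier R - p" "\<And>x. x \<in> carrier M \<Longrightarrow> s \<odot>\<^bsub>M\<^esub> x = \<zero>\<^bsub>M\<^esub>"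
      using noetherian_module.uniform_annihilator[OF assms(1) prime] by blast
    have "s \<odot>\<^bsub>F\<^esub> e x y \<in> K" if "x \<in> carrier M" "y \<in> carrier N" for x y
      using e_mem(3)[OF K_submodule order_refl that, of s] e_mem(5)[OF K_submodule order_refl that] s that by simp
    then show ?thesis using s(1) by blast
  next
    case True
    then obtain s where s: "s \<in> carrier R - p" "\<And>y. y \<in> carrier N \<Longrightarrow> s \<odot>\<^bsub>N\<^esub> y = \<zero>\<^bsub>N\<^esub>"
      using noetherian_module.uniform_annihilator[OF assms(2) prime] np by blast
    have "s \<odot>\<^bsub>F\<^esub> e x y \<in> K" if "x \<in> carrier M" "y \<in> carrier N" for x y
      using e_mem(4)[OF K_submodule order_refl that, of s] e_mem(6)[OF K_submodule order_refl that] s that by simp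
    then show ?thesis using s(1) by blast
  qed
  then obtain s where s: "s \<in> carrier R - p" and se: "\<And>x y. x \<in> carrier M \<Longrightarrow> y \<in> carrier N \<Longrightarrow> s \<odot>\<^bsub>F\<^esub> e x y \<in> K"
    by blast
  have "carrier F \<subseteq> {u \<in> carrier F. s \<odot>\<^bsub>F\<^esub> u \<in> K}" unfolding F_def
  proof (rule free_module_submodule_top[OF M.R.is_cring], unfold F_def[symmetric])
    show "submodule {u \<in> carrier F. s \<odot>\<^bsub>F\<^esub> u \<in> K} R F"
      by (rule F.submodule_preimage_smult[OF K_submodule]) (use s in blast)
  qed (use se e_closed in auto)
  then show False using u s by blast
qed

text \<open>The functionals M -> R / p and N -> R / p multiply to a bilinear map, hence to a
  functional on the tensor product. At the tensor of a and b its value is nonzero in the domain R /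
  p.\<close>

lemma Supp_tensor_module_superset:
  assumes "noetherian_module R M" "noetherian_module R N"
  shows "Supp R M \<inter> Supp R N \<subseteq> Supp R (tensor_module R M N)"
proof
  fix p assume p: "p \<in> Supp R M \<inter> Supp R N"
  interpret NM: noetherian_module R M by fact
  interpret NN: noetherian_module R N by fact
  have prime: "primeideal p R" using p Supp_iff[OF M.module_axioms] by blast
  interpret p: primeideal p R by (rule prime)
  let ?P = "regular_module R"
  have P: "module R ?P" by (rule module_regular_module[OF M.R.is_cring])
  obtain \<rho> a where "\<forall>x\<in>carrier M. \<rho> x \<in> carrier R"
    and "\<forall>x\<in>carrier M. \<forall>y\<in>carrier M. \<rho> (x \<oplus>\<^bsub>M\<^esub> y) \<ominus>\<^bsub>R\<^esub> (\<rho> x \<oplus>\<^bsub>R\<^esub> \<rho> y) \<in> p"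
    and "\<forall>r\<in>carrier R. \<forall>x\<in>carrier M. \<rho> (r \<odot>\<^bsub>M\<^esub> x) \<ominus>\<^bsub>R\<^esub> r \<otimes>\<^bsub>R\<^esub> \<rho> x \<in> p"
    and a: "a \<in> carrier M" "\<rho> a \<notin> p"
    by (rule NM.Supp_functional[of p]) (use p in simp, rule that)
  note \<rho> = this(1-3)[rule_format]
  obtain \<sigma> b where "\<forall>x\<in>carrier N. \<sigma> x \<in> carrier R"
    and "\<forall>x\<in>carrier N. \<forall>y\<in>carrier N. \<sigma> (x \<oplus>\<^bsub>N\<^esub> y) \<ominus>\<^bsub>R\<^esub> (\<sigma> x \<oplus>\<^bsub>R\<^esub> \<sigma> y) \<in> p"
    and "\<forall>r\<in>carrier R. \<forall>x\<in>carrier N. \<sigma> (r \<odot>\<^bsub>N\<^esub> x) \<ominus>\<^bsub>R\<^esub> r \<otimes>\<^bsub>R\<^esub> \<sigma> x \<in> p"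
    and b: "b \<in> carrier N" "\<sigma> b \<notin> p"
    by (rule NN.Supp_functional[of p]) (use p in simp, rule that)
  note \<sigma> = this(1-3)[rule_format]
  \<comment> \<open>Bilinear only modulo p. The induced map g therefore goes from F to R, and what
    is shown is that it sends K into p.\<close>
  let ?\<phi> = "\<lambda>(x, y). \<rho> x \<otimes>\<^bsub>R\<^esub> \<sigma> y"
  define g where "g = free_lift R (carrier M \<times> carrier N) ?P ?\<phi>"
  have \<phi>: "?\<phi> \<in> carrier M \<times> carrier N \<rightarrow> carrier ?P"
    using \<rho>(1) \<sigma>(1) by (auto simp: regular_module_simps)
  have g: "g \<in> module_hom R F ?P" unfolding g_def F_def by (rule free_lift_hom[OF P \<phi>])
  have ge: "g (e x y) = \<rho> x \<otimes>\<^bsub>R\<^esub> \<sigma> y" if "x \<in> carrier M" "y \<in> carrier N" for x y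
    unfolding g_def using free_lift_basis[OF P \<phi>, of "(x, y)"] that by simp
  let ?W = "{u \<in> carrier F. g u \<in> p}"
  have gc: "g u \<in> carrier R" if "u \<in> carrier F" for u
    using module_hom_closed[OF g that] by (simp add: regular_module_simps)
  note g_hom = module_hom_add[OF g, unfolded regular_module_simps]
    module_hom_smult[OF g, unfolded regular_module_simps]
    module_hom_minus[OF F_module P g, unfolded regular_module_simps]
  have W: "submodule ?W R F"
    by (rule F.submodule_of_smult_closed)
       (use module_hom_zero[OF F_module P g] p.zero_closed p.I_l_closed in
         \<open>auto simp: regular_module_simps g_hom\<close>)
  have "tensor_relations R M N \<subseteq> ?W"
  proof (unfold relations_subset, intro conjI ballI)
    fix x x' y assume *: "x \<in> carrier M" "x' \<in> carrier M" "y \<in> carrier N"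
    have "(\<rho> (x \<oplus>\<^bsub>M\<^esub> x') \<ominus>\<^bsub>R\<^esub> (\<rho> x \<oplus>\<^bsub>R\<^esub> \<rho> x')) \<otimes>\<^bsub>R\<^esub> \<sigma> y \<in> p"
      using p.I_r_closed \<rho>(2)[OF *(1,2)] \<sigma>(1)[OF *(3)] by blast
    then show "e (x \<oplus>\<^bsub>M\<^esub> x') y \<ominus>\<^bsub>F\<^esub> (e x y \<oplus>\<^bsub>F\<^esub> e x' y) \<in> ?W"
      using * e_closed \<rho>(1) \<sigma>(1) by (simp add: g_hom ge M.R.minus_eq M.R.l_distr M.R.l_minus)
  next
    fix x y y' assume *: "x \<in> carrier M" "y \<in> carrier N" "y' \<in> carrier N"
    have "\<rho> x \<otimes>\<^bsub>R\<^esub> (\<sigma> (y \<oplus>\<^bsub>N\<^esub> y') \<ominus>\<^bsub>R\<^esub> (\<sigma> y \<oplus>\<^bsub>R\<^esub> \<sigma> y')) \<in> p"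
      using p.I_l_closed \<sigma>(2)[OF *(2,3)] \<rho>(1)[OF *(1)] by blast
    then show "e x (y \<oplus>\<^bsub>N\<^esub> y') \<ominus>\<^bsub>F\<^esub> (e x y \<oplus>\<^bsub>F\<^esub> e x y') \<in> ?W"
      using * e_closed \<rho>(1) \<sigma>(1) by (simp add: g_hom ge M.R.minus_eq M.R.r_distr M.R.r_minus)
  next
    fix r x y assume *: "r \<in> carrier R" "x \<in> carrier M" "y \<in> carrier N"
    have "(\<rho> (r \<odot>\<^bsub>M\<^esub> x) \<ominus>\<^bsub>R\<^esub> r \<otimes>\<^bsub>R\<^esub> \<rho> x) \<otimes>\<^bsub>R\<^esub> \<sigma> y \<in> p"
      using p.I_r_closed \<rho>(3)[OF *(1,2)] \<sigma>(1)[OF *(3)] by blast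
    then show "e (r \<odot>\<^bsub>M\<^esub> x) y \<ominus>\<^bsub>F\<^esub> r \<odot>\<^bsub>F\<^esub> e x y \<in> ?W"
      using * e_closed \<rho>(1) \<sigma>(1)
      by (simp add: g_hom ge M.R.minus_eq M.R.l_distr M.R.l_minus M.R.m_assoc)
  next
    fix r x y assume *: "r \<in> carrier R" "x \<in> carrier M" "y \<in> carrier N"
    have "\<rho> x \<otimes>\<^bsub>R\<^esub> (\<sigma> (r \<odot>\<^bsub>N\<^esub> y) \<ominus>\<^bsub>R\<^esub> r \<otimes>\<^bsub>R\<^esub> \<sigma> y) \<in> p"
      using p.I_l_closed \<sigma>(3)[OF *(1,3)] \<rho>(1)[OF *(2)] by blast
    then show "e x (r \<odot>\<^bsub>N\<^esub> y) \<ominus>\<^bsub>F\<^esub> r \<odot>\<^bsub>F\<^esub> e x y \<in> ?W"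
      using * e_closed \<rho>(1) \<sigma>(1)
      by (simp add: g_hom ge M.R.minus_eq M.R.r_distr M.R.r_minus M.R.m_lcomm)
  qed
  then have KW: "K \<subseteq> ?W" using W unfolding K_def module_span_def by blast
  have "s \<odot>\<^bsub>F\<^esub> e a b \<notin> K" if s: "s \<in> carrier R - p" for s
  proof
    assume "s \<odot>\<^bsub>F\<^esub> e a b \<in> K"
    then have "g (s \<odot>\<^bsub>F\<^esub> e a b) \<in> p" using KW by blast
    then have "s \<otimes>\<^bsub>R\<^esub> (\<rho> a \<otimes>\<^bsub>R\<^esub> \<sigma> b) \<in> p" using s a(1) b(1) e_closed by (simp add: g_hom ge)
    moreover have "s \<otimes>\<^bsub>R\<^esub> (\<rho> a \<otimes>\<^bsub>R\<^esub> \<sigma> b) \<in> carrier R - p"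
      by (intro p.complement_submonoid(2) s) (use \<rho>(1) \<sigma>(1) a b in auto)
    ultimately show False by blast
  qed
  then show "p \<in> Supp R (tensor_module R M N)"
    unfolding tensor_module_eq Supp_quotient_module[OF F_module K_submodule]
    using prime e_closed[OF a(1) b(1)] by blast
qed

end

theorem corollary2p9:
  fixes R :: "('r, 'k) ring_scheme"
    and M :: "('r, 'm, 'l) module_scheme"
    and N :: "('r, 'n, 'l2) module_scheme"
  assumes "local_ring R" and "noetherian_ring R"
    and "module R M" and "finitely_generated R M"
    and "module R N" and "finitely_generated R N"
  shows
    "(\<Union>i. Supp R (Ext R i (tensor_module R M N) (regular_module R))) =
       (\<Union>i. Supp R (Ext R i M N)) \<and>
     (\<Union>i. Supp R (Ext R i M N)) =
       (\<Union>i. Supp R (Ext R i M (regular_module R))) \<inter>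
       (\<Union>i. Supp R (Ext R i N (regular_module R))) \<and>
     (\<Union>i. Supp R (Ext R i M M)) =
       (\<Union>i. Supp R (Ext R i M (regular_module R)))"
proof -
  interpret module_pair R M N using assms(3,5) by (rule module_pair.intro)
  have cr: "cring R" by (rule M.R.is_cring)
  note noeth = M.noetherian_moduleI[OF assms(2,4)] N.noetherian_moduleI[OF assms(2,6)]
  have T: "Supp R (tensor_module R M N) = Supp R M \<inter> Supp R N"
    using Supp_tensor_module_subset[OF noeth] Supp_tensor_module_superset[OF noeth] by blast
  have sub: "Supp R M \<subseteq> {p. primeideal p R}" "Supp R N \<subseteq> {p. primeideal p R}"
    by (auto simp: Supp_def)
  note reg = module_regular_module[OF cr] finitely_generated_regular_module[OF cr]
  note UN = UN_Supp_Ext[OF assms(2)]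
  \<comment> \<open>Every union turns into an intersection of supports. The regular module
    contributes the set of all primes, which contains \<open>Supp R M\<close> and
    \<open>Supp R N\<close>.\<close>
  show ?thesis
    unfolding UN[OF module_tensor_module finitely_generated_tensor_module[OF assms(4,6)] reg]
      UN[OF assms(3-6)] UN[OF assms(3,4) reg] UN[OF assms(5,6) reg] UN[OF assms(3,4) assms(3,4)]
      T Supp_regular_module[OF cr]
    using sub by blast
qed

end
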